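(* Let $\nu>0$, $b\ge0$, $a,c\in\mathbb{R}$, $x_0^2:=a^2+4\nu b$, $k_m\ge0$, $\omega_m>0$ fixed, and $D^\infty=\{(\omega,k):\omega_m\le|\omega|<+\infty,\ k_m\le|k|<+\infty\}$. For small overlap $L>0$ the Ventcel best approximation problem $$\inf_{(p,q)\in\mathbb{C}^2}\sup_{(\omega,k)\in D^\infty}|\rho(\omega,k,p,q,L)|$$ has a unique solution $(p_{1,\infty}^*(L),q_{1,\infty}^*(L))$ with minimal value $\delta_{1,\infty}^*(L)$, and as $L\to0$ $$p_{1,\infty}^*(L)\sim\frac12\sqrt[5]{\frac{\nu A^4}{8L}},\qquad q_{1,\infty}^*(L)\sim4\sqrt[5]{\frac{\nu^2L^3}{2A^2}},\qquad \delta_{1,\infty}^*(L)\sim1-\frac{A}{2p_{1,\infty}^*(L)},$$ where $A$ is the constant defined in the context.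
   Context: This concerns the optimized Schwarz waveform relaxation algorithm for $\partial_t u+(a,c)\cdot\nabla u-\nu\Delta u+bu=f$ on $\mathbb{R}^2$, decomposed into $\Omega_1=(-\infty,L)\times\mathbb{R}$ and $\Omega_2=(0,\infty)\times\mathbb{R}$ ($L\ge0$ the overlap), with Ventcel transmission operators $(\nu\nabla-\tfrac{(a,c)^T}{2})\cdot n_i+\tfrac{s}{2}$, $s=p+q(\partial_t+c\partial_y-\nu\Delta_y)$; its convergence factor in Fourier variables $(\omega,k)$ is $$\rho(\omega,k,p,q,L)=\frac{p+q(\nu k^2+i(\omega+ck))-\sqrt{x_0^2+4\nu(\nu k^2+i(\omega+ck))}}{p+q(\nu k^2+i(\omega+ck))+\sqrt{x_0^2+4\nu(\nu k^2+i(\omega+ck))}}\,e^{-\frac{L}{2\nu}\sqrt{x_0^2+4\nu(\nu k^2+i(\omega+ck))}},$$ with $\sqrt{\cdot}$ the branch with positive real part. Define $$\bar k=|c|\frac{\sqrt{(c^2+x_0^2)^2+16\nu^2\omega_m^2}-(c^2+x_0^2)}{8\nu^2\omega_m},\qquad \varphi(k,\xi)=2\sqrt2\sqrt{\sqrt{(x_0^2+4\nu^2k^2)^2+16\nu^2\xi^2}+x_0^2+4\nu^2k^2},$$ and $A=\varphi(\bar k,-\omega_m+|c|\bar k)$ if $k_m\le\bar k$; $A=\varphi(k_m,-\omega_m+|c|k_m)$ if $\bar k\le k_m\le\omega_m/|c|$; $A=\varphi(k_m,0)$ if $k_m\ge\omega_m/|c|$. Standing assumption: either $x_0^2+4\nu^2k_m^2\ne0$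 or $\omega_m\ne0$. $\sim$ denotes asymptotic equivalence as $L\to0$. *)

theory Defs
  imports "HOL-Analysis.Analysis" "HOL-Library.Landau_Symbols"
begin

definition x0sq :: "real \<Rightarrow> real \<Rightarrow> real \<Rightarrow> real" where
  "x0sq nu a b = a^2 + 4 * nu * b"

text \<open>Convergence factor rho(omega,k,p,q,L); csqrt is the principal branch
  (positive real part on the relevant arguments).\<close>
definition rho :: "real \<Rightarrow> real \<Rightarrow> real \<Rightarrow> real \<Rightarrow> real \<Rightarrow> real \<Rightarrow> complex \<Rightarrow> complex \<Rightarrow> real \<Rightarrow> complex" where
  "rho nu a b c omega k p q L =
     (let z = complex_of_real (nu * k^2) + \<i> * complex_of_real (omega + c * k);
          S = csqrt (complex_of_real (x0sq nu a b) + 4 * complex_of_real nu * z)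
      in ((p + q * z - S) / (p + q * z + S)) * exp (- complex_of_real (L / (2 * nu)) * S))"

definition Dinf :: "real \<Rightarrow> real \<Rightarrow> (real \<times> real) set" where
  "Dinf km om = {(omega, k). om \<le> \<bar>omega\<bar> \<and> km \<le> \<bar>k\<bar>}"

text \<open>sup over D^infinity of |rho| (extended reals, to allow unbounded values).\<close>
definition supRho :: "real \<Rightarrow> real \<Rightarrow> real \<Rightarrow> real \<Rightarrow> real \<Rightarrow> real \<Rightarrow> complex \<Rightarrow> complex \<Rightarrow> real \<Rightarrow> ereal" where
  "supRho nu a b c km om p q L =
     (SUP wk \<in> Dinf km om. ereal (cmod (rho nu a b c (fst wk) (snd wk) p q L)))"

definition kbar :: "real \<Rightarrow> real \<Rightarrow> real \<Rightarrow> real \<Rightarrow> real \<Rightarrow> real" where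
  "kbar nu a b c om = \<bar>c\<bar> * (sqrt ((c^2 + x0sq nu a b)^2 + 16 * nu^2 * om^2) - (c^2 + x0sq nu a b))
                        / (8 * nu^2 * om)"

definition phi :: "real \<Rightarrow> real \<Rightarrow> real \<Rightarrow> real \<Rightarrow> real \<Rightarrow> real" where
  "phi nu a b k xi = 2 * sqrt 2 * sqrt (sqrt ((x0sq nu a b + 4 * nu^2 * k^2)^2 + 16 * nu^2 * xi^2)
                                        + x0sq nu a b + 4 * nu^2 * k^2)"

text \<open>The constant A. For c = 0 the threshold omega_m/|c| is +infinity.\<close>
definition Aconst :: "real \<Rightarrow> real \<Rightarrow> real \<Rightarrow> real \<Rightarrow> real \<Rightarrow> real \<Rightarrow> real" where
  "Aconst nu a b c km om =
     (let kb = kbar nu a b c om in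
      if km \<le> kb then phi nu a b kb (- om + \<bar>c\<bar> * kb)
      else if c = 0 \<or> km \<le> om / \<bar>c\<bar> then phi nu a b km (- om + \<bar>c\<bar> * km)
      else phi nu a b km 0)"

end

theory Submission
  imports Defs
begin

text \<open>
  Writing \<open>S\<close> for the square root in \<open>rho\<close>, the Ventcel symbol becomes \<open>s = P + Q S\<^sup>2\<close> with
  \<open>P = p - q x\<^sub>0\<^sup>2/(4\<nu>)\<close>, \<open>Q = q/(4\<nu>)\<close>, and \<open>|rho| \<le> \<delta>\<close> becomes
  \<open>|s - S| \<le> \<delta> exp (L Re S/(2\<nu>)) |s + S|\<close> on the set \<open>K\<close> of all \<open>S\<close>. This set lies in the sector
  \<open>|Im S| \<le> Re S\<close>, has \<open>min Re S = A/4\<close>, and reaches infinity along a hyperbola asymptotic to the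
  boundary of the sector.

  Put \<open>h = L\<^bsup>1/5\<^esup>\<close>, \<open>P = \<alpha>/h\<close>, \<open>Q = \<beta> h\<^sup>3\<close>, \<open>\<delta> = exp (- t h)\<close>. As \<open>h \<rightarrow> 0\<close>, the constraints at \<open>S\<close>
  of size \<open>1\<close>, \<open>h\<^bsup>-2\<^esup>\<close> and \<open>h\<^bsup>-4\<^esup>\<close> become \<open>t |\<alpha>|\<^sup>2 \<le> 2 m Re \<alpha>\<close>, \<open>t\<^sup>2 \<le> 8 Re \<alpha> Re \<beta>\<close> and
  \<open>\<nu> t\<^sup>2 |\<beta>|\<^sup>2 \<le> 2 Re \<beta>\<close> with \<open>m = A/4\<close>. They force \<open>t\<^sup>5 \<le> 32 m/\<nu>\<close>, and equality determines
  \<open>\<alpha>\<close> and \<open>\<beta>\<close>, which are real and positive. Together with the candidate built from these limits this localizes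
  every near-optimal pair.

  Near-optimal pairs therefore have \<open>|arg P|, |arg Q| < \<pi>/4\<close>. There \<open>|s - S| < |s + S|\<close>, so only the
  constraints whose right-hand factor is below 1 matter, and these confine \<open>s\<close> to a disc. Hence the midpoint of two
  optimal pairs has at most one active constraint, which can be relaxed by shifting \<open>P\<close>; so the optimum
  is unique.
\<close>

section \<open>Constraints for a single spectral value\<close>

text \<open>After squaring, \<open>s\<close> and \<open>S\<close> interact only through
  \<open>Re (s * cnj S)\<close>, so the constraint is a lower bound on that quantity. For
  \<open>r < 1\<close> it describes a closed disc of values \<open>s\<close>.\<close>

lemma cmod_diff_le_iff:
  assumes "r \<ge> 0"
  shows "cmod (s - S) \<le> r * cmod (s + S) \<longleftrightarrow>
    ((cmod s)\<^sup>2 + (cmod S)\<^sup>2) * (1 - r\<^sup>2) \<le> 2 * (1 + r\<^sup>2) * Re (s * cnj S)"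
proof -
  have "cmod (s - S) \<le> r * cmod (s + S) \<longleftrightarrow> (cmod (s - S))\<^sup>2 \<le> (r * cmod (s + S))\<^sup>2"
    using assms by (metis mult_nonneg_nonneg norm_ge_zero power2_le_imp_le power_mono)
  also have "\<dots> \<longleftrightarrow> ((cmod s)\<^sup>2 + (cmod S)\<^sup>2) * (1 - r\<^sup>2) \<le> 2 * (1 + r\<^sup>2) * Re (s * cnj S)"
    unfolding power_mult_distrib cmod_power2 by (simp add: algebra_simps power2_eq_square)
  finally show ?thesis .
qed

text \<open>This is tanh u \<le> u with the denominator cleared. The difference of the two sides
  vanishes at 0 and has derivative \<open>1 - exp (-2*x) * (1 + 2*x)\<close>, which is
  nonnegative.\<close>

lemma one_minus_exp_le:
  fixes u :: real
  assumes "u \<ge> 0"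
  shows "1 - (exp (-u))\<^sup>2 \<le> u * (1 + (exp (-u))\<^sup>2)"
proof -
  define f where "f = (\<lambda>x::real. x * (1 + exp (-2*x)) - (1 - exp (-2*x)))"
  have "f 0 \<le> f u"
  proof (rule DERIV_nonneg_imp_nondecreasing[OF assms])
    fix x :: real
    have "(f has_real_derivative (1 - exp (-2*x) * (1 + 2*x))) (at x)"
      unfolding f_def by (auto intro!: derivative_eq_intros simp: algebra_simps)
    moreover have "1 + 2*x \<le> exp (2*x)" by (rule exp_ge_add_one_self)
    hence "exp (-2*x) * (1 + 2*x) \<le> exp (-2*x) * exp (2*x)"
      by (intro mult_left_mono) auto
    hence "exp (-2*x) * (1 + 2*x) \<le> 1" by (simp flip: exp_add)
    ultimately show "\<exists>y. (f has_real_derivative y) (at x) \<and> 0 \<le> y" by force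
  qed
  thus ?thesis by (simp add: f_def flip: exp_double)
qed

text \<open>The exact condition has tanh u in place of \<open>u\<close>; enlarging it to
  \<open>u\<close> leaves a sufficient condition that is polynomial in the data.\<close>

lemma cmod_diff_le_expI:
  assumes "u \<ge> 0" and "Re (s * cnj S) \<ge> u / 2 * ((cmod s)\<^sup>2 + (cmod S)\<^sup>2)"
  shows "cmod (s - S) \<le> exp (-u) * cmod (s + S)"
proof -
  let ?N = "(cmod s)\<^sup>2 + (cmod S)\<^sup>2"
  have "?N * (1 - (exp (-u))\<^sup>2) \<le> ?N * (u * (1 + (exp (-u))\<^sup>2))"
    by (intro mult_left_mono one_minus_exp_le assms) auto
  also have "\<dots> = 2 * (1 + (exp (-u))\<^sup>2) * (u / 2 * ?N)" by simp
  also have "\<dots> \<le> 2 * (1 + (exp (-u))\<^sup>2) * Re (s * cnj S)"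
    by (intro mult_left_mono assms) (auto intro: add_nonneg_nonneg)
  finally show ?thesis by (subst cmod_diff_le_iff) auto
qed

text \<open>Lowering tanh u to \<open>u / (1 + u)\<close> gives a necessary condition. It agrees
  with the sufficient one to first order as \<open>u\<close> tends to 0, so nothing is lost in the
  limits below.\<close>

lemma cmod_diff_le_expD:
  assumes "u \<ge> 0" and "cmod (s - S) \<le> exp (-u) * cmod (s + S)"
  shows "u / (1 + u) / 2 * ((cmod s)\<^sup>2 + (cmod S)\<^sup>2) \<le> Re (s * cnj S)"
proof -
  let ?N = "(cmod s)\<^sup>2 + (cmod S)\<^sup>2"
  define E where "E = (exp (-u))\<^sup>2"
  have E: "E > 0" by (simp add: E_def)
  have "?N * (1 - E) \<le> 2 * (1 + E) * Re (s * cnj S)"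
    using assms(2) unfolding E_def by (subst (asm) cmod_diff_le_iff) auto
  hence 1: "?N * ((1 - E) / (2 * (1 + E))) \<le> Re (s * cnj S)"
    using E by (simp add: field_simps)
  have "1 + 2*u \<le> exp (2*u)" by (rule exp_ge_add_one_self)
  hence "E * (1 + 2*u) \<le> E * exp (2*u)" using E by (intro mult_left_mono) auto
  also have "E * exp (2*u) = 1" by (simp add: E_def flip: exp_double exp_add)
  finally have "u * (1 + E) \<le> (1 - E) * (1 + u)" by (simp add: algebra_simps)
  hence "u / (1 + u) / 2 \<le> (1 - E) / (2 * (1 + E))"
    using E assms(1) by (simp add: field_simps)
  hence "u / (1 + u) / 2 * ?N \<le> (1 - E) / (2 * (1 + E)) * ?N"
    by (intro mult_right_mono) auto
  with 1 show ?thesis by (simp add: mult.commute)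
qed

text \<open>The last three hypotheses are the limits of the constraints at the three scales. With
  \<open>a = Re \<alpha>\<close> and \<open>b = Re \<beta>\<close> they yield
  \<open>t * a \<le> 2 * m\<close>, \<open>t\<^sup>2 \<le> 8 * a * b\<close> and
  \<open>\<nu> * t\<^sup>2 * b \<le> 2\<close>; combined, these bound \<open>t ^ 5 * \<nu>\<close>
  by \<open>32 * m\<close>. Since \<open>t \<ge> \<kappa>\<close>, all are equalities, and the
  moduli in the first and third then leave no room for imaginary parts.\<close>

lemma equioscillation_limit_unique:
  fixes \<alpha> \<beta> :: complex and m \<nu> \<kappa> t :: real
  assumes pos: "m > 0" "\<nu> > 0" "\<kappa> > 0" and kappa: "\<kappa> ^ 5 * \<nu> = 32 * m" and "t \<ge> \<kappa>"
    and 1: "t / 2 * (cmod \<alpha>)\<^sup>2 \<le> m * Re \<alpha>"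
    and 2: "\<And>\<sigma>. \<sigma> > 0 \<Longrightarrow> t * \<sigma> \<le> Re \<alpha> + 2 * \<sigma>\<^sup>2 * Re \<beta>"
    and 3: "\<nu> * t\<^sup>2 / 2 * (cmod \<beta>)\<^sup>2 \<le> Re \<beta>"
  shows "t = \<kappa>" "\<alpha> = of_real (2 * m / \<kappa>)" "\<beta> = of_real (2 / (\<nu> * \<kappa>\<^sup>2))"
proof -
  define a b where "a = Re \<alpha>" and "b = Re \<beta>"
  have t: "t > 0" using assms by auto
  have "0 \<le> t / 2 * (cmod \<alpha>)\<^sup>2" using t by simp
  hence "0 \<le> m * a" using 1 unfolding a_def by linarith
  hence a0: "a \<ge> 0" using pos by (simp add: zero_le_mult_iff)
  have b0: "b \<ge> 0" using order.trans[OF _ 3, of 0] t pos by (simp add: b_def)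
  have bpos: "b > 0"
  proof (rule ccontr)
    assume "\<not> b > 0"
    with b0 have "b = 0" by simp
    \<comment> \<open>For \<open>b = 0\<close> this choice of \<sigma> would give
      \<open>a + 1 \<le> a\<close>.\<close>
    with 2[of "(a+1)/t"] a0 t show False by (simp add: a_def b_def)
  qed
  \<comment> \<open>The value \<open>\<sigma> = t / (4*b)\<close> minimizes
    \<open>2 * \<sigma>\<^sup>2 * b - t * \<sigma>\<close>, so the whole family of constraints
    reduces to this one.\<close>
  have "t * (t / (4*b)) \<le> a + 2 * (t / (4*b))\<^sup>2 * b"
    using 2[of "t/(4*b)"] t bpos by (simp add: a_def b_def)
  hence ab: "t\<^sup>2 \<le> 8 * a * b" using bpos by (simp add: field_simps power2_eq_square)
  have apos: "a > 0" using ab a0 t bpos by (cases "a = 0") auto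
  have "t / 2 * a\<^sup>2 \<le> t / 2 * (cmod \<alpha>)\<^sup>2" using t by (simp add: cmod_power2 a_def)
  hence "(t * a) * a \<le> (2 * m) * a" using 1 by (simp add: a_def power2_eq_square)
  hence ta: "t * a \<le> 2 * m" using apos by simp
  have "\<nu> * t\<^sup>2 / 2 * b\<^sup>2 \<le> \<nu> * t\<^sup>2 / 2 * (cmod \<beta>)\<^sup>2"
    using t pos by (simp add: cmod_power2 b_def)
  hence "(\<nu> * t\<^sup>2 * b) * b \<le> 2 * b" using 3 by (simp add: b_def power2_eq_square)
  hence tb: "\<nu> * t\<^sup>2 * b \<le> 2" using bpos by simp
  have prod: "t ^ 5 * \<nu> \<le> 8 * ((t * a) * (\<nu> * t\<^sup>2 * b))"
  proof -
    have "t ^ 5 * \<nu> = t\<^sup>2 * (\<nu> * t^3)" by (simp add: power_numeral_reduce)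
    also have "\<dots> \<le> (8 * a * b) * (\<nu> * t^3)"
      using ab t pos by (intro mult_right_mono) auto
    finally show ?thesis by (simp add: power_numeral_reduce algebra_simps)
  qed
  have "(t * a) * (\<nu> * t\<^sup>2 * b) \<le> (2 * m) * 2"
    using mult_mono[OF ta tb] t pos apos bpos by auto
  with prod have "t ^ 5 * \<nu> \<le> \<kappa> ^ 5 * \<nu>" using kappa by simp
  hence "t ^ 5 \<le> \<kappa> ^ 5" using pos by simp
  hence "t \<le> \<kappa>" using pos t by (simp add: power_mono_iff)
  with \<open>t \<ge> \<kappa>\<close> show tk: "t = \<kappa>" by simp
  \<comment> \<open>The product of the two factors attains its upper bound, hence so does each
    factor.\<close>
  have P4: "4 * m \<le> (t * a) * (\<nu> * t\<^sup>2 * b)" using prod kappa tk by (simp add: mult_ac)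
  have "(t * a) * (\<nu> * t\<^sup>2 * b) \<le> (t * a) * 2"
    using tb t apos by (intro mult_left_mono) auto
  with P4 ta have ta': "t * a = 2 * m" by simp
  have "2 * m * 2 \<le> 2 * m * (\<nu> * t\<^sup>2 * b)" using P4 ta' by simp
  hence "2 \<le> \<nu> * t\<^sup>2 * b" using pos by (metis mult_le_cancel_left_pos mult_pos_pos zero_less_numeral)
  with tb have tb': "\<nu> * t\<^sup>2 * b = 2" by simp
  have "t / 2 * a\<^sup>2 = (t * a) / 2 * a" by (simp add: power2_eq_square)
  also have "\<dots> = m * a" using ta' by simp
  finally have "t / 2 * (cmod \<alpha>)\<^sup>2 \<le> t / 2 * a\<^sup>2" using 1 by (simp only: a_def)
  hence "(cmod \<alpha>)\<^sup>2 \<le> a\<^sup>2" using t by simp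
  hence ia: "Im \<alpha> = 0" by (simp add: cmod_power2 a_def)
  have "\<nu> * t\<^sup>2 / 2 * b\<^sup>2 = (\<nu> * t\<^sup>2 * b) / 2 * b" by (simp add: power2_eq_square)
  also have "\<dots> = b" using tb' by simp
  finally have "\<nu> * t\<^sup>2 / 2 * (cmod \<beta>)\<^sup>2 \<le> \<nu> * t\<^sup>2 / 2 * b\<^sup>2"
    using 3 by (simp only: b_def)
  hence "(cmod \<beta>)\<^sup>2 \<le> b\<^sup>2" using t pos by simp
  hence ib: "Im \<beta> = 0" by (simp add: cmod_power2 b_def)
  have "a = 2 * m / \<kappa>" using ta' tk pos by (metis nonzero_mult_div_cancel_left less_irrefl)
  thus "\<alpha> = of_real (2 * m / \<kappa>)" using ia by (simp add: complex_eq_iff a_def)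
  have "b = 2 / (\<nu> * \<kappa>\<^sup>2)" using tb' tk pos
    by (metis nonzero_mult_div_cancel_left less_irrefl mult_pos_pos zero_less_power)
  thus "\<beta> = of_real (2 / (\<nu> * \<kappa>\<^sup>2))" using ib by (simp add: complex_eq_iff b_def)
qed

text \<open>As a function of \<open>s\<close>, the difference of squares is a real quadratic with
  leading part \<open>(1 - r\<^sup>2) * (cmod s)\<^sup>2\<close>. Its deviation from affine
  interpolation along a segment is therefore explicit, and it is strictly convex when
  \<open>r < 1\<close>.\<close>

lemma convex_combination_defect:
  fixes s w S :: complex and r t :: real
  shows "(cmod (s + of_real t * w - S))\<^sup>2 - r\<^sup>2 * (cmod (s + of_real t * w + S))\<^sup>2 =
    (1 - t) * ((cmod (s - S))\<^sup>2 - r\<^sup>2 * (cmod (s + S))\<^sup>2)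
    + t * ((cmod (s + w - S))\<^sup>2 - r\<^sup>2 * (cmod (s + w + S))\<^sup>2)
    - t * (1 - t) * (1 - r\<^sup>2) * (cmod w)\<^sup>2"
  unfolding cmod_power2 by (simp add: power2_eq_square algebra_simps)

text \<open>The admissible values form a disc, and the midpoint of two distinct points of a disc is
  interior.\<close>

lemma midpoint_strict:
  assumes "cmod (s1 - S) \<le> r * cmod (s1 + S)" "cmod (s2 - S) \<le> r * cmod (s2 + S)"
    and "0 \<le> r" "r < 1" "s1 \<noteq> s2"
  shows "cmod ((s1 + s2) / 2 - S) < r * cmod ((s1 + s2) / 2 + S)"
proof -
  have g: "(cmod (s - S))\<^sup>2 - r\<^sup>2 * (cmod (s + S))\<^sup>2 \<le> 0" if "cmod (s - S) \<le> r * cmod (s + S)" for s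
    using power_mono[OF that, of 2] by (simp add: power_mult_distrib)
  have "s1 + of_real (1/2) * (s2 - s1) = (s1 + s2) / 2" by (simp add: field_simps)
  moreover have "s1 + (s2 - s1) = s2" by simp
  ultimately have eq: "(cmod ((s1 + s2) / 2 - S))\<^sup>2 - r\<^sup>2 * (cmod ((s1 + s2) / 2 + S))\<^sup>2 =
    (1 - 1 / 2) * ((cmod (s1 - S))\<^sup>2 - r\<^sup>2 * (cmod (s1 + S))\<^sup>2)
    + 1 / 2 * ((cmod (s2 - S))\<^sup>2 - r\<^sup>2 * (cmod (s2 + S))\<^sup>2)
    - 1 / 2 * (1 - 1 / 2) * (1 - r\<^sup>2) * (cmod (s2 - s1))\<^sup>2"
    using convex_combination_defect[of s1 "1/2" "s2 - s1" S r] by (simp only:)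
  have "1 / 2 * (1 - 1 / 2) * (1 - r\<^sup>2) * (cmod (s2 - s1))\<^sup>2 > 0"
  proof -
    have "r\<^sup>2 < 1" using assms by (simp add: abs_square_less_1)
    thus ?thesis using assms by (intro mult_pos_pos) auto
  qed
  moreover have "x = (1 - 1 / 2) * p + 1 / 2 * q - d \<Longrightarrow> p \<le> 0 \<Longrightarrow> q \<le> 0 \<Longrightarrow> 0 < d \<Longrightarrow> x < 0"
    for x p q d :: real by simp
  ultimately have "(cmod ((s1 + s2) / 2 - S))\<^sup>2 - r\<^sup>2 * (cmod ((s1 + s2) / 2 + S))\<^sup>2 < 0"
    using eq g[OF assms(1)] g[OF assms(2)] by blast
  hence "(cmod ((s1 + s2) / 2 - S))\<^sup>2 < (r * cmod ((s1 + s2) / 2 + S))\<^sup>2" by (simp add: power_mult_distrib)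
  thus ?thesis by (rule power2_less_imp_less) (use assms in auto)
qed

text \<open>\<open>A\<close> and \<open>B\<close> normalize \<open>S\<close> and \<open>s\<close> to
  finite limits, while \<open>u\<close> has the size of \<open>h\<close>. Multiplying the necessary
  condition by \<open>A n * B n\<close> shows that \<open>c\<close> and \<open>d\<close> decide
  which of the two squared moduli survives; their product is the limit of \<open>h\<^sup>2\<close>,
  so at most one does.\<close>

lemma rescaled_constraint_limit:
  fixes s S :: "nat \<Rightarrow> complex" and h u A B :: "nat \<Rightarrow> real"
  assumes h: "h \<longlonglongrightarrow> 0" "\<And>n. h n > 0"
    and le: "\<forall>\<^sub>F n in sequentially. cmod (s n - S n) \<le> exp (- u n) * cmod (s n + S n)"
    and u: "(\<lambda>n. u n / h n) \<longlonglongrightarrow> v" "v > 0"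
    and AB: "\<And>n. A n > 0" "\<And>n. B n > 0"
    and S: "(\<lambda>n. of_real (A n) * S n) \<longlonglongrightarrow> S'" and s: "(\<lambda>n. of_real (B n) * s n) \<longlonglongrightarrow> s'"
    and c: "(\<lambda>n. h n * A n / B n) \<longlonglongrightarrow> c" and d: "(\<lambda>n. h n * B n / A n) \<longlonglongrightarrow> d"
  shows "v / 2 * (c * (cmod s')\<^sup>2 + d * (cmod S')\<^sup>2) \<le> Re (s' * cnj S')"
proof (rule tendsto_le[OF sequentially_bot])
  have "(\<lambda>n. u n / h n * h n) \<longlonglongrightarrow> v * 0" by (intro tendsto_mult u h)
  moreover have "u n / h n * h n = u n" for n using h(2)[of n] by simp
  ultimately have u0: "u \<longlonglongrightarrow> 0" by simp
  have "(\<lambda>n. (u n / h n) / (1 + u n) / 2 * (h n * A n / B n * (cmod (of_real (B n) * s n))\<^sup>2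
      + h n * B n / A n * (cmod (of_real (A n) * S n))\<^sup>2))
      \<longlonglongrightarrow> v / (1 + 0) / 2 * (c * (cmod s')\<^sup>2 + d * (cmod S')\<^sup>2)"
    by (intro tendsto_intros u u0 c d s S) auto
  thus "(\<lambda>n. (u n / h n) / (1 + u n) / 2 * (h n * A n / B n * (cmod (of_real (B n) * s n))\<^sup>2
      + h n * B n / A n * (cmod (of_real (A n) * S n))\<^sup>2))
      \<longlonglongrightarrow> v / 2 * (c * (cmod s')\<^sup>2 + d * (cmod S')\<^sup>2)" by simp
  show "(\<lambda>n. Re ((of_real (B n) * s n) * cnj (of_real (A n) * S n))) \<longlonglongrightarrow> Re (s' * cnj S')"
    by (intro tendsto_intros s S)
  have "\<forall>\<^sub>F n in sequentially. u n / h n > 0" using u by (rule order_tendstoD)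
  with le have "\<forall>\<^sub>F n in sequentially. u n / h n > 0 \<and> cmod (s n - S n) \<le> exp (- u n) * cmod (s n + S n)"
    by eventually_elim simp
  thus "\<forall>\<^sub>F n in sequentially. (u n / h n) / (1 + u n) / 2 * (h n * A n / B n * (cmod (of_real (B n) * s n))\<^sup>2
      + h n * B n / A n * (cmod (of_real (A n) * S n))\<^sup>2)
      \<le> Re ((of_real (B n) * s n) * cnj (of_real (A n) * S n))"
  proof eventually_elim
    case (elim n)
    note pos = h(2)[of n] AB[of n]
    from elim pos have un: "u n > 0" by (simp add: zero_less_divide_iff)
    have "u n / (1 + u n) / 2 * ((cmod (s n))\<^sup>2 + (cmod (S n))\<^sup>2) \<le> Re (s n * cnj (S n))"
      using un elim by (intro cmod_diff_le_expD) auto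
    hence "A n * B n * (u n / (1 + u n) / 2 * ((cmod (s n))\<^sup>2 + (cmod (S n))\<^sup>2))
       \<le> A n * B n * Re (s n * cnj (S n))" using pos by (intro mult_left_mono) auto
    also have "A n * B n * (u n / (1 + u n) / 2 * ((cmod (s n))\<^sup>2 + (cmod (S n))\<^sup>2)) =
      (u n / h n) / (1 + u n) / 2 * (h n * A n / B n * (cmod (of_real (B n) * s n))\<^sup>2
      + h n * B n / A n * (cmod (of_real (A n) * S n))\<^sup>2)"
    proof -
      have "h n * A n / B n * (cmod (of_real (B n) * s n))\<^sup>2 = h n * (A n * B n * (cmod (s n))\<^sup>2)"
        "h n * B n / A n * (cmod (of_real (A n) * S n))\<^sup>2 = h n * (A n * B n * (cmod (S n))\<^sup>2)"
        using pos by (auto simp: norm_mult power_mult_distrib power2_eq_square)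
      moreover have "A n * B n * (v * (x + y)) = (v / h n) * (h n * (A n * B n * x) + h n * (A n * B n * y))" for v x y
        using pos by (simp add: field_simps)
      moreover have "u n / h n / (1 + u n) / 2 = u n / (1 + u n) / 2 / h n" by simp
      ultimately show ?thesis by (simp only:)
    qed
    also have "A n * B n * Re (s n * cnj (S n)) = Re ((of_real (B n) * s n) * cnj (of_real (A n) * S n))"
      by (simp add: algebra_simps)
    finally show ?case .
  qed
qed

lemma Bseq_diff:
  fixes f g :: "nat \<Rightarrow> 'a::real_normed_vector"
  assumes "Bseq f" "Bseq g"
  shows "Bseq (\<lambda>n. f n - g n)"
proof -
  obtain A B where "\<And>n. norm (f n) \<le> A" "\<And>n. norm (g n) \<le> B"
    using assms unfolding Bseq_def by auto
  hence "norm (f n - g n) \<le> A + B" for n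
    by (meson add_mono norm_triangle_ineq4 order_trans)
  thus ?thesis by (rule BseqI')
qed

text \<open>Since \<open>Re (s * cnj S)\<close> is at most the product of the moduli, the necessary
  condition bounds \<open>cmod s\<close> by a multiple of \<open>cmod S / u\<close>, and
  \<open>u\<close> is comparable to \<open>h\<close>.\<close>

lemma rescaled_constraint_Bseq:
  fixes s S :: "nat \<Rightarrow> complex" and h u A :: "nat \<Rightarrow> real"
  assumes h: "h \<longlonglongrightarrow> 0" "\<And>n. h n > 0"
    and le: "\<forall>\<^sub>F n in sequentially. cmod (s n - S n) \<le> exp (- u n) * cmod (s n + S n)"
    and u: "(\<lambda>n. u n / h n) \<longlonglongrightarrow> v" "v > 0"
    and A: "\<And>n. A n > 0" and S: "(\<lambda>n. of_real (A n) * S n) \<longlonglongrightarrow> S'"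
  shows "Bseq (\<lambda>n. of_real (h n * A n) * s n)"
proof -
  have "(\<lambda>n. u n / h n * h n) \<longlonglongrightarrow> v * 0" by (intro tendsto_mult u h)
  moreover have "u n / h n * h n = u n" for n using h(2)[of n] by simp
  ultimately have u0: "u \<longlonglongrightarrow> 0" by simp
  have "(\<lambda>n. 2 * (1 + u n) / (u n / h n) * cmod (of_real (A n) * S n)) \<longlonglongrightarrow> 2 * (1 + 0) / v * cmod S'"
    using u(2) by (intro tendsto_intros u u0 S) auto
  hence B: "Bseq (\<lambda>n. 2 * (1 + u n) / (u n / h n) * cmod (of_real (A n) * S n))"
    by (rule convergent_imp_Bseq[OF convergentI])
  have "\<forall>\<^sub>F n in sequentially. u n / h n > 0" using u by (rule order_tendstoD)
  with le have "\<forall>\<^sub>F n in sequentially. u n / h n > 0 \<and> cmod (s n - S n) \<le> exp (- u n) * cmod (s n + S n)"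
    by eventually_elim simp
  hence "\<forall>\<^sub>F n in sequentially. norm (of_real (h n * A n) * s n)
     \<le> norm (2 * (1 + u n) / (u n / h n) * cmod (of_real (A n) * S n))"
  proof eventually_elim
    case (elim n)
    note pos = h(2)[of n] A[of n]
    from elim pos have un: "u n > 0" by (simp add: zero_less_divide_iff)
    have "u n / (1 + u n) / 2 * ((cmod (s n))\<^sup>2 + (cmod (S n))\<^sup>2) \<le> Re (s n * cnj (S n))"
      using un elim by (intro cmod_diff_le_expD) auto
    also have "\<dots> \<le> cmod (s n) * cmod (S n)"
      using complex_Re_le_cmod[of "s n * cnj (S n)"] by (simp add: norm_mult)
    finally have "u n / (1 + u n) / 2 * (cmod (s n))\<^sup>2 + u n / (1 + u n) / 2 * (cmod (S n))\<^sup>2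
        \<le> cmod (s n) * cmod (S n)" by (simp only: distrib_left)
    moreover have "0 \<le> u n / (1 + u n) / 2 * (cmod (S n))\<^sup>2" using un by simp
    ultimately have "(u n / (1 + u n) / 2 * cmod (s n)) * cmod (s n) \<le> cmod (S n) * cmod (s n)"
      by (simp add: power2_eq_square mult_ac)
    hence "u n / (1 + u n) / 2 * cmod (s n) \<le> cmod (S n)"
      by (cases "s n = 0") (auto intro: mult_right_le_imp_le)
    hence "cmod (s n) \<le> 2 * (1 + u n) / u n * cmod (S n)" using un by (simp add: field_simps)
    hence "h n * A n * cmod (s n) \<le> h n * A n * (2 * (1 + u n) / u n * cmod (S n))"
      using pos by (intro mult_left_mono) auto
    thus ?case using pos un by (simp add: norm_mult abs_mult field_simps)
  qed
  thus ?thesis using B by (rule Bseq_eventually_mono)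
qed

section \<open>Localization of near-optimal parameters\<close>

text \<open>These are the features of the set of square roots from which the optimization is carried
  out. Conjugate symmetry eliminates imaginary parts of the limiting parameters, \<open>S0\<close>
  realizes the least real part, the hyperbola provides points of every large size, and compactness
  of bounded pieces makes extrema attained.\<close>

locale sector_set =
  fixes K :: "complex set" and \<nu> m X0 Y0 :: real and S0 :: complex
  assumes nu_pos: "\<nu> > 0" and m_pos: "m > 0" and X0_nonneg: "X0 \<ge> 0"
    and sector: "\<And>S. S \<in> K \<Longrightarrow> \<bar>Im S\<bar> \<le> Re S"
    and m_le: "\<And>S. S \<in> K \<Longrightarrow> m \<le> Re S"
    and cnj_mem: "\<And>S. S \<in> K \<Longrightarrow> cnj S \<in> K"
    and S0: "S0 \<in> K" "Re S0 = m"
    and hyperbola_mem: "\<And>y. y \<ge> Y0 \<Longrightarrow> Complex (sqrt (X0 + y\<^sup>2)) y \<in> K"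
    and compact_K: "\<And>R. compact (K \<inter> cball 0 R)"
begin

text \<open>Denominator and exponential of \<open>rho\<close> are multiplied out, so zeros of
  \<open>P + Q * S\<^sup>2 + S\<close> require no exception and the condition is closed in all
  parameters.\<close>

definition feas :: "real \<Rightarrow> real \<Rightarrow> complex \<Rightarrow> complex \<Rightarrow> bool" where
  "feas L \<delta> P Q \<longleftrightarrow> (\<forall>S\<in>K. cmod (P + Q * S\<^sup>2 - S) \<le> \<delta> * exp (L / (2*\<nu>) * Re S) * cmod (P + Q * S\<^sup>2 + S))"

text \<open>This constant and the next two solve the limiting constraints with equality: \<kappa>
  \<alpha> = 2 m, \<nu> \<kappa>^2 \<beta> = 2 and \<kappa>^2 = 8 \<alpha> \<beta>.\<close>

definition kappa_opt :: real where "kappa_opt = root 5 (32 * m / \<nu>)"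
definition alpha_opt :: real where "alpha_opt = 2 * m / kappa_opt"
definition beta_opt :: real where "beta_opt = 2 / (\<nu> * kappa_opt\<^sup>2)"

lemma kappa_opt_pos: "kappa_opt > 0" using nu_pos m_pos by (simp add: kappa_opt_def)

lemma kappa_opt_power5: "kappa_opt ^ 5 * \<nu> = 32 * m"
  using nu_pos m_pos by (simp add: kappa_opt_def)

lemma feas_mono: "feas L \<delta> P Q \<Longrightarrow> \<delta> \<le> \<delta>' \<Longrightarrow> feas L \<delta>' P Q"
  unfolding feas_def by (meson exp_ge_zero mult_right_mono norm_ge_zero order_trans)

lemma feas_expD:
  assumes "feas (h ^ 5) (exp (-(t * h))) P Q" "S \<in> K"
  shows "cmod (P + Q * S\<^sup>2 - S) \<le> exp (-(t * h - h ^ 5 / (2*\<nu>) * Re S)) * cmod (P + Q * S\<^sup>2 + S)"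
  using assms unfolding feas_def by (auto simp: exp_diff exp_minus field_simps)

section \<open>Limits of the constraints along a sequence of feasible parameters\<close>

context
  fixes h t :: "nat \<Rightarrow> real" and \<alpha> \<beta> :: "nat \<Rightarrow> complex" and t' :: real
  assumes h: "h \<longlonglongrightarrow> 0" "\<And>n. h n > 0" and t: "t \<longlonglongrightarrow> t'" "t' \<ge> kappa_opt"
    and F: "\<And>n. feas (h n ^ 5) (exp (-(t n * h n))) (\<alpha> n / of_real (h n)) (\<beta> n * of_real (h n) ^ 3)"
begin

lemma h_nonzero [simp]: "h n \<noteq> 0" using h(2)[of n] by simp

lemma t'_pos: "t' > 0" using t kappa_opt_pos by auto

abbreviation "sv n S \<equiv> \<alpha> n / of_real (h n) + \<beta> n * of_real (h n) ^ 3 * S\<^sup>2"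
abbreviation "uu n S \<equiv> t n * h n - h n ^ 5 / (2*\<nu>) * Re S"

text \<open>The overlap enters the rescaled exponent only through \<open>h ^ 4 * Re S\<close>, so
  its damping is felt in the limit exactly at points of size \<open>1 / h ^ 4\<close>.\<close>

lemma uu_limit:
  assumes "(\<lambda>n. of_real (h n ^ 4) * S n) \<longlonglongrightarrow> S'"
  shows "(\<lambda>n. uu n (S n) / h n) \<longlonglongrightarrow> t' - Re S' / (2*\<nu>)"
proof -
  have "(\<lambda>n. t n - Re (of_real (h n ^ 4) * S n) / (2*\<nu>)) \<longlonglongrightarrow> t' - Re S' / (2*\<nu>)"
    using nu_pos by (intro tendsto_intros t assms) auto
  moreover have "t n - Re (of_real (h n ^ 4) * S n) / (2*\<nu>) = uu n (S n) / h n" for n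
    using h(2)[of n] by (simp add: field_simps power_numeral_reduce flip: of_real_power)
  ultimately show ?thesis by simp
qed

lemma h_power_tendsto: "k > 0 \<Longrightarrow> (\<lambda>n. h n ^ k) \<longlonglongrightarrow> 0"
  using tendsto_power[OF h(1), of k] by (simp add: power_0_left)

lemma of_real_h_power_tendsto: "k > 0 \<Longrightarrow> (\<lambda>n. complex_of_real (h n) ^ k) \<longlonglongrightarrow> 0"
  using tendsto_of_real[OF h_power_tendsto, of k] by simp

lemma uu_limit_const: "(\<lambda>n. uu n S / h n) \<longlonglongrightarrow> t'"
proof -
  have "(\<lambda>n. of_real (h n ^ 4) * S) \<longlonglongrightarrow> of_real 0 * S"
    by (intro tendsto_intros h_power_tendsto) auto
  from uu_limit[OF this] show ?thesis by simp
qed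

text \<open>A point of the hyperbola at height \<open>\<sigma> / h ^ j\<close>; \<open>j = 2\<close>
  and \<open>j = 4\<close> are the two large scales that occur.\<close>

definition hyp :: "nat \<Rightarrow> nat \<Rightarrow> real \<Rightarrow> complex" where
  "hyp j n \<sigma> = Complex (sqrt (X0 + (\<sigma> / h n ^ j)\<^sup>2)) (\<sigma> / h n ^ j)"

text \<open>After rescaling, \<open>X0\<close> becomes negligible and the hyperbola collapses onto
  its asymptote, the diagonal.\<close>

lemma hyp_limit:
  assumes "j > 0" "\<sigma> > 0"
  shows "(\<lambda>n. of_real (h n ^ j) * hyp j n \<sigma>) \<longlonglongrightarrow> Complex \<sigma> \<sigma>"
proof -
  have "(\<lambda>n. Complex (sqrt (X0 * (h n ^ j)\<^sup>2 + \<sigma>\<^sup>2)) \<sigma>) \<longlonglongrightarrow> Complex (sqrt (X0 * 0\<^sup>2 + \<sigma>\<^sup>2)) \<sigma>"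
    using assms by (intro tendsto_intros tendsto_Complex h_power_tendsto) auto
  moreover have "Complex (sqrt (X0 * (h n ^ j)\<^sup>2 + \<sigma>\<^sup>2)) \<sigma> = of_real (h n ^ j) * hyp j n \<sigma>" for n
  proof -
    have hp: "h n ^ j > 0" using h(2)[of n] by simp
    have "X0 * (h n ^ j)\<^sup>2 + \<sigma>\<^sup>2 = (h n ^ j)\<^sup>2 * (X0 + (\<sigma> / h n ^ j)\<^sup>2)"
      using hp by (simp add: field_simps)
    hence "sqrt (X0 * (h n ^ j)\<^sup>2 + \<sigma>\<^sup>2) = h n ^ j * sqrt (X0 + (\<sigma> / h n ^ j)\<^sup>2)"
      using hp by (simp add: real_sqrt_mult)
    thus ?thesis using h(2)[of n] by (simp add: hyp_def complex_eq_iff del: of_real_power)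
  qed
  ultimately show ?thesis using assms by simp
qed

lemma hyp_mem:
  assumes "j > 0" "\<sigma> > 0"
  shows "\<forall>\<^sub>F n in sequentially. hyp j n \<sigma> \<in> K"
proof -
  have "(\<lambda>n. Y0 * h n ^ j) \<longlonglongrightarrow> Y0 * 0" using assms by (intro tendsto_intros h_power_tendsto)
  hence "\<forall>\<^sub>F n in sequentially. Y0 * h n ^ j < \<sigma>" using assms by (intro order_tendstoD) auto
  thus ?thesis
  proof eventually_elim
    case (elim n)
    hence "\<sigma> / h n ^ j \<ge> Y0" using h(2)[of n] by (simp add: field_simps)
    thus ?case unfolding hyp_def by (rule hyperbola_mem)
  qed
qed

lemma eventually_constraint:
  assumes "\<forall>\<^sub>F n in sequentially. S n \<in> K"
  shows "\<forall>\<^sub>F n in sequentially. cmod (sv n (S n) - S n) \<le> exp (- uu n (S n)) * cmod (sv n (S n) + S n)"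
  using assms by eventually_elim (rule feas_expD[OF F])

context
  fixes a b :: complex
  assumes \<alpha>: "\<alpha> \<longlonglongrightarrow> a" and \<beta>: "\<beta> \<longlonglongrightarrow> b"
begin

text \<open>At a fixed \<open>S\<close> the symbol has size \<open>1 / h\<close> and is dominated by
  its constant part, so \<open>(cmod a)\<^sup>2\<close> survives and \<open>(cmod S)\<^sup>2\<close>
  disappears.\<close>

lemma limit_constraint_fixed:
  assumes "S \<in> K"
  shows "t' / 2 * (cmod a)\<^sup>2 \<le> Re (a * cnj S)"
proof -
  have "(\<lambda>n. \<alpha> n + \<beta> n * of_real (h n) ^ 4 * S\<^sup>2) \<longlonglongrightarrow> a + b * 0 * S\<^sup>2"
    by (intro tendsto_intros \<alpha> \<beta> of_real_h_power_tendsto) auto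
  moreover have "\<alpha> n + \<beta> n * of_real (h n) ^ 4 * S\<^sup>2 = of_real (h n) * sv n S" for n
    using h(2)[of n] by (simp add: field_simps power_numeral_reduce)
  ultimately have s: "(\<lambda>n. of_real (h n) * sv n S) \<longlonglongrightarrow> a" by simp
  have d: "(\<lambda>n. h n * h n / 1) \<longlonglongrightarrow> 0" using h_power_tendsto[of 2] by (simp add: power2_eq_square)
  have c: "(\<lambda>n. h n * 1 / h n) \<longlonglongrightarrow> 1"
  proof -
    have "(\<lambda>n. h n * 1 / h n) = (\<lambda>n. 1)" using h(2) by (auto simp: less_imp_neq[symmetric])
    thus ?thesis by simp
  qed
  have "t' / 2 * (1 * (cmod a)\<^sup>2 + 0 * (cmod S)\<^sup>2) \<le> Re (a * cnj S)"
    by (rule rescaled_constraint_limit[OF h eventually_constraint[of "\<lambda>n. S"] uu_limit_const t'_pos _ _ _ s c d])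
       (use assms h in auto)
  thus ?thesis by simp
qed

text \<open>At size \<open>1 / h\<^sup>2\<close> both parts of the symbol have size
  \<open>1 / h\<close>, which is small against \<open>S\<close>; only the square of
  \<open>S'\<close> survives.\<close>

lemma limit_constraint_middle:
  assumes K: "\<forall>\<^sub>F n in sequentially. S n \<in> K" and S: "(\<lambda>n. of_real (h n ^ 2) * S n) \<longlonglongrightarrow> S'"
  shows "t' / 2 * (cmod S')\<^sup>2 \<le> Re ((a + b * S'\<^sup>2) * cnj S')"
proof -
  have "(\<lambda>n. \<alpha> n + \<beta> n * (of_real (h n ^ 2) * S n)\<^sup>2) \<longlonglongrightarrow> a + b * S'\<^sup>2"
    by (intro tendsto_intros \<alpha> \<beta> S)
  moreover have "\<alpha> n + \<beta> n * (of_real (h n ^ 2) * S n)\<^sup>2 = of_real (h n) * sv n (S n)" for n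
    using h(2)[of n] by (simp add: field_simps power_numeral_reduce)
  ultimately have s: "(\<lambda>n. of_real (h n) * sv n (S n)) \<longlonglongrightarrow> a + b * S'\<^sup>2" by simp
  have "(\<lambda>n. of_real (h n ^ 2) * (of_real (h n ^ 2) * S n)) \<longlonglongrightarrow> of_real 0 * S'"
    by (intro tendsto_intros S h_power_tendsto) auto
  hence "(\<lambda>n. of_real (h n ^ 4) * S n) \<longlonglongrightarrow> 0" by (simp add: mult.assoc[symmetric] flip: power_add)
  from uu_limit[OF this] have u: "(\<lambda>n. uu n (S n) / h n) \<longlonglongrightarrow> t'" by simp
  have c: "(\<lambda>n. h n * h n ^ 2 / h n) \<longlonglongrightarrow> 0"
  proof -
    have "(\<lambda>n. h n * h n ^ 2 / h n) = (\<lambda>n. h n ^ 2)" using h(2) by (auto simp: less_imp_neq[symmetric])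
    thus ?thesis using h_power_tendsto[of 2] by simp
  qed
  have d: "(\<lambda>n. h n * h n / h n ^ 2) \<longlonglongrightarrow> 1"
  proof -
    have "(\<lambda>n. h n * h n / h n ^ 2) = (\<lambda>n. 1)"
      using h(2) by (auto simp: power2_eq_square less_imp_neq[symmetric])
    thus ?thesis by simp
  qed
  have "t' / 2 * (0 * (cmod (a + b * S'\<^sup>2))\<^sup>2 + 1 * (cmod S')\<^sup>2) \<le> Re ((a + b * S'\<^sup>2) * cnj S')"
    by (rule rescaled_constraint_limit[OF h eventually_constraint[OF K] u t'_pos _ _ S s c d])
       (use h in auto)
  thus ?thesis by simp
qed

text \<open>At size \<open>1 / h ^ 4\<close> the quadratic part of the symbol has size
  \<open>1 / h ^ 5\<close> and dominates both the constant part and \<open>S\<close>. Here the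
  exponent keeps its overlap term.\<close>

lemma limit_constraint_large:
  assumes K: "\<forall>\<^sub>F n in sequentially. S n \<in> K" and S: "(\<lambda>n. of_real (h n ^ 4) * S n) \<longlonglongrightarrow> S'"
    and v: "t' - Re S' / (2*\<nu>) > 0"
  shows "(t' - Re S' / (2*\<nu>)) / 2 * (cmod (b * S'\<^sup>2))\<^sup>2 \<le> Re (b * S'\<^sup>2 * cnj S')"
proof -
  have "(\<lambda>n. \<alpha> n * of_real (h n) ^ 4 + \<beta> n * (of_real (h n ^ 4) * S n)\<^sup>2) \<longlonglongrightarrow> a * 0 + b * S'\<^sup>2"
    by (intro tendsto_intros \<alpha> \<beta> S of_real_h_power_tendsto) auto
  moreover have "\<alpha> n * of_real (h n) ^ 4 + \<beta> n * (of_real (h n ^ 4) * S n)\<^sup>2 = of_real (h n ^ 5) * sv n (S n)" for n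
    using h(2)[of n] by (simp add: field_simps power_numeral_reduce)
  ultimately have s: "(\<lambda>n. of_real (h n ^ 5) * sv n (S n)) \<longlonglongrightarrow> b * S'\<^sup>2" by simp
  have d: "(\<lambda>n. h n * h n ^ 5 / h n ^ 4) \<longlonglongrightarrow> 0"
  proof -
    have "(\<lambda>n. h n * h n ^ 5 / h n ^ 4) = (\<lambda>n. h n ^ 2)"
      using h(2) by (auto simp: less_imp_neq[symmetric] power_numeral_reduce)
    thus ?thesis using h_power_tendsto[of 2] by simp
  qed
  have c: "(\<lambda>n. h n * h n ^ 4 / h n ^ 5) \<longlonglongrightarrow> 1"
  proof -
    have "(\<lambda>n. h n * h n ^ 4 / h n ^ 5) = (\<lambda>n. 1)"
      using h(2) by (auto simp: power_numeral_reduce less_imp_neq[symmetric])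
    thus ?thesis by simp
  qed
  have "(t' - Re S' / (2*\<nu>)) / 2 * (1 * (cmod (b * S'\<^sup>2))\<^sup>2 + 0 * (cmod S')\<^sup>2) \<le> Re (b * S'\<^sup>2 * cnj S')"
    by (rule rescaled_constraint_limit[OF h eventually_constraint[OF K] uu_limit[OF S] v _ _ S s c d])
       (use h in auto)
  thus ?thesis by simp
qed

lemma limit_eq: "t' = kappa_opt" "a = of_real alpha_opt" "b = of_real beta_opt"
proof -
  \<comment> \<open>Adding the constraints at \<open>S0\<close> and \<open>cnj S0\<close> cancels
    the contribution of \<open>Im a\<close>. The same symmetrization gives the other two
    inequalities.\<close>
  have 1: "t' / 2 * (cmod a)\<^sup>2 \<le> m * Re a"
    using limit_constraint_fixed[OF S0(1)] limit_constraint_fixed[OF cnj_mem[OF S0(1)]] S0(2)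
    by (simp add: algebra_simps)
  have cnj_limit: "(\<lambda>n. of_real (h n ^ j) * cnj (hyp j n \<sigma>)) \<longlonglongrightarrow> Complex \<sigma> (-\<sigma>)"
    if "j > 0" "\<sigma> > 0" for j \<sigma>
    using tendsto_cnj[OF hyp_limit[OF that]] by (simp add: complex_cnj)
  have cnj_hyp: "\<forall>\<^sub>F n in sequentially. cnj (hyp j n \<sigma>) \<in> K" if "j > 0" "\<sigma> > 0" for j \<sigma>
    using hyp_mem[OF that] by eventually_elim (rule cnj_mem)
  have 2: "t' * \<sigma> \<le> Re a + 2 * \<sigma>\<^sup>2 * Re b" if "\<sigma> > 0" for \<sigma>
  proof -
    have c: "(cmod (Complex \<sigma> \<sigma>))\<^sup>2 = 2 * \<sigma>\<^sup>2" "(cmod (Complex \<sigma> (-\<sigma>)))\<^sup>2 = 2 * \<sigma>\<^sup>2"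
      by (simp_all add: cmod_power2)
    have "(t' * \<sigma>) * (2 * \<sigma>) \<le> (Re a + 2 * \<sigma>\<^sup>2 * Re b) * (2 * \<sigma>)"
      using limit_constraint_middle[OF hyp_mem[of 2 \<sigma>] hyp_limit[of 2 \<sigma>]]
        limit_constraint_middle[OF cnj_hyp[of 2 \<sigma>] cnj_limit[of 2 \<sigma>]] that
      unfolding c by (simp add: algebra_simps power2_eq_square)
    thus ?thesis using that by simp
  qed
  have 3: "\<nu> * t'\<^sup>2 / 2 * (cmod b)\<^sup>2 \<le> Re b"
  proof -
    \<comment> \<open>This value maximizes \<open>(t' - \<sigma> / (2*\<nu>)) * \<sigma>\<close>,
      the coefficient of \<open>(cmod b)\<^sup>2\<close> after the two conjugate constraints are
      added and divided by \<open>4 * \<sigma> ^ 3\<close>.\<close>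
    define \<sigma> where "\<sigma> = \<nu> * t'"
    have \<sigma>: "\<sigma> > 0" using nu_pos t'_pos by (simp add: \<sigma>_def)
    have eq: "t' - \<sigma> / (2*\<nu>) = t' / 2" using nu_pos by (simp add: \<sigma>_def field_simps)
    have "(cmod (b * (Complex \<sigma> \<sigma>)\<^sup>2))\<^sup>2 = 4 * \<sigma> ^ 4 * (cmod b)\<^sup>2"
      "(cmod (b * (Complex \<sigma> (-\<sigma>))\<^sup>2))\<^sup>2 = 4 * \<sigma> ^ 4 * (cmod b)\<^sup>2"
      unfolding cmod_power2 by (simp_all add: power2_eq_square algebra_simps power_numeral_reduce)
    note c = this
    have v: "t' - Re (Complex \<sigma> \<sigma>) / (2*\<nu>) > 0" "t' - Re (Complex \<sigma> (-\<sigma>)) / (2*\<nu>) > 0"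
      using eq t'_pos by simp_all
    have "t' / 2 * (4 * \<sigma> ^ 4 * (cmod b)\<^sup>2) \<le>
        Re (b * (Complex \<sigma> \<sigma>)\<^sup>2 * cnj (Complex \<sigma> \<sigma>)) + Re (b * (Complex \<sigma> (-\<sigma>))\<^sup>2 * cnj (Complex \<sigma> (-\<sigma>)))"
      using limit_constraint_large[OF hyp_mem[OF zero_less_numeral \<sigma>] hyp_limit[OF zero_less_numeral \<sigma>] v(1)]
        limit_constraint_large[OF cnj_hyp[OF zero_less_numeral \<sigma>] cnj_limit[OF zero_less_numeral \<sigma>] v(2)]
      unfolding c complex.sel eq by linarith
    also have "\<dots> = 4 * \<sigma> ^ 3 * Re b"
      by (simp add: power2_eq_square power_numeral_reduce algebra_simps)
    finally have "t' / 2 * (4 * \<sigma> ^ 4 * (cmod b)\<^sup>2) \<le> 4 * \<sigma> ^ 3 * Re b" .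
    hence "(\<sigma> * t' / 2 * (cmod b)\<^sup>2) * (4 * \<sigma> ^ 3) \<le> Re b * (4 * \<sigma> ^ 3)"
      by (simp add: power_numeral_reduce algebra_simps)
    hence "\<sigma> * t' / 2 * (cmod b)\<^sup>2 \<le> Re b" using \<sigma> by (simp only: mult_le_cancel_right) auto
    thus ?thesis by (simp add: \<sigma>_def power2_eq_square mult_ac)
  qed
  note * = equioscillation_limit_unique[OF m_pos nu_pos kappa_opt_pos kappa_opt_power5 t(2) 1 2 3]
  show "t' = kappa_opt" "a = of_real alpha_opt" "b = of_real beta_opt"
    using * by (simp_all add: alpha_opt_def beta_opt_def)
qed

end

text \<open>Two fixed points of \<open>K\<close> with different squares bound
  \<open>\<beta> n * h n ^ 4\<close>, by subtraction, and then \<open>\<alpha> n\<close>. A point of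
  size \<open>1 / h ^ 4\<close>, where the quadratic part dominates, removes the factor
  \<open>h ^ 4\<close>.\<close>

lemma bounded_parameters: "Bseq \<alpha>" "Bseq \<beta>"
proof -
  define y where "y = max 1 Y0"
  define Sa Sb where "Sa = Complex (sqrt (X0 + y\<^sup>2)) y" and "Sb = Complex (sqrt (X0 + (2*y)\<^sup>2)) (2*y)"
  have y: "y > 0" "y \<ge> Y0" "2*y \<ge> Y0" by (auto simp: y_def)
  have K: "Sa \<in> K" "Sb \<in> K" unfolding Sa_def Sb_def using y by (blast intro: hyperbola_mem)+
  have B: "Bseq (\<lambda>n. of_real (h n) * sv n S)" if "S \<in> K" for S
    using rescaled_constraint_Bseq[OF h eventually_constraint[of "\<lambda>n. S"] uu_limit_const t'_pos, of "\<lambda>_. 1" S] that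
    by simp
  have eq: "of_real (h n) * sv n S = \<alpha> n + \<beta> n * of_real (h n) ^ 4 * S\<^sup>2" for n S
    using h(2)[of n] by (simp add: field_simps power_numeral_reduce)
  have ne: "Sb\<^sup>2 - Sa\<^sup>2 \<noteq> 0"
  proof
    assume "Sb\<^sup>2 - Sa\<^sup>2 = 0"
    hence "(Sb - Sa) * (Sb + Sa) = 0" by (simp add: power2_eq_square algebra_simps)
    hence "Sb = Sa \<or> Sb = - Sa" by (auto simp: eq_neg_iff_add_eq_0)
    thus False using y by (auto simp: Sa_def Sb_def complex_eq_iff)
  qed
  have "Bseq (\<lambda>n. (of_real (h n) * sv n Sb - of_real (h n) * sv n Sa) * inverse (Sb\<^sup>2 - Sa\<^sup>2))"
    by (intro Bseq_mult Bseq_diff B K Bfun_const)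
  moreover have "(of_real (h n) * sv n Sb - of_real (h n) * sv n Sa) * inverse (Sb\<^sup>2 - Sa\<^sup>2)
      = \<beta> n * of_real (h n) ^ 4" for n
  proof -
    have "of_real (h n) * sv n Sb - of_real (h n) * sv n Sa = \<beta> n * of_real (h n) ^ 4 * (Sb\<^sup>2 - Sa\<^sup>2)"
      unfolding eq by (simp add: algebra_simps)
    thus ?thesis using ne by (simp add: field_simps)
  qed
  ultimately have B4: "Bseq (\<lambda>n. \<beta> n * of_real (h n) ^ 4)" by simp
  have "Bseq (\<lambda>n. of_real (h n) * sv n Sa - \<beta> n * of_real (h n) ^ 4 * Sa\<^sup>2)"
    by (intro Bseq_mult Bseq_diff B K B4 Bfun_const)
  thus B\<alpha>: "Bseq \<alpha>" unfolding eq by simp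
  \<comment> \<open>With this choice the limiting exponent is \<open>t' / 2\<close>, hence
    positive.\<close>
  define \<sigma> where "\<sigma> = \<nu> * t'"
  have \<sigma>: "\<sigma> > 0" using nu_pos t'_pos by (simp add: \<sigma>_def)
  define S where "S = (\<lambda>n. hyp 4 n \<sigma>)"
  have S: "(\<lambda>n. of_real (h n ^ 4) * S n) \<longlonglongrightarrow> Complex \<sigma> \<sigma>" and SK: "\<forall>\<^sub>F n in sequentially. S n \<in> K"
    unfolding S_def using \<sigma> by (simp_all only: hyp_limit hyp_mem zero_less_numeral)
  have v: "t' - Re (Complex \<sigma> \<sigma>) / (2*\<nu>) > 0" using nu_pos t'_pos by (simp add: \<sigma>_def)
  have "Bseq (\<lambda>n. of_real (h n * h n ^ 4) * sv n (S n))"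
    by (rule rescaled_constraint_Bseq[OF h eventually_constraint[OF SK] uu_limit[OF S] v _ S])
       (use h in auto)
  moreover have "Bseq (\<lambda>n. \<alpha> n * of_real (h n) ^ 4)"
    by (intro Bseq_mult B\<alpha> convergent_imp_Bseq convergentI[OF of_real_h_power_tendsto]) auto
  moreover have "(\<lambda>n. inverse ((of_real (h n ^ 4) * S n)\<^sup>2)) \<longlonglongrightarrow> inverse ((Complex \<sigma> \<sigma>)\<^sup>2)"
    by (intro tendsto_inverse tendsto_power S) (use \<sigma> in \<open>auto simp: complex_eq_iff power2_eq_square\<close>)
  hence "Bseq (\<lambda>n. inverse ((of_real (h n ^ 4) * S n)\<^sup>2))"
    by (rule convergent_imp_Bseq[OF convergentI])
  ultimately have "Bseq (\<lambda>n. (of_real (h n * h n ^ 4) * sv n (S n) - \<alpha> n * of_real (h n) ^ 4)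
      * inverse ((of_real (h n ^ 4) * S n)\<^sup>2))"
    by (intro Bseq_mult[OF Bseq_diff])
  moreover have "(of_real (h n * h n ^ 4) * sv n (S n) - \<alpha> n * of_real (h n) ^ 4)
      * inverse ((of_real (h n ^ 4) * S n)\<^sup>2) = \<beta> n" for n
  proof -
    have "S n \<noteq> 0" using \<sigma> by (auto simp: S_def hyp_def complex_eq_iff)
    moreover have "of_real (h n * h n ^ 4) * sv n (S n) - \<alpha> n * of_real (h n) ^ 4
        = \<beta> n * (of_real (h n ^ 4) * S n)\<^sup>2"
      by (simp add: field_simps power_numeral_reduce)
    ultimately show ?thesis by (simp add: field_simps)
  qed
  ultimately show "Bseq \<beta>" by simp
qed

end

text \<open>Compactness argument: a sequence of counterexamples has bounded parameters, so a
  subsequence converges, and \<open>limit_eq\<close> identifies its limit with the optimal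
  constants.\<close>

lemma parameters_localized:
  assumes "\<epsilon> > 0"
  shows "\<exists>\<eta>>0. \<forall>h t \<alpha> \<beta>. 0 < h \<and> h < \<eta> \<and> kappa_opt - \<eta> \<le> t \<and>
      feas (h ^ 5) (exp (-(t * h))) (\<alpha> / of_real h) (\<beta> * of_real h ^ 3) \<longrightarrow>
      dist \<alpha> (of_real alpha_opt) < \<epsilon> \<and> dist \<beta> (of_real beta_opt) < \<epsilon> \<and> t < kappa_opt + \<epsilon>"
proof (rule ccontr)
  assume neg: "\<not> ?thesis"
  have "\<forall>n::nat. \<exists>h t \<alpha> \<beta>. 0 < h \<and> h < inverse (real (Suc n)) \<and> kappa_opt - inverse (real (Suc n)) \<le> t \<and>
      feas (h ^ 5) (exp (-(t * h))) (\<alpha> / of_real h) (\<beta> * of_real h ^ 3) \<and>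
      \<not> (dist \<alpha> (of_real alpha_opt) < \<epsilon> \<and> dist \<beta> (of_real beta_opt) < \<epsilon> \<and> t < kappa_opt + \<epsilon>)"
  proof
    fix n :: nat
    have "inverse (real (Suc n)) > 0" by simp
    with neg show "\<exists>h t \<alpha> \<beta>. 0 < h \<and> h < inverse (real (Suc n)) \<and> kappa_opt - inverse (real (Suc n)) \<le> t \<and>
      feas (h ^ 5) (exp (-(t * h))) (\<alpha> / of_real h) (\<beta> * of_real h ^ 3) \<and>
      \<not> (dist \<alpha> (of_real alpha_opt) < \<epsilon> \<and> dist \<beta> (of_real beta_opt) < \<epsilon> \<and> t < kappa_opt + \<epsilon>)"
      by blast
  qed
  then obtain h t \<alpha> \<beta> where H: "\<And>n::nat. 0 < h n \<and> h n < inverse (real (Suc n)) \<and>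
      kappa_opt - inverse (real (Suc n)) \<le> t n \<and>
      feas (h n ^ 5) (exp (-(t n * h n))) (\<alpha> n / of_real (h n)) (\<beta> n * of_real (h n) ^ 3) \<and>
      \<not> (dist (\<alpha> n) (of_real alpha_opt) < \<epsilon> \<and> dist (\<beta> n) (of_real beta_opt) < \<epsilon> \<and> t n < kappa_opt + \<epsilon>)"
    by metis
  \<comment> \<open>Capping \<open>t\<close> makes the sequence bounded and preserves feasibility,
    because a smaller exponent weakens the constraint. A counterexample with
    \<open>t n \<ge> kappa_opt + \<epsilon>\<close> has \<open>T n = kappa_opt + \<epsilon>\<close>,
    which still contradicts convergence to \<open>kappa_opt\<close>.\<close>
  define T where "T n = min (t n) (kappa_opt + \<epsilon>)" for n
  have T_lo: "kappa_opt - inverse (real (Suc n)) \<le> T n" and T_hi: "T n \<le> kappa_opt + \<epsilon>" for n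
    using H[of n] assms unfolding T_def by (auto simp: min_def intro: order.trans[of _ kappa_opt])
  have h: "h \<longlonglongrightarrow> 0"
    by (rule tendsto_sandwich[OF _ _ tendsto_const LIMSEQ_inverse_real_of_nat])
       (use H in \<open>auto intro!: always_eventually less_imp_le\<close>)
  have F: "feas (h n ^ 5) (exp (-(T n * h n))) (\<alpha> n / of_real (h n)) (\<beta> n * of_real (h n) ^ 3)" for n
  proof (rule feas_mono)
    show "feas (h n ^ 5) (exp (-(t n * h n))) (\<alpha> n / of_real (h n)) (\<beta> n * of_real (h n) ^ 3)"
      using H[of n] by blast
    show "exp (-(t n * h n)) \<le> exp (-(T n * h n))"
      using H[of n] by (auto simp: T_def intro: mult_right_mono)
  qed
  have "bounded (range T)"
  proof (rule boundedI)
    fix x assume "x \<in> range T"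
    then obtain n where "x = T n" by auto
    moreover have "inverse (real (Suc n)) \<le> 1" by (simp add: inverse_eq_divide)
    ultimately show "norm x \<le> kappa_opt + \<epsilon> + 1"
      using T_lo[of n] T_hi[of n] kappa_opt_pos assms by simp
  qed
  then obtain r1 t' where r1: "strict_mono r1" "(T \<circ> r1) \<longlonglongrightarrow> t'"
    using bounded_imp_convergent_subsequence by blast
  have t': "t' \<ge> kappa_opt"
  proof (rule tendsto_le[OF sequentially_bot r1(2)])
    have "(\<lambda>n. kappa_opt - inverse (real (Suc n))) \<longlonglongrightarrow> kappa_opt - 0"
      by (intro tendsto_intros LIMSEQ_inverse_real_of_nat)
    from LIMSEQ_subseq_LIMSEQ[OF this r1(1)]
    show "(\<lambda>n. kappa_opt - inverse (real (Suc (r1 n)))) \<longlonglongrightarrow> kappa_opt" by (simp add: o_def)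
    show "\<forall>\<^sub>F n in sequentially. kappa_opt - inverse (real (Suc (r1 n))) \<le> (T \<circ> r1) n"
      using T_lo by simp
  qed
  have "Bseq (\<alpha> \<circ> r1)" "Bseq (\<beta> \<circ> r1)"
    using bounded_parameters[of "h \<circ> r1" "T \<circ> r1" t' "\<alpha> \<circ> r1" "\<beta> \<circ> r1"]
      LIMSEQ_subseq_LIMSEQ[OF h r1(1)] r1(2) t' F H by auto
  hence "bounded (range (\<lambda>n. ((\<alpha> \<circ> r1) n, (\<beta> \<circ> r1) n)))"
    by (intro bounded_subset[OF bounded_Times[of "range (\<alpha> \<circ> r1)" "range (\<beta> \<circ> r1)"]])
       (auto simp: Bseq_eq_bounded)
  then obtain r2 ab where r2: "strict_mono r2"
    and lim2: "((\<lambda>n. ((\<alpha> \<circ> r1) n, (\<beta> \<circ> r1) n)) \<circ> r2) \<longlonglongrightarrow> ab"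
    using bounded_imp_convergent_subsequence by blast
  define r where "r = r1 \<circ> r2"
  have \<alpha>: "(\<alpha> \<circ> r) \<longlonglongrightarrow> fst ab" and \<beta>: "(\<beta> \<circ> r) \<longlonglongrightarrow> snd ab"
    using tendsto_fst[OF lim2] tendsto_snd[OF lim2] by (simp_all add: o_def r_def)
  have r: "strict_mono r" using r1 r2 by (simp add: r_def strict_mono_o)
  have T: "(T \<circ> r) \<longlonglongrightarrow> t'"
    using LIMSEQ_subseq_LIMSEQ[OF r1(2) r2] by (simp add: r_def o_assoc)
  have *: "t' = kappa_opt" "fst ab = of_real alpha_opt" "snd ab = of_real beta_opt"
    using limit_eq[of "h \<circ> r" "T \<circ> r" t' "\<alpha> \<circ> r" "\<beta> \<circ> r", OF _ _ T t' _ \<alpha> \<beta>]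
      LIMSEQ_subseq_LIMSEQ[OF h r] F H by auto
  have "\<forall>\<^sub>F n in sequentially. dist ((\<alpha> \<circ> r) n) (of_real alpha_opt) < \<epsilon>"
    using \<alpha> assms unfolding * by (rule tendstoD)
  moreover have "\<forall>\<^sub>F n in sequentially. dist ((\<beta> \<circ> r) n) (of_real beta_opt) < \<epsilon>"
    using \<beta> assms unfolding * by (rule tendstoD)
  moreover have "\<forall>\<^sub>F n in sequentially. (T \<circ> r) n < kappa_opt + \<epsilon>"
    using order_tendstoD(2)[OF T] assms by (simp add: *)
  ultimately have "\<forall>\<^sub>F n in sequentially. False"
  proof eventually_elim
    case (elim n)
    with H[of "r n"] show ?case by (auto simp: T_def)
  qed
  thus False by simp
qed

section \<open>The candidate with real parameters\<close>

lemma alpha_opt_pos: "alpha_opt > 0" using m_pos kappa_opt_pos by (simp add: alpha_opt_def)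

lemma beta_opt_pos: "beta_opt > 0" using nu_pos kappa_opt_pos by (simp add: beta_opt_def)

lemma alpha_opt_beta_opt: "8 * (alpha_opt * beta_opt) = kappa_opt\<^sup>2"
proof -
  have "8 * (alpha_opt * beta_opt) * (\<nu> * kappa_opt ^ 3) = 32 * m"
    using nu_pos kappa_opt_pos by (simp add: alpha_opt_def beta_opt_def power_numeral_reduce)
  also have "\<dots> = kappa_opt\<^sup>2 * (\<nu> * kappa_opt ^ 3)"
    using kappa_opt_power5 by (simp add: power_numeral_reduce algebra_simps)
  finally show ?thesis using nu_pos kappa_opt_pos by simp
qed

lemma cmod_square_bounds:
  assumes "S \<in> K"
  shows "(cmod S)\<^sup>2 \<le> 2 * (Re S)\<^sup>2" "(Re S)\<^sup>2 \<le> (cmod S)\<^sup>2" "Re S > 0"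
proof -
  show "Re S > 0" using m_le[OF assms] m_pos by simp
  have "(Im S)\<^sup>2 \<le> (Re S)\<^sup>2" using sector[OF assms] by (metis abs_le_square_iff abs_of_nonneg abs_ge_zero order.trans)
  thus "(cmod S)\<^sup>2 \<le> 2 * (Re S)\<^sup>2" "(Re S)\<^sup>2 \<le> (cmod S)\<^sup>2" by (auto simp: cmod_power2)
qed

text \<open>Dividing by \<open>w\<close> splits the claim into bounds for \<open>u * P\<close>,
  \<open>u * (Q * r)\<close> and \<open>u * (r / w)\<close>. Each is at most
  \<open>2 * x * (1 - e)\<close> by optimality of the constants, and at every scale only one of them
  is large; the other two are of order \<open>h * x\<close> and fit into the margin
  \<open>2 * e * x\<close>.\<close>

lemma candidate_bound:
  fixes h \<epsilon> :: real and S :: complex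
  assumes \<epsilon>: "0 < \<epsilon>" "\<epsilon> < kappa_opt" and h: "0 < h" "h \<le> 1"
    and small: "kappa_opt * (2 * beta_opt + 2 / alpha_opt + alpha_opt + 1 / beta_opt) * h \<le> 2 * (\<epsilon> / kappa_opt)"
    and "S \<in> K"
  defines "u \<equiv> (kappa_opt - \<epsilon>) * h - h ^ 5 / (2*\<nu>) * Re S"
  defines "w \<equiv> alpha_opt / h + beta_opt * h ^ 3 * (cmod S)\<^sup>2"
  assumes u: "u > 0"
  shows "u * (w\<^sup>2 + (cmod S)\<^sup>2) \<le> 2 * Re S * w"
proof -
  define x r where "x = Re S" and "r = (cmod S)\<^sup>2"
  define P where "P = alpha_opt / h"
  define Q where "Q = beta_opt * h ^ 3"
  define e where "e = \<epsilon> / kappa_opt"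
  \<comment> \<open>The four summands are the constants in the crude bounds for the terms that do
    not dominate.\<close>
  define M where "M = kappa_opt * (2 * beta_opt + 2 / alpha_opt + alpha_opt + 1 / beta_opt)"
  have r: "r \<le> 2 * x\<^sup>2" "x\<^sup>2 \<le> r" "x > 0" and mx: "m \<le> x"
    using cmod_square_bounds[OF \<open>S \<in> K\<close>] m_le[OF \<open>S \<in> K\<close>] by (auto simp: x_def r_def)
  have rpos: "r > 0" using r by (smt (verit) zero_less_power)
  have e: "0 < e" "e < 1" "kappa_opt - \<epsilon> = kappa_opt * (1 - e)" using \<epsilon> kappa_opt_pos by (auto simp: e_def field_simps)
  have P: "P > 0" and Q: "Q > 0" using alpha_opt_pos beta_opt_pos h by (auto simp: P_def Q_def)
  have w: "w = P + Q * r" by (simp add: w_def P_def Q_def r_def)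
  have wpos: "w > 0" using P Q rpos by (simp add: w add_pos_pos)
  have u_le: "u \<le> kappa_opt * (1 - e) * h" using e(3) r nu_pos h by (simp add: u_def x_def)
  have u_le': "u \<le> kappa_opt * h" using u_le e kappa_opt_pos h
    by (smt (verit) mult_le_cancel_left1 mult_right_mono mult_left_le)
  have termP: "u * P \<le> 2 * x * (1 - e)"
  proof -
    have "u * P \<le> kappa_opt * (1 - e) * h * P" using u_le P by (intro mult_right_mono) auto
    also have "\<dots> = 2 * m * (1 - e)" using h kappa_opt_pos by (simp add: P_def alpha_opt_def)
    also have "\<dots> \<le> 2 * x * (1 - e)" using mx e by (intro mult_right_mono) auto
    finally show ?thesis .
  qed
  have termQ: "u * (Q * r) \<le> 2 * x * (1 - e)"
  proof -
    define l where "l = h ^ 5 / (2*\<nu>)"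
    define \<tau> where "\<tau> = kappa_opt * (1 - e) * h"
    have l: "l > 0" using h nu_pos by (simp add: l_def)
    \<comment> \<open>Completing the square bounds \<open>(\<tau> - l * x) * x\<close> by its
      maximum over \<open>x\<close>; this is the extremal point of the large scale.\<close>
    have "0 \<le> (\<tau> - 2 * l * x)\<^sup>2" by simp
    hence "4 * l * ((\<tau> - l * x) * x) \<le> \<tau>\<^sup>2" by (simp add: power2_eq_square algebra_simps)
    moreover have "u = \<tau> - l * x" using e(3) by (simp add: u_def \<tau>_def l_def x_def)
    ultimately have "4 * l * (u * x) \<le> \<tau>\<^sup>2" by simp
    hence "u * x \<le> \<tau>\<^sup>2 / (4 * l)" using l by (simp add: field_simps)
    also have "\<dots> = (kappa_opt * (1 - e))\<^sup>2 * \<nu> / (2 * h ^ 3)"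
      using h nu_pos by (simp add: \<tau>_def l_def field_simps power_numeral_reduce)
    finally have ux: "u * x \<le> (kappa_opt * (1 - e))\<^sup>2 * \<nu> / (2 * h ^ 3)" .
    have "u * (Q * r) \<le> u * (Q * (2 * x\<^sup>2))" using u Q r by (intro mult_left_mono) auto
    also have "\<dots> = (u * x) * (2 * Q * x)" by (simp add: power2_eq_square)
    also have "\<dots> \<le> (kappa_opt * (1 - e))\<^sup>2 * \<nu> / (2 * h ^ 3) * (2 * Q * x)"
      using ux Q r by (intro mult_right_mono) auto
    also have "\<dots> = 2 * x * ((1 - e) * (1 - e))"
      using h nu_pos kappa_opt_pos by (simp add: Q_def beta_opt_def power2_eq_square)
    also have "\<dots> \<le> 2 * x * ((1 - e) * 1)" using e r by (intro mult_left_mono) auto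
    finally show ?thesis by simp
  qed
  have termR: "u * (r / w) \<le> 2 * x * (1 - e)"
  proof -
    define z where "z = 2 * x / (kappa_opt * h)"
    have z: "z > 0" using r kappa_opt_pos h by (simp add: z_def)
    \<comment> \<open>The inequality of arithmetic and geometric means, sharp where the two parts of
      the symbol balance, that is, at the middle scale.\<close>
    have "0 \<le> (P - Q * r)\<^sup>2" by simp
    hence "4 * P * Q * r \<le> w\<^sup>2" by (simp add: w power2_eq_square algebra_simps)
    moreover have "8 * (P * Q) = kappa_opt\<^sup>2 * h\<^sup>2"
    proof -
      have "8 * (P * Q) = 8 * (alpha_opt * beta_opt) * h\<^sup>2"
        using h by (simp add: P_def Q_def power_numeral_reduce)
      thus ?thesis by (simp add: alpha_opt_beta_opt)
    qed
    hence "4 * P * Q * r = kappa_opt\<^sup>2 * h\<^sup>2 * r / 2" by simp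
    ultimately have w2: "kappa_opt\<^sup>2 * h\<^sup>2 * r / 2 \<le> w\<^sup>2" by simp
    have "r\<^sup>2 \<le> 2 * x\<^sup>2 * r" using r rpos by (simp add: power2_eq_square)
    also have "\<dots> = z\<^sup>2 * (kappa_opt\<^sup>2 * h\<^sup>2 * r / 2)"
      using h kappa_opt_pos by (simp add: z_def power_divide power_mult_distrib)
    also have "\<dots> \<le> z\<^sup>2 * w\<^sup>2" using w2 by (intro mult_left_mono) auto
    finally have "r\<^sup>2 \<le> (z * w)\<^sup>2" by (simp add: power_mult_distrib)
    hence "r \<le> z * w" by (rule power2_le_imp_le) (use z wpos in auto)
    hence "r / w \<le> z" using wpos by (simp add: field_simps)
    hence "u * (r / w) \<le> (kappa_opt * (1 - e) * h) * z"
      using u_le u rpos wpos by (intro mult_mono) auto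
    also have "\<dots> = 2 * x * (1 - e)" using h kappa_opt_pos by (simp add: z_def)
    finally show ?thesis .
  qed
  have uP': "u * P \<le> kappa_opt * alpha_opt"
  proof -
    have "u * P \<le> kappa_opt * h * P" using u_le' P by (intro mult_right_mono) auto
    thus ?thesis using h by (simp add: P_def)
  qed
  have uQ': "u * (Q * r) \<le> 2 * kappa_opt * beta_opt * (h ^ 4 * x\<^sup>2)"
  proof -
    have "u * (Q * r) \<le> kappa_opt * h * (Q * (2 * x\<^sup>2))"
      using u_le' Q r u rpos h kappa_opt_pos by (intro mult_mono) auto
    thus ?thesis by (simp add: Q_def power_numeral_reduce algebra_simps)
  qed
  have hx: "h ^ 4 * x\<^sup>2 \<le> h * x" if "h ^ 3 * x \<le> 1"
  proof -
    have "h ^ 4 * x\<^sup>2 = (h ^ 3 * x) * (h * x)" by (simp add: power_numeral_reduce)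
    also have "\<dots> \<le> 1 * (h * x)" using that h r by (intro mult_right_mono) auto
    finally show ?thesis by simp
  qed
  have h3: "h ^ 3 * x \<le> h * x"
    using h r power_decreasing[of 1 3 h] by (intro mult_right_mono) auto
  have Mh: "M * (h * x) \<le> 2 * e * x"
    using mult_right_mono[OF small, of x] r by (simp add: M_def e_def mult_ac)
  have M: "M * (h * x) = 2 * kappa_opt * beta_opt * (h * x) + 2 * kappa_opt / alpha_opt * (h * x) + kappa_opt * alpha_opt * (h * x) + kappa_opt / beta_opt * (h * x)"
    by (simp add: M_def algebra_simps)
  have Mnn: "0 \<le> 2 * kappa_opt * beta_opt * (h * x)" "0 \<le> 2 * kappa_opt / alpha_opt * (h * x)"
     "0 \<le> kappa_opt * alpha_opt * (h * x)" "0 \<le> kappa_opt / beta_opt * (h * x)"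
    using kappa_opt_pos beta_opt_pos alpha_opt_pos h r by auto
  have sum: "u * P + u * (Q * r) + u * (r / w) \<le> 2 * x * (1 - e) + M * (h * x)"
  proof -
    \<comment> \<open>The thresholds \<open>1 / h\<close> and \<open>1 / h ^ 3\<close> separate the
      scales 1, \<open>1 / h\<^sup>2\<close> and \<open>1 / h ^ 4\<close>. The dominant terms in the
      three ranges are \<open>u * P\<close>, \<open>u * (r / w)\<close> and
      \<open>u * (Q * r)\<close>.\<close>
    consider "h * x \<le> 1" | "h * x \<ge> 1" "h ^ 3 * x \<le> 1" | "h ^ 3 * x \<ge> 1" by linarith
    thus ?thesis
    proof cases
      case 1
      have "2 * kappa_opt * beta_opt * (h ^ 4 * x\<^sup>2) \<le> 2 * kappa_opt * beta_opt * (h * x)"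
        using hx h3 1 kappa_opt_pos beta_opt_pos by (intro mult_left_mono) auto
      moreover have "u * (r / w) \<le> 2 * kappa_opt / alpha_opt * (h * x)"
      proof -
        have "r / w \<le> 2 * x\<^sup>2 / P" using r P Q rpos wpos by (intro frac_le) (auto simp: w)
        hence "u * (r / w) \<le> kappa_opt * h * (2 * x\<^sup>2 / P)"
          using u_le' u rpos wpos kappa_opt_pos h by (intro mult_mono) auto
        also have "\<dots> = 2 * kappa_opt / alpha_opt * ((h * x) * (h * x))"
          by (simp add: P_def power2_eq_square)
        also have "\<dots> \<le> 2 * kappa_opt / alpha_opt * (1 * (h * x))"
          using 1 h r kappa_opt_pos alpha_opt_pos by (intro mult_left_mono mult_right_mono) auto
        finally show ?thesis by simp
      qed
      ultimately show ?thesis using termP uQ' M Mnn by linarith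
    next
      case 2
      have "2 * kappa_opt * beta_opt * (h ^ 4 * x\<^sup>2) \<le> 2 * kappa_opt * beta_opt * (h * x)"
        using hx 2 kappa_opt_pos beta_opt_pos by (intro mult_left_mono) auto
      moreover have "kappa_opt * alpha_opt * 1 \<le> kappa_opt * alpha_opt * (h * x)"
        using 2 kappa_opt_pos alpha_opt_pos by (intro mult_left_mono) auto
      ultimately show ?thesis using termR uP' uQ' M Mnn by linarith
    next
      case 3
      have "kappa_opt * alpha_opt * 1 \<le> kappa_opt * alpha_opt * (h * x)"
        using 3 h3 kappa_opt_pos alpha_opt_pos by (intro mult_left_mono) auto
      moreover have "u * (r / w) \<le> kappa_opt / beta_opt * (h * x)"
      proof -
        have "r / w \<le> r / (Q * r)" using P Q rpos by (intro frac_le) (auto simp: w)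
        hence "r / w \<le> 1 / Q" using rpos by simp
        hence "u * (r / w) \<le> kappa_opt * h * (1 / Q)"
          using u_le' u rpos wpos kappa_opt_pos h by (intro mult_mono) auto
        also have "\<dots> = kappa_opt / beta_opt * (1 / h\<^sup>2)" using h by (simp add: Q_def power_numeral_reduce)
        also have "\<dots> \<le> kappa_opt / beta_opt * (h * x)"
          using 3 h kappa_opt_pos beta_opt_pos
          by (intro mult_left_mono) (auto simp: field_simps power_numeral_reduce)
        finally show ?thesis .
      qed
      ultimately show ?thesis using termQ uP' M Mnn by linarith
    qed
  qed
  have "u * P + u * (Q * r) + u * (r / w) \<le> 2 * x"
    using sum Mh by (simp add: algebra_simps)
  hence "(u * P + u * (Q * r) + u * (r / w)) * w \<le> 2 * x * w" using wpos by (intro mult_right_mono) auto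
  moreover have "(u * P + u * (Q * r) + u * (r / w)) * w = u * (w\<^sup>2 + r)"
  proof -
    have "(u * P + u * (Q * r) + u * (r / w)) * w = u * (w * w) + u * (r / w * w)"
      by (simp add: w algebra_simps)
    thus ?thesis using wpos by (simp add: power2_eq_square algebra_simps)
  qed
  ultimately show ?thesis by (simp add: x_def r_def)
qed

text \<open>The limiting constants, used unchanged for positive \<open>h\<close>, reach every rate
  below \<open>kappa_opt\<close>. Being real and positive, they give
  \<open>Re (s * cnj S) = Re S * w\<close> and \<open>cmod s \<le> w\<close>, which reduces the
  constraint to \<open>candidate_bound\<close>.\<close>

lemma candidate_feas:
  assumes "0 < \<epsilon>" "\<epsilon> < kappa_opt"
  shows "\<forall>\<^sub>F h in at_right 0. feas (h ^ 5) (exp (-((kappa_opt - \<epsilon>) * h))) (of_real alpha_opt / of_real h) (of_real beta_opt * of_real h ^ 3)"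
proof -
  define M where "M = kappa_opt * (2 * beta_opt + 2 / alpha_opt + alpha_opt + 1 / beta_opt)"
  have "((\<lambda>h. M * h) \<longlongrightarrow> M * 0) (at_right 0)" by (intro tendsto_intros)
  hence "\<forall>\<^sub>F h in at_right 0. M * h < 2 * (\<epsilon> / kappa_opt)"
    using assms kappa_opt_pos by (intro order_tendstoD) auto
  moreover have "\<forall>\<^sub>F h::real in at_right 0. h \<in> {0<..<1}" by (rule eventually_at_right_real) simp
  ultimately show ?thesis
  proof eventually_elim
    case (elim h)
    hence h: "0 < h" "h \<le> 1" by auto
    show ?case unfolding feas_def
    proof
      fix S assume S: "S \<in> K"
      define u where "u = (kappa_opt - \<epsilon>) * h - h ^ 5 / (2*\<nu>) * Re S"
      define s where "s = of_real alpha_opt / of_real h + of_real beta_opt * of_real h ^ 3 * S\<^sup>2"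
      define w where "w = alpha_opt / h + beta_opt * h ^ 3 * (cmod S)\<^sup>2"
      have w: "w > 0" using alpha_opt_pos beta_opt_pos h by (auto simp: w_def intro!: add_pos_nonneg)
      have x: "Re S > 0" using cmod_square_bounds[OF S] by simp
      have Re: "Re (s * cnj S) = Re S * w"
      proof -
        have "s = of_real (alpha_opt / h) + of_real (beta_opt * h ^ 3) * S\<^sup>2" by (simp add: s_def)
        hence "s * cnj S = of_real (alpha_opt / h) * cnj S + of_real (beta_opt * h ^ 3) * (S * (S * cnj S))"
          by (simp add: algebra_simps power2_eq_square del: of_real_mult of_real_divide)
        also have "S * cnj S = of_real ((cmod S)\<^sup>2)" by (rule complex_norm_square[symmetric])
        finally have "s * cnj S = of_real (alpha_opt / h) * cnj S + of_real (beta_opt * h ^ 3) * (S * of_real ((cmod S)\<^sup>2))" .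
        thus ?thesis by (simp add: w_def algebra_simps del: of_real_mult of_real_divide of_real_power)
      qed
      have s_le: "cmod s \<le> w"
        unfolding s_def w_def using alpha_opt_pos beta_opt_pos h
        by (intro norm_triangle_mono) (auto simp: norm_mult norm_divide norm_power)
      have "cmod (s - S) \<le> exp (-u) * cmod (s + S)"
      proof (cases "u > 0")
        case True
        have "u * (w\<^sup>2 + (cmod S)\<^sup>2) \<le> 2 * Re S * w"
          unfolding w_def u_def
          by (rule candidate_bound) (use assms h elim S True in \<open>auto simp: M_def u_def\<close>)
        moreover have "u * ((cmod s)\<^sup>2 + (cmod S)\<^sup>2) \<le> u * (w\<^sup>2 + (cmod S)\<^sup>2)"
          using True s_le by (intro mult_left_mono add_right_mono power_mono) auto
        ultimately have "u / 2 * ((cmod s)\<^sup>2 + (cmod S)\<^sup>2) \<le> Re (s * cnj S)" unfolding Re by simp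
        thus ?thesis using True by (intro cmod_diff_le_expI) auto
      next
        case False
        \<comment> \<open>Where the exponent \<open>u\<close> is not positive, the factor
          \<open>exp (-u)\<close> is at least 1 and positivity of \<open>Re (s * cnj S)\<close>
          suffices.\<close>
        have "cmod (s - S) \<le> 1 * cmod (s + S)"
          unfolding cmod_diff_le_iff[OF zero_le_one] Re using w x by simp
        also have "\<dots> \<le> exp (-u) * cmod (s + S)" using False by (intro mult_right_mono) auto
        finally show ?thesis .
      qed
      moreover have "exp (-u) = exp (-((kappa_opt - \<epsilon>) * h)) * exp (h ^ 5 / (2*\<nu>) * Re S)"
        by (simp add: u_def flip: exp_add)
      ultimately show "cmod (of_real alpha_opt / of_real h + of_real beta_opt * of_real h ^ 3 * S\<^sup>2 - S)
        \<le> exp (-((kappa_opt - \<epsilon>) * h)) * exp (h ^ 5 / (2*\<nu>) * Re S) *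
          cmod (of_real alpha_opt / of_real h + of_real beta_opt * of_real h ^ 3 * S\<^sup>2 + S)"
        by (simp only: s_def)
    qed
  qed
qed

subsection \<open>Existence and uniqueness of the optimum\<close>

definition cone :: "complex \<Rightarrow> complex \<Rightarrow> bool" where
  "cone P Q \<longleftrightarrow> \<bar>Im P\<bar> < Re P \<and> \<bar>Im Q\<bar> < Re Q"

text \<open>In \<open>(P + Q * S\<^sup>2) * cnj S = P * cnj S + Q * S * (cmod S)\<^sup>2\<close>
  both summands have positive real part: the parameters have argument below \<pi>/4 in modulus and
  \<open>S\<close> has argument at most \<pi>/4 in modulus.\<close>

lemma cone_imp_cmod_less:
  assumes "cone P Q" "S \<in> K"
  shows "cmod (P + Q * S\<^sup>2 - S) < cmod (P + Q * S\<^sup>2 + S)"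
proof -
  have x: "Re S > 0" "\<bar>Im S\<bar> \<le> Re S" using cmod_square_bounds[OF assms(2)] sector[OF assms(2)] by auto
  have pos: "\<bar>b * Im S\<bar> < a * Re S" if "\<bar>b\<bar> < a" for a b
  proof -
    have "\<bar>b * Im S\<bar> \<le> \<bar>b\<bar> * Re S" using x by (simp add: abs_mult mult_left_mono)
    also have "\<dots> < a * Re S" using that x by simp
    finally show ?thesis .
  qed
  have 1: "Re (P * cnj S) > 0" using pos[of "Im P" "Re P"] assms(1) by (simp add: cone_def)
  have 2: "Re (Q * S) > 0" using pos[of "Im Q" "Re Q"] assms(1) by (simp add: cone_def)
  have "(P + Q * S\<^sup>2) * cnj S = P * cnj S + Q * S * (S * cnj S)"
    by (simp add: power2_eq_square algebra_simps)
  also have "S * cnj S = of_real ((cmod S)\<^sup>2)" by (rule complex_norm_square[symmetric])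
  finally have eq: "(P + Q * S\<^sup>2) * cnj S = P * cnj S + Q * S * of_real ((cmod S)\<^sup>2)" .
  have "Re (z * of_real a) = Re z * a" for z a by simp
  hence "Re ((P + Q * S\<^sup>2) * cnj S) = Re (P * cnj S) + Re (Q * S) * (cmod S)\<^sup>2"
    by (simp only: eq plus_complex.sel)
  also have "\<dots> > 0" using 1 2 by (intro add_pos_nonneg mult_nonneg_nonneg) auto
  finally have pos: "Re ((P + Q * S\<^sup>2) * cnj S) > 0" .
  define s where "s = P + Q * S\<^sup>2"
  have "(cmod (s - S))\<^sup>2 < (cmod (s + S))\<^sup>2"
    using pos unfolding s_def[symmetric] cmod_power2 by (simp add: power2_eq_square algebra_simps)
  thus ?thesis unfolding s_def by (rule power2_less_imp_less) simp
qed

text \<open>For parameters in the cone a constraint is automatic once its factor reaches 1. Taken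
  with \<open>C = 1\<close>, this bound confines the remaining constraints to a bounded part of
  \<open>K\<close>.\<close>

lemma Re_le_of_bound:
  assumes "L > 0" "\<delta> > 0" "\<delta> * exp (L / (2*\<nu>) * x) \<le> C" "C > 0"
  shows "x \<le> ln (C / \<delta>) / (L / (2*\<nu>))"
proof -
  have "exp (L / (2*\<nu>) * x) \<le> C / \<delta>" using assms by (simp add: field_simps)
  hence "L / (2*\<nu>) * x \<le> ln (C / \<delta>)" using assms by (subst ln_ge_iff) auto
  thus ?thesis using assms nu_pos by (simp add: field_simps)
qed

lemma cmod_le_Re: "S \<in> K \<Longrightarrow> cmod S \<le> 2 * Re S"
  using cmod_le[of S] sector[of S] by (auto simp: abs_le_iff)

text \<open>Far out, the factor is at least 1 even with \<open>\<Delta> / 2\<close> in place of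
  \<open>\<Delta>\<close>, and the cone condition suffices. On the compact remainder the quotient
  attains a maximum, which is below \<open>\<Delta>\<close>.\<close>

lemma strict_imp_improvable:
  assumes L: "L > 0" and \<Delta>: "\<Delta> > 0" and cone: "cone P Q"
    and strict: "\<And>S. S \<in> K \<Longrightarrow>
      cmod (P + Q * S\<^sup>2 - S) < \<Delta> * exp (L / (2*\<nu>) * Re S) * cmod (P + Q * S\<^sup>2 + S)"
  shows "\<exists>\<delta>. 0 \<le> \<delta> \<and> \<delta> < \<Delta> \<and> feas L \<delta> P Q"
proof -
  \<comment> \<open>At \<open>Re S = R\<close> the factor
    \<open>\<Delta> / 2 * exp (L / (2*\<nu>) * Re S)\<close> equals 1.\<close>
  define R where "R = ln (1 / (\<Delta>/2)) / (L / (2*\<nu>))"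
  define C where "C = K \<inter> cball 0 (2 * R)"
  define g where "g S = cmod (P + Q * S\<^sup>2 - S) / (exp (L / (2*\<nu>) * Re S) * cmod (P + Q * S\<^sup>2 + S))" for S
  have nz: "P + Q * S\<^sup>2 + S \<noteq> 0" if "S \<in> K" for S
    using strict[OF that] by auto
  have g_lt: "g S < \<Delta>" if "S \<in> K" for S
    using strict[OF that] nz[OF that] by (simp add: g_def field_simps)
  have g_le: "cmod (P + Q * S\<^sup>2 - S) \<le> \<delta> * exp (L / (2*\<nu>) * Re S) * cmod (P + Q * S\<^sup>2 + S)"
    if "S \<in> K" "g S \<le> \<delta>" for S \<delta>
    using that nz[OF that(1)] by (simp add: g_def field_simps)
  obtain M where M: "M < \<Delta>" "\<And>S. S \<in> C \<Longrightarrow> g S \<le> M"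
  proof (cases "C = {}")
    case True
    thus ?thesis using that[of "\<Delta>/2"] \<Delta> by simp
  next
    case False
    have "continuous_on C g" unfolding g_def
      by (intro continuous_intros) (auto simp: C_def dest: nz)
    then obtain S1 where "S1 \<in> C" "\<forall>S\<in>C. g S \<le> g S1"
      using continuous_attains_sup[of C g] compact_K[of "2*R"] False unfolding C_def by blast
    thus ?thesis using that[of "g S1"] g_lt by (auto simp: C_def)
  qed
  have "feas L (max M (\<Delta>/2)) P Q"
    unfolding feas_def
  proof
    fix S assume S: "S \<in> K"
    show "cmod (P + Q * S\<^sup>2 - S) \<le> max M (\<Delta>/2) * exp (L / (2*\<nu>) * Re S) * cmod (P + Q * S\<^sup>2 + S)"
    proof (cases "S \<in> C")
      case True
      thus ?thesis using M S by (intro g_le) (auto simp: le_max_iff_disj)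
    next
      case False
      hence "cmod S > 2 * R" using S by (auto simp: C_def)
      hence "Re S > R" using cmod_le_Re[OF S] by simp
      hence "1 \<le> \<Delta>/2 * exp (L / (2*\<nu>) * Re S)"
        using Re_le_of_bound[OF L, of "\<Delta>/2" "Re S" 1] \<Delta> unfolding R_def by fastforce
      hence "1 \<le> max M (\<Delta>/2) * exp (L / (2*\<nu>) * Re S)"
        by (smt (verit) exp_ge_zero max.cobounded2 mult_right_mono)
      hence "1 * cmod (P + Q * S\<^sup>2 + S) \<le> max M (\<Delta>/2) * exp (L / (2*\<nu>) * Re S) * cmod (P + Q * S\<^sup>2 + S)"
        by (intro mult_right_mono) auto
      with cone_imp_cmod_less[OF cone S] show ?thesis by simp
    qed
  qed
  thus ?thesis using M \<Delta> by (intro exI[of _ "max M (\<Delta>/2)"]) auto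
qed

lemma square_eq_on_K:
  assumes "S \<in> K" "T \<in> K" "S\<^sup>2 = T\<^sup>2" shows "S = T"
proof -
  have "S = T \<or> S = - T" using assms(3) by (simp add: power2_eq_iff)
  moreover have "Re S > 0" "Re T > 0" using cmod_square_bounds assms by auto
  ultimately show ?thesis by auto
qed

text \<open>Shifting \<open>P\<close> so that \<open>P + Q * T\<^sup>2\<close> moves towards \<open>T\<close> makes all constraints strict.\<close>

lemma single_contact_improvable:
  assumes L: "L > 0" and \<Delta>: "\<Delta> > 0" and cone: "cone P Q" and T: "T \<in> K"
    and feas: "feas L \<Delta> P Q"
    and strict: "\<And>S. S \<in> K \<Longrightarrow> S \<noteq> T \<Longrightarrow>
      cmod (P + Q * S\<^sup>2 - S) < \<Delta> * exp (L / (2*\<nu>) * Re S) * cmod (P + Q * S\<^sup>2 + S)"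
  shows "\<exists>\<delta> P Q. 0 \<le> \<delta> \<and> \<delta> < \<Delta> \<and> feas L \<delta> P Q"
proof (rule ccontr)
  assume neg: "\<not> ?thesis"
  define r where "r S = \<Delta> * exp (L / (2*\<nu>) * Re S)" for S
  define s where "s S = P + Q * S\<^sup>2" for S
  \<comment> \<open>A full step by \<open>w\<close> moves the symbol at \<open>T\<close> onto
    \<open>T\<close> itself, where the left-hand side of the constraint vanishes.\<close>
  define w where "w = T - s T"
  have r_pos: "r S > 0" for S using \<Delta> by (simp add: r_def)
  have "continuous_on UNIV r" "continuous_on UNIV s"
    unfolding r_def s_def by (intro continuous_intros)+
  hence cont: "isCont r S" "isCont s S" for S
    by (auto simp: continuous_on_eq_continuous_at)
  have active: "cmod (s T - T) = r T * cmod (s T + T)"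
  proof (rule ccontr)
    assume "cmod (s T - T) \<noteq> r T * cmod (s T + T)"
    moreover have "cmod (s T - T) \<le> r T * cmod (s T + T)"
      using feas T by (auto simp: feas_def s_def r_def)
    ultimately have "\<And>S. S \<in> K \<Longrightarrow>
      cmod (P + Q * S\<^sup>2 - S) < \<Delta> * exp (L / (2*\<nu>) * Re S) * cmod (P + Q * S\<^sup>2 + S)"
      using strict by (fastforce simp: s_def r_def)
    from strict_imp_improvable[OF L \<Delta> cone this] neg show False by blast
  qed
  have "r T * cmod (s T + T) < 1 * cmod (s T + T)"
    using cone_imp_cmod_less[OF cone T] active by (simp add: s_def)
  hence rT: "r T < 1" by (rule mult_right_less_imp_less) simp
  define \<tau> where "\<tau> n = inverse (real (Suc n))" for n
  have \<tau>: "\<tau> \<longlonglongrightarrow> 0" "\<And>n. 0 < \<tau> n" "\<And>n. \<tau> n \<le> 1"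
    unfolding \<tau>_def by (rule LIMSEQ_inverse_real_of_nat) (auto simp: inverse_eq_divide)
  have \<tau>w: "(\<lambda>n. of_real (\<tau> n) * w) \<longlonglongrightarrow> 0"
    using tendsto_mult[OF tendsto_of_real[OF \<tau>(1)] tendsto_const[of w]] by simp
  have "\<forall>\<^sub>F n in sequentially. cone (P + of_real (\<tau> n) * w) Q"
  proof -
    have "(\<lambda>n. Re (P + of_real (\<tau> n) * w) - \<bar>Im (P + of_real (\<tau> n) * w)\<bar>) \<longlonglongrightarrow> Re (P + 0) - \<bar>Im (P + 0)\<bar>"
      by (intro tendsto_intros \<tau>w)
    moreover have "Re (P + 0) - \<bar>Im (P + 0)\<bar> > 0" using cone by (simp add: cone_def)
    ultimately have "\<forall>\<^sub>F n in sequentially. Re (P + of_real (\<tau> n) * w) - \<bar>Im (P + of_real (\<tau> n) * w)\<bar> > 0"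
      by (rule order_tendstoD)
    thus ?thesis by eventually_elim (use cone in \<open>auto simp: cone_def\<close>)
  qed
  then obtain N where N: "\<And>n. n \<ge> N \<Longrightarrow> cone (P + of_real (\<tau> n) * w) Q"
    by (auto simp: eventually_sequentially)
  define \<tau>' where "\<tau>' n = \<tau> (n + N)" for n
  have \<tau>': "0 < \<tau>' n" "\<tau>' n \<le> 1" "cone (P + of_real (\<tau>' n) * w) Q" for n
    using \<tau> N by (auto simp: \<tau>'_def)
  \<comment> \<open>If some short step made all constraints strict, the level could be lowered; so
    every short step is violated somewhere. The violations stay in a compact set, and their limit
    points can only be \<open>T\<close>.\<close>
  have "\<exists>S\<in>K. r S * cmod (s S + of_real (\<tau>' n) * w + S) \<le> cmod (s S + of_real (\<tau>' n) * w - S)" for n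
  proof (rule ccontr)
    assume "\<not> ?thesis"
    hence "\<And>S. S \<in> K \<Longrightarrow> cmod (P + of_real (\<tau>' n) * w + Q * S\<^sup>2 - S)
        < \<Delta> * exp (L / (2*\<nu>) * Re S) * cmod (P + of_real (\<tau>' n) * w + Q * S\<^sup>2 + S)"
      by (auto simp: s_def r_def not_le add_ac)
    from strict_imp_improvable[OF L \<Delta> \<tau>'(3) this] neg show False by blast
  qed
  then obtain Sn where Sn: "\<And>n. Sn n \<in> K"
    and viol: "\<And>n. r (Sn n) * cmod (s (Sn n) + of_real (\<tau>' n) * w + Sn n)
       \<le> cmod (s (Sn n) + of_real (\<tau>' n) * w - Sn n)" by metis
  have "Sn n \<in> K \<inter> cball 0 (2 * (ln (1 / \<Delta>) / (L / (2*\<nu>))))" for n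
  proof -
    have "cmod (s (Sn n) + of_real (\<tau>' n) * w - Sn n) < cmod (s (Sn n) + of_real (\<tau>' n) * w + Sn n)"
      using cone_imp_cmod_less[OF \<tau>'(3) Sn] by (simp add: s_def add_ac)
    with viol[of n] have "r (Sn n) * cmod (s (Sn n) + of_real (\<tau>' n) * w + Sn n)
        < 1 * cmod (s (Sn n) + of_real (\<tau>' n) * w + Sn n)" by simp
    hence "r (Sn n) < 1" by (rule mult_right_less_imp_less) simp
    hence "Re (Sn n) \<le> ln (1 / \<Delta>) / (L / (2*\<nu>))"
      unfolding r_def using L \<Delta> by (intro Re_le_of_bound) auto
    thus ?thesis using cmod_le_Re[OF Sn[of n]] Sn by simp
  qed
  then obtain S' \<phi> where S': "S' \<in> K" and \<phi>: "strict_mono \<phi>" "(Sn \<circ> \<phi>) \<longlonglongrightarrow> S'"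
    using compact_imp_seq_compact[OF compact_K] unfolding seq_compact_def by (meson IntD1)
  have \<tau>lim: "(\<lambda>n. \<tau>' (\<phi> n)) \<longlonglongrightarrow> 0"
    using LIMSEQ_subseq_LIMSEQ[OF LIMSEQ_ignore_initial_segment[OF \<tau>(1), of N] \<phi>(1)]
    by (simp add: o_def \<tau>'_def)
  have Slim: "(\<lambda>n. Sn (\<phi> n)) \<longlonglongrightarrow> S'" using \<phi>(2) by (simp add: o_def)
  have rlim: "(\<lambda>n. r (Sn (\<phi> n))) \<longlonglongrightarrow> r S'" and slim: "(\<lambda>n. s (Sn (\<phi> n))) \<longlonglongrightarrow> s S'"
    by (rule isCont_tendsto_compose[OF cont(1) Slim], rule isCont_tendsto_compose[OF cont(2) Slim])
  have "r S' * cmod (s S' + of_real 0 * w + S') \<le> cmod (s S' + of_real 0 * w - S')"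
  proof (rule LIMSEQ_le)
    show "(\<lambda>n. r (Sn (\<phi> n)) * cmod (s (Sn (\<phi> n)) + of_real (\<tau>' (\<phi> n)) * w + Sn (\<phi> n)))
        \<longlonglongrightarrow> r S' * cmod (s S' + of_real 0 * w + S')"
      by (intro tendsto_intros rlim slim Slim \<tau>lim)
    show "(\<lambda>n. cmod (s (Sn (\<phi> n)) + of_real (\<tau>' (\<phi> n)) * w - Sn (\<phi> n)))
        \<longlonglongrightarrow> cmod (s S' + of_real 0 * w - S')"
      by (intro tendsto_intros rlim slim Slim \<tau>lim)
  qed (use viol in auto)
  hence "S' = T" using strict[OF S'] by (force simp: r_def s_def)
  have "(\<lambda>n. (cmod (s (Sn (\<phi> n)) + w - Sn (\<phi> n)))\<^sup>2 - (r (Sn (\<phi> n)))\<^sup>2 * (cmod (s (Sn (\<phi> n)) + w + Sn (\<phi> n)))\<^sup>2)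
     \<longlonglongrightarrow> (cmod (s S' + w - S'))\<^sup>2 - (r S')\<^sup>2 * (cmod (s S' + w + S'))\<^sup>2"
    by (intro tendsto_intros rlim slim Slim)
  moreover have "(cmod (s S' + w - S'))\<^sup>2 - (r S')\<^sup>2 * (cmod (s S' + w + S'))\<^sup>2 < 0"
  proof -
    have "T \<noteq> 0" "r T \<noteq> 0" using r_pos[of T] cmod_square_bounds(3)[OF T] by auto
    thus ?thesis by (simp add: \<open>S' = T\<close> w_def zero_less_mult_iff)
  qed
  \<comment> \<open>Near \<open>T\<close> the full step satisfies the constraint strictly, while no
    step satisfies it weakly. Convexity for \<open>r < 1\<close> then makes the short step strict as
    well, against the choice of the violating points.\<close>
  ultimately have ev1: "\<forall>\<^sub>F n in sequentially. (cmod (s (Sn (\<phi> n)) + w - Sn (\<phi> n)))\<^sup>2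
      - (r (Sn (\<phi> n)))\<^sup>2 * (cmod (s (Sn (\<phi> n)) + w + Sn (\<phi> n)))\<^sup>2 < 0"
    by (rule order_tendstoD)
  have ev2: "\<forall>\<^sub>F n in sequentially. r (Sn (\<phi> n)) < 1"
    using order_tendstoD(2)[OF rlim] rT by (simp add: \<open>S' = T\<close>)
  from ev1 ev2 have "\<forall>\<^sub>F n in sequentially. False"
  proof eventually_elim
    case (elim n)
    define U t where "U = Sn (\<phi> n)" and "t = \<tau>' (\<phi> n)"
    have U: "U \<in> K" using Sn by (simp add: U_def)
    have t: "0 < t" "t \<le> 1" using \<tau>' by (auto simp: t_def)
    have "cmod (s U - U) \<le> r U * cmod (s U + U)" using feas U by (auto simp: feas_def s_def r_def)
    from power_mono[OF this, of 2] have "(cmod (s U - U))\<^sup>2 - (r U)\<^sup>2 * (cmod (s U + U))\<^sup>2 \<le> 0"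
      by (simp add: power_mult_distrib)
    hence a: "(1 - t) * ((cmod (s U - U))\<^sup>2 - (r U)\<^sup>2 * (cmod (s U + U))\<^sup>2) \<le> 0"
      using t by (intro mult_nonneg_nonpos) auto
    have b: "t * ((cmod (s U + w - U))\<^sup>2 - (r U)\<^sup>2 * (cmod (s U + w + U))\<^sup>2) < 0"
      using elim t by (intro mult_pos_neg) (auto simp: U_def)
    have "(r U)\<^sup>2 \<le> 1" using elim r_pos[of U] by (simp add: U_def power_le_one)
    hence c: "0 \<le> t * (1 - t) * (1 - (r U)\<^sup>2) * (cmod w)\<^sup>2" using t by simp
    have "(cmod (s U + of_real t * w - U))\<^sup>2 - (r U)\<^sup>2 * (cmod (s U + of_real t * w + U))\<^sup>2 < 0"
      unfolding convex_combination_defect using a b c by linarith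
    moreover have "(r U * cmod (s U + of_real t * w + U))\<^sup>2 \<le> (cmod (s U + of_real t * w - U))\<^sup>2"
      using viol[of "\<phi> n"] r_pos[of U] unfolding U_def t_def by (intro power_mono) auto
    ultimately show ?case by (simp add: power_mult_distrib)
  qed
  thus False by simp
qed

text \<open>The midpoint of two optimal pairs satisfies every constraint strictly except where the
  two symbols coincide. They coincide at one point of \<open>K\<close> at most, and then the level
  could still be lowered.\<close>

lemma optimal_unique:
  assumes L: "L > 0" and min: "\<And>\<delta> P Q. 0 \<le> \<delta> \<Longrightarrow> feas L \<delta> P Q \<Longrightarrow> \<Delta> \<le> \<delta>" and "\<Delta> \<ge> 0"
    and F: "feas L \<Delta> P1 Q1" "feas L \<Delta> P2 Q2" and C: "cone P1 Q1" "cone P2 Q2"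
  shows "P1 = P2 \<and> Q1 = Q2"
proof (rule ccontr)
  assume ne: "\<not> (P1 = P2 \<and> Q1 = Q2)"
  define P Q where "P = (P1 + P2) / 2" and "Q = (Q1 + Q2) / 2"
  have mid: "P + Q * S\<^sup>2 = ((P1 + Q1 * S\<^sup>2) + (P2 + Q2 * S\<^sup>2)) / 2" for S
    by (simp add: P_def Q_def field_simps)
  have cone: "cone P Q" using C by (auto simp: cone_def P_def Q_def)
  have strict: "cmod (P + Q * S\<^sup>2 - S) < \<Delta> * exp (L / (2*\<nu>) * Re S) * cmod (P + Q * S\<^sup>2 + S)"
    if S: "S \<in> K" and "P1 + Q1 * S\<^sup>2 \<noteq> P2 + Q2 * S\<^sup>2" for S
  proof (cases "\<Delta> * exp (L / (2*\<nu>) * Re S) < 1")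
    case True
    show ?thesis unfolding mid
      by (rule midpoint_strict) (use F S that True \<open>\<Delta> \<ge> 0\<close> in \<open>auto simp: feas_def\<close>)
  next
    case False
    have "cmod (P + Q * S\<^sup>2 - S) < 1 * cmod (P + Q * S\<^sup>2 + S)"
      using cone_imp_cmod_less[OF cone S] by simp
    also have "\<dots> \<le> \<Delta> * exp (L / (2*\<nu>) * Re S) * cmod (P + Q * S\<^sup>2 + S)"
      using False by (intro mult_right_mono) auto
    finally show ?thesis .
  qed
  \<comment> \<open>Equality of the symbols at two different squares would force equal pairs, and on
    \<open>K\<close> the square determines the point.\<close>
  have agree: "S = T" if "S \<in> K" "T \<in> K" "P1 + Q1 * S\<^sup>2 = P2 + Q2 * S\<^sup>2" "P1 + Q1 * T\<^sup>2 = P2 + Q2 * T\<^sup>2" for S T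
  proof (rule ccontr)
    assume "S \<noteq> T"
    hence "S\<^sup>2 \<noteq> T\<^sup>2" using square_eq_on_K that by blast
    moreover have "(Q1 - Q2) * (S\<^sup>2 - T\<^sup>2) = (P1 + Q1 * S\<^sup>2 - (P2 + Q2 * S\<^sup>2)) - (P1 + Q1 * T\<^sup>2 - (P2 + Q2 * T\<^sup>2))"
      by (simp add: algebra_simps)
    hence "(Q1 - Q2) * (S\<^sup>2 - T\<^sup>2) = 0" using that by simp
    ultimately have "Q1 = Q2" by auto
    with that(3) ne show False by simp
  qed
  define y where "y = max 1 Y0"
  have "Complex (sqrt (X0 + y\<^sup>2)) y \<in> K" "Complex (sqrt (X0 + (y + 1)\<^sup>2)) (y + 1) \<in> K"
    by (intro hyperbola_mem; simp add: y_def)+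
  moreover have "Complex (sqrt (X0 + y\<^sup>2)) y \<noteq> Complex (sqrt (X0 + (y + 1)\<^sup>2)) (y + 1)" by simp
  \<comment> \<open>A point where the symbols differ carries a strict inequality, whose right-hand
    side shows that \<open>\<Delta>\<close> is not 0.\<close>
  ultimately obtain U where U: "U \<in> K" "P1 + Q1 * U\<^sup>2 \<noteq> P2 + Q2 * U\<^sup>2"
    using agree by blast
  have "0 \<le> cmod (P + Q * U\<^sup>2 - U)" by simp
  also note strict[OF U]
  finally have "\<Delta> \<noteq> 0" by auto
  with \<open>\<Delta> \<ge> 0\<close> have \<Delta>: "\<Delta> > 0" by simp
  have FPQ: "feas L \<Delta> P Q"
    unfolding feas_def
  proof
    fix S assume S: "S \<in> K"
    show "cmod (P + Q * S\<^sup>2 - S) \<le> \<Delta> * exp (L / (2*\<nu>) * Re S) * cmod (P + Q * S\<^sup>2 + S)"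
    proof (cases "P1 + Q1 * S\<^sup>2 = P2 + Q2 * S\<^sup>2")
      case True
      hence "P + Q * S\<^sup>2 = P1 + Q1 * S\<^sup>2" unfolding mid by simp
      thus ?thesis using F(1) S by (auto simp: feas_def)
    qed (use strict[OF S] in auto)
  qed
  have "\<exists>\<delta> P Q. 0 \<le> \<delta> \<and> \<delta> < \<Delta> \<and> feas L \<delta> P Q"
  proof (cases "\<exists>T\<in>K. P1 + Q1 * T\<^sup>2 = P2 + Q2 * T\<^sup>2")
    case True
    then obtain T where T: "T \<in> K" "P1 + Q1 * T\<^sup>2 = P2 + Q2 * T\<^sup>2" by blast
    show ?thesis
      using single_contact_improvable[OF L \<Delta> cone T(1) FPQ] strict agree[OF _ T(1) _ T(2)] by blast
  next
    case False
    thus ?thesis using strict_imp_improvable[OF L \<Delta> cone] strict by blast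
  qed
  then obtain \<delta> P' Q' where "0 \<le> \<delta>" "\<delta> < \<Delta>" "feas L \<delta> P' Q'" by blast
  with min[of \<delta> P' Q'] show False by simp
qed

section \<open>Existence of the optimum and its expansion\<close>

definition optimum :: "real \<Rightarrow> real \<Rightarrow> complex \<Rightarrow> complex \<Rightarrow> bool" where
  "optimum L \<Delta> P Q \<longleftrightarrow> 0 \<le> \<Delta> \<and> (\<forall>\<delta> P' Q'. 0 \<le> \<delta> \<and> feas L \<delta> P' Q' \<longrightarrow> \<Delta> \<le> \<delta>) \<and>
     (\<forall>P' Q'. feas L \<Delta> P' Q' \<longleftrightarrow> P' = P \<and> Q' = Q)"

lemma feas_limit:
  assumes "\<And>n. feas L (\<delta> n) (P n) (Q n)" "\<delta> \<longlonglongrightarrow> \<delta>'" "P \<longlonglongrightarrow> P'" "Q \<longlonglongrightarrow> Q'"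
  shows "feas L \<delta>' P' Q'"
  unfolding feas_def
proof
  fix S assume S: "S \<in> K"
  show "cmod (P' + Q' * S\<^sup>2 - S) \<le> \<delta>' * exp (L / (2*\<nu>) * Re S) * cmod (P' + Q' * S\<^sup>2 + S)"
  proof (rule LIMSEQ_le)
    show "(\<lambda>n. cmod (P n + Q n * S\<^sup>2 - S)) \<longlonglongrightarrow> cmod (P' + Q' * S\<^sup>2 - S)"
      by (intro tendsto_intros assms)
    show "(\<lambda>n. \<delta> n * exp (L / (2*\<nu>) * Re S) * cmod (P n + Q n * S\<^sup>2 + S))
        \<longlonglongrightarrow> \<delta>' * exp (L / (2*\<nu>) * Re S) * cmod (P' + Q' * S\<^sup>2 + S)"
      by (intro tendsto_intros assms)
  qed (use assms(1) S in \<open>auto simp: feas_def\<close>)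
qed

text \<open>In a disc of radius \<open>a / 2\<close> about \<open>a\<close> the real part exceeds
  \<open>a / 2\<close> and the imaginary part stays below it in modulus; positive factors preserve
  this comparison.\<close>

lemma near_real_imp_cone:
  assumes "h > 0" "dist \<alpha> (of_real a) < a / 2" "dist \<beta> (of_real b) < b / 2"
  shows "cone (\<alpha> / of_real h) (\<beta> * of_real h ^ 3)"
proof -
  have *: "\<bar>Im z\<bar> < Re z" if "dist z (of_real a) < a / 2" for z a
    using that abs_Re_le_cmod[of "z - of_real a"] abs_Im_le_cmod[of "z - of_real a"]
    by (simp add: dist_norm abs_le_iff) linarith
  have "\<beta> * of_real h ^ 3 = \<beta> * of_real (h ^ 3)" by simp
  thus ?thesis using *[OF assms(2)] *[OF assms(3)] assms(1)
    by (simp add: cone_def divide_strict_right_mono abs_mult del: of_real_power)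
qed

text \<open>Localization controls all pairs feasible at level \<open>\<delta>0\<close>, and the
  candidate shows that the smaller level \<open>\<delta>1\<close> is feasible. A minimizing sequence
  therefore stays bounded and, feasibility being closed, converges along a subsequence to an optimal
  pair; pairs at that level lie in the cone, which gives uniqueness.\<close>

lemma eventually_optimum: "\<forall>\<^sub>F h in at_right 0. \<exists>\<Delta> P Q. optimum (h ^ 5) \<Delta> P Q"
proof -
  define \<epsilon> where "\<epsilon> = min alpha_opt beta_opt / 2"
  have "\<epsilon> > 0" using alpha_opt_pos beta_opt_pos by (simp add: \<epsilon>_def)
  from parameters_localized[OF this] obtain \<eta> where \<eta>: "\<eta> > 0"
    and loc: "\<And>h t \<alpha> \<beta>. 0 < h \<Longrightarrow> h < \<eta> \<Longrightarrow> kappa_opt - \<eta> \<le> t \<Longrightarrow>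
      feas (h ^ 5) (exp (-(t * h))) (\<alpha> / of_real h) (\<beta> * of_real h ^ 3) \<Longrightarrow>
      dist \<alpha> (of_real alpha_opt) < \<epsilon> \<and> dist \<beta> (of_real beta_opt) < \<epsilon>" by blast
  \<comment> \<open>Being below \<open>\<eta>\<close>, this margin puts the candidate's level
    strictly under \<open>\<delta>0\<close>.\<close>
  define \<epsilon>' where "\<epsilon>' = min \<eta> kappa_opt / 2"
  have \<epsilon>': "0 < \<epsilon>'" "\<epsilon>' < kappa_opt" "\<epsilon>' < \<eta>" using \<eta> kappa_opt_pos by (auto simp: \<epsilon>'_def)
  have "\<forall>\<^sub>F h in at_right 0. h \<in> {0<..<\<eta>}" using \<eta> by (rule eventually_at_right_real)
  with candidate_feas[OF \<epsilon>'(1,2)] show ?thesis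
  proof eventually_elim
    case (elim h)
    hence h: "0 < h" "h < \<eta>" by auto
    define \<delta>0 \<delta>1 where "\<delta>0 = exp (-((kappa_opt - \<eta>) * h))" and "\<delta>1 = exp (-((kappa_opt - \<epsilon>') * h))"
    have \<delta>: "\<delta>1 < \<delta>0" using \<epsilon>' h by (simp add: \<delta>0_def \<delta>1_def)
    have near: "dist (P * of_real h) (of_real alpha_opt) < \<epsilon> \<and> dist (Q / of_real h ^ 3) (of_real beta_opt) < \<epsilon>"
      if "feas (h ^ 5) \<delta> P Q" "\<delta> \<le> \<delta>0" for \<delta> P Q
      using loc[of h "kappa_opt - \<eta>" "P * of_real h" "Q / of_real h ^ 3"] feas_mono[OF that] h
      by (simp add: \<delta>0_def)
    have near_cone: "cone P Q" if "feas (h ^ 5) \<delta> P Q" "\<delta> \<le> \<delta>0" for \<delta> P Q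
      using near_real_imp_cone[of h "P * of_real h" alpha_opt "Q / of_real h ^ 3" beta_opt] near[OF that] h
      by (simp add: \<epsilon>_def min_def split: if_splits)
    define D where "D = {\<delta>. 0 \<le> \<delta> \<and> (\<exists>P Q. feas (h ^ 5) \<delta> P Q)}"
    define \<Delta> where "\<Delta> = Inf D"
    have D1: "\<delta>1 \<in> D" using elim by (auto simp: D_def \<delta>1_def)
    have bdd: "bdd_below D" by (rule bdd_belowI[of _ 0]) (auto simp: D_def)
    have \<Delta>_le: "\<Delta> \<le> \<delta>" if "0 \<le> \<delta>" "feas (h ^ 5) \<delta> P Q" for \<delta> P Q
      unfolding \<Delta>_def using that by (intro cInf_lower bdd) (auto simp: D_def)
    have \<Delta>0: "\<Delta> \<ge> 0" unfolding \<Delta>_def using D1 by (intro cInf_greatest) (auto simp: D_def)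
    have \<Delta>1: "\<Delta> < \<delta>0" using cInf_lower[OF D1 bdd] \<delta> by (simp add: \<Delta>_def)
    \<comment> \<open>The increments are scaled by \<open>\<delta>0 - \<Delta>\<close> so that every
      member of the minimizing sequence, including the first, has level at most
      \<open>\<delta>0\<close>.\<close>
    have "\<exists>\<delta> P Q. 0 \<le> \<delta> \<and> feas (h ^ 5) \<delta> P Q \<and> \<delta> < \<Delta> + (\<delta>0 - \<Delta>) * inverse (real (Suc n))" for n
    proof -
      have "(\<delta>0 - \<Delta>) * inverse (real (Suc n)) > 0" using \<Delta>1 by (intro mult_pos_pos) auto
      hence "Inf D < \<Delta> + (\<delta>0 - \<Delta>) * inverse (real (Suc n))" unfolding \<Delta>_def by simp
      then obtain \<delta> where "\<delta> \<in> D" "\<delta> < \<Delta> + (\<delta>0 - \<Delta>) * inverse (real (Suc n))"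
        using cInf_lessD[of D] D1 by blast
      thus ?thesis by (auto simp: D_def)
    qed
    then obtain d p q where F: "\<And>n. 0 \<le> d n" "\<And>n. feas (h ^ 5) (d n) (p n) (q n)"
      and d: "\<And>n. d n < \<Delta> + (\<delta>0 - \<Delta>) * inverse (real (Suc n))" by metis
    have "d n \<le> \<delta>0" for n
    proof -
      have "(\<delta>0 - \<Delta>) * inverse (real (Suc n)) \<le> (\<delta>0 - \<Delta>) * 1"
        using \<Delta>1 by (intro mult_left_mono) (auto simp: inverse_eq_divide)
      with d[of n] show ?thesis by simp
    qed
    note near' = near[OF F(2) this]
    have dlim: "d \<longlonglongrightarrow> \<Delta>"
    proof (rule tendsto_sandwich)
      show "\<forall>\<^sub>F n in sequentially. \<Delta> \<le> d n" using \<Delta>_le F by (intro always_eventually) blast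
      show "\<forall>\<^sub>F n in sequentially. d n \<le> \<Delta> + (\<delta>0 - \<Delta>) * inverse (real (Suc n))"
        using d by (intro always_eventually) (auto intro: less_imp_le)
      have "(\<lambda>n. \<Delta> + (\<delta>0 - \<Delta>) * inverse (real (Suc n))) \<longlonglongrightarrow> \<Delta> + (\<delta>0 - \<Delta>) * 0"
        by (intro tendsto_intros LIMSEQ_inverse_real_of_nat)
      thus "(\<lambda>n. \<Delta> + (\<delta>0 - \<Delta>) * inverse (real (Suc n))) \<longlonglongrightarrow> \<Delta>" by simp
    qed simp
    have "dist (of_real alpha_opt) (p n * of_real h) \<le> \<epsilon>" "dist (of_real beta_opt) (q n / of_real h ^ 3) \<le> \<epsilon>" for n
      using near'[of n] by (auto simp: dist_commute)
    hence "range (\<lambda>n. (p n * of_real h, q n / of_real h ^ 3)) \<subseteq> cball (of_real alpha_opt) \<epsilon> \<times> cball (of_real beta_opt) \<epsilon>"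
      by auto
    hence "bounded (range (\<lambda>n. (p n * of_real h, q n / of_real h ^ 3)))"
      by (rule bounded_subset[OF bounded_Times[OF bounded_cball bounded_cball]])
    then obtain \<phi> pq where \<phi>: "strict_mono \<phi>"
      and lim: "((\<lambda>n. (p n * of_real h, q n / of_real h ^ 3)) \<circ> \<phi>) \<longlonglongrightarrow> pq"
      using bounded_imp_convergent_subsequence by blast
    have "(\<lambda>n. p (\<phi> n) * of_real h / of_real h) \<longlonglongrightarrow> fst pq / of_real h"
      using tendsto_fst[OF lim] h by (intro tendsto_intros) (auto simp: o_def)
    hence plim: "(\<lambda>n. p (\<phi> n)) \<longlonglongrightarrow> fst pq / of_real h" using h by simp
    have "(\<lambda>n. q (\<phi> n) / of_real h ^ 3 * of_real h ^ 3) \<longlonglongrightarrow> snd pq * of_real h ^ 3"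
      using tendsto_snd[OF lim] by (intro tendsto_intros) (auto simp: o_def)
    hence qlim: "(\<lambda>n. q (\<phi> n)) \<longlonglongrightarrow> snd pq * of_real h ^ 3" using h by simp
    define P Q where "P = fst pq / of_real h" and "Q = snd pq * of_real h ^ 3"
    have FPQ: "feas (h ^ 5) \<Delta> P Q"
      unfolding P_def Q_def
      by (rule feas_limit[OF _ _ plim qlim, of _ "\<lambda>n. d (\<phi> n)"])
         (use F LIMSEQ_subseq_LIMSEQ[OF dlim \<phi>] in \<open>auto simp: o_def\<close>)
    have uniq: "P' = P \<and> Q' = Q" if "feas (h ^ 5) \<Delta> P' Q'" for P' Q'
      by (rule optimal_unique[OF _ \<Delta>_le \<Delta>0 that FPQ])
         (use h near_cone[OF that] near_cone[OF FPQ] \<Delta>1 in auto)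
    have "optimum (h ^ 5) \<Delta> P Q"
      unfolding optimum_def using \<Delta>0 \<Delta>_le FPQ uniq by blast
    thus ?case by blast
  qed
qed

text \<open>The candidate bounds the optimal level from above and localization bounds it from below,
  which squeezes its rate to \<open>kappa_opt\<close>; applied to the optimal pair, localization
  also gives the parameter limits.\<close>

theorem optimum_asymptotics:
  "\<exists>(\<alpha> :: real \<Rightarrow> complex) (\<beta> :: real \<Rightarrow> complex) D.
     (\<alpha> \<longlongrightarrow> of_real alpha_opt) (at_right 0) \<and> (\<beta> \<longlongrightarrow> of_real beta_opt) (at_right 0) \<and>
     ((\<lambda>h. (1 - D h) / h) \<longlongrightarrow> kappa_opt) (at_right 0) \<and>
     (\<forall>\<^sub>F h in at_right 0. optimum (h ^ 5) (D h) (\<alpha> h / of_real h) (\<beta> h * of_real h ^ 3))"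
proof -
  define X where "X h = (SOME X. optimum (h ^ 5) (fst X) (fst (snd X)) (snd (snd X)))" for h
  define D P Q where "D h = fst (X h)" and "P h = fst (snd (X h))" and "Q h = snd (snd (X h))" for h
  have DPQ: "optimum (h ^ 5) (D h) (P h) (Q h)" if ex: "\<exists>\<Delta> P Q. optimum (h ^ 5) \<Delta> P Q" for h
  proof -
    from ex have "\<exists>X. optimum (h ^ 5) (fst X) (fst (snd X)) (snd (snd X))" by force
    thus ?thesis unfolding X_def D_def P_def Q_def by (rule someI_ex)
  qed
  define \<alpha> \<beta> where "\<alpha> h = P h * of_real h" and "\<beta> h = Q h / of_real h ^ 3" for h
  have pos: "\<forall>\<^sub>F h::real in at_right 0. h > 0" by (rule eventually_at_right_less)
  from eventually_optimum pos
  have opt: "\<forall>\<^sub>F h in at_right 0. optimum (h ^ 5) (D h) (\<alpha> h / of_real h) (\<beta> h * of_real h ^ 3)"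
  proof eventually_elim
    case (elim h)
    from DPQ[OF elim(1)] elim(2) show ?case by (simp add: \<alpha>_def \<beta>_def)
  qed
  have upper: "\<forall>\<^sub>F h in at_right 0. D h \<le> exp (-((kappa_opt - \<epsilon>) * h))" if "0 < \<epsilon>" "\<epsilon> < kappa_opt" for \<epsilon>
    using opt candidate_feas[OF that]
  proof eventually_elim
    case (elim h)
    have "0 \<le> exp (-((kappa_opt - \<epsilon>) * h))" by simp
    with elim show ?case unfolding optimum_def by blast
  qed
  have loc: "\<forall>\<^sub>F h in at_right 0. dist (\<alpha> h) (of_real alpha_opt) < \<epsilon> \<and> dist (\<beta> h) (of_real beta_opt) < \<epsilon>
      \<and> exp (-((kappa_opt + \<epsilon>) * h)) \<le> D h" if \<epsilon>: "\<epsilon> > 0" for \<epsilon>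
  proof -
    from parameters_localized[OF \<epsilon>] obtain \<eta> where \<eta>: "\<eta> > 0"
      and L: "\<And>h t \<alpha> \<beta>. 0 < h \<Longrightarrow> h < \<eta> \<Longrightarrow> kappa_opt - \<eta> \<le> t \<Longrightarrow>
        feas (h ^ 5) (exp (-(t * h))) (\<alpha> / of_real h) (\<beta> * of_real h ^ 3) \<Longrightarrow>
        dist \<alpha> (of_real alpha_opt) < \<epsilon> \<and> dist \<beta> (of_real beta_opt) < \<epsilon> \<and> t < kappa_opt + \<epsilon>" by blast
    define \<epsilon>' where "\<epsilon>' = min \<eta> kappa_opt / 2"
    have \<epsilon>': "0 < \<epsilon>'" "\<epsilon>' < kappa_opt" "\<epsilon>' < \<eta>" using \<eta> kappa_opt_pos by (auto simp: \<epsilon>'_def)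
    have "\<forall>\<^sub>F h in at_right 0. h \<in> {0<..<\<eta>}" using \<eta> by (rule eventually_at_right_real)
    with opt upper[OF \<epsilon>'(1,2)] show ?thesis
    proof eventually_elim
      case (elim h)
      have F: "feas (h ^ 5) (D h) (\<alpha> h / of_real h) (\<beta> h * of_real h ^ 3)"
        using elim(1) unfolding optimum_def by blast
      \<comment> \<open>A smaller level would make the pair feasible with rate exactly
        \<open>kappa_opt + \<epsilon>\<close>, which localization excludes.\<close>
      have "exp (-((kappa_opt + \<epsilon>) * h)) \<le> D h"
      proof (rule ccontr)
        assume "\<not> ?thesis"
        hence "feas (h ^ 5) (exp (-((kappa_opt + \<epsilon>) * h))) (\<alpha> h / of_real h) (\<beta> h * of_real h ^ 3)"
          by (intro feas_mono[OF F]) simp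
        from L[OF _ _ _ this] elim \<epsilon> \<eta> show False by auto
      qed
      moreover have "feas (h ^ 5) (exp (-((kappa_opt - \<epsilon>') * h))) (\<alpha> h / of_real h) (\<beta> h * of_real h ^ 3)"
        using elim by (intro feas_mono[OF F])
      from L[OF _ _ _ this] elim \<epsilon>'
      have "dist (\<alpha> h) (of_real alpha_opt) < \<epsilon>" "dist (\<beta> h) (of_real beta_opt) < \<epsilon>" by auto
      ultimately show ?case by blast
    qed
  qed
  have lim\<alpha>: "(\<alpha> \<longlongrightarrow> of_real alpha_opt) (at_right 0)"
    by (rule tendstoI, drule loc, erule eventually_mono) auto
  have lim\<beta>: "(\<beta> \<longlongrightarrow> of_real beta_opt) (at_right 0)"
    by (rule tendstoI, drule loc, erule eventually_mono) auto
  have limD: "((\<lambda>h. (1 - D h) / h) \<longlongrightarrow> kappa_opt) (at_right 0)"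
  proof (rule order_tendstoI)
    fix x assume x: "kappa_opt < x"
    have "\<forall>\<^sub>F h in at_right 0. dist (\<alpha> h) (of_real alpha_opt) < (x - kappa_opt) / 2 \<and> dist (\<beta> h) (of_real beta_opt) < (x - kappa_opt) / 2
      \<and> exp (-((kappa_opt + (x - kappa_opt) / 2) * h)) \<le> D h" using x by (intro loc) simp
    with pos show "\<forall>\<^sub>F h in at_right 0. (1 - D h) / h < x"
    proof eventually_elim
      case (elim h)
      have "1 - (kappa_opt + (x - kappa_opt) / 2) * h \<le> exp (-((kappa_opt + (x - kappa_opt) / 2) * h))"
        using exp_ge_add_one_self[of "-((kappa_opt + (x - kappa_opt) / 2) * h)"] by simp
      with elim have "1 - D h \<le> (kappa_opt + (x - kappa_opt) / 2) * h" by linarith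
      hence "(1 - D h) / h \<le> kappa_opt + (x - kappa_opt) / 2" using elim by (simp add: field_simps)
      also have "\<dots> < x" using x by (simp add: field_simps)
      finally show ?case .
    qed
  next
    fix x assume x: "x < kappa_opt"
    define \<epsilon> where "\<epsilon> = min (kappa_opt - x) kappa_opt / 2"
    have \<epsilon>: "0 < \<epsilon>" "\<epsilon> < kappa_opt" "x < kappa_opt - \<epsilon>" using x kappa_opt_pos by (auto simp: \<epsilon>_def min_def field_simps)
    have "((\<lambda>h. (kappa_opt - \<epsilon>) / (1 + (kappa_opt - \<epsilon>) * h)) \<longlongrightarrow> (kappa_opt - \<epsilon>) / (1 + (kappa_opt - \<epsilon>) * 0)) (at_right 0)"
      by (intro tendsto_intros) auto
    hence "\<forall>\<^sub>F h in at_right 0. x < (kappa_opt - \<epsilon>) / (1 + (kappa_opt - \<epsilon>) * h)"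
      using \<epsilon> by (intro order_tendstoD) auto
    with pos upper[OF \<epsilon>(1,2)] show "\<forall>\<^sub>F h in at_right 0. x < (1 - D h) / h"
    proof eventually_elim
      case (elim h)
      define u where "u = (kappa_opt - \<epsilon>) * h"
      have u: "u > 0" using \<epsilon> elim by (simp add: u_def)
      \<comment> \<open>Inverting this inequality turns the exponential upper bound on
        \<open>D h\<close> into a rational one whose quotient by \<open>h\<close> has an evident
        limit.\<close>
      have "1 + u \<le> exp u" by (rule exp_ge_add_one_self)
      hence "exp (-u) \<le> 1 / (1 + u)" using u by (simp add: exp_minus field_simps)
      hence "D h \<le> 1 / (1 + u)" using elim by (simp add: u_def)
      hence "u / (1 + u) \<le> 1 - D h" using u by (simp add: field_simps)
      hence "(u / (1 + u)) / h \<le> (1 - D h) / h" using elim by (intro divide_right_mono) auto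
      moreover have "(u / (1 + u)) / h = (kappa_opt - \<epsilon>) / (1 + (kappa_opt - \<epsilon>) * h)" using elim by (simp add: u_def)
      ultimately show ?case using elim by simp
    qed
  qed
  from lim\<alpha> lim\<beta> limD opt show ?thesis by blast
qed

end

section \<open>The set of spectral values\<close>

text \<open>The square root in \<open>rho\<close> as a function of the wave number and of
  \<open>\<xi> = \<omega> + c * k\<close>; the argument \<open>X\<close> stands for
  \<open>x0sq nu a b\<close>.\<close>

definition sroot :: "real \<Rightarrow> real \<Rightarrow> real \<Rightarrow> real \<Rightarrow> complex" where
  "sroot nu X k \<xi> = csqrt (Complex (X + 4 * nu\<^sup>2 * k\<^sup>2) (4 * nu * \<xi>))"

lemma sroot_square: "(sroot nu X k \<xi>)\<^sup>2 = Complex (X + 4 * nu\<^sup>2 * k\<^sup>2) (4 * nu * \<xi>)"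
  by (simp add: sroot_def)

lemma Re_sroot_nonneg: "0 \<le> Re (sroot nu X k \<xi>)"
  unfolding sroot_def by (rule Re_csqrt)

lemma sroot_Re_Im:
  "(Re (sroot nu X k \<xi>))\<^sup>2 - (Im (sroot nu X k \<xi>))\<^sup>2 = X + 4 * nu\<^sup>2 * k\<^sup>2"
  "Re (sroot nu X k \<xi>) * Im (sroot nu X k \<xi>) = 2 * nu * \<xi>"
  using sroot_square[of nu X k \<xi>]
  by (simp_all add: complex_eq_iff power2_eq_square algebra_simps)

lemma sroot_sector:
  assumes "X \<ge> 0"
  shows "\<bar>Im (sroot nu X k \<xi>)\<bar> \<le> Re (sroot nu X k \<xi>)"
proof -
  have "(Im (sroot nu X k \<xi>))\<^sup>2 \<le> (Re (sroot nu X k \<xi>))\<^sup>2"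
    using sroot_Re_Im(1)[of nu X k \<xi>] assms by (smt (verit) mult_nonneg_nonneg zero_le_power2)
  thus ?thesis using Re_sroot_nonneg[of nu X k \<xi>] by (simp add: abs_le_square_iff[symmetric])
qed

text \<open>Eliminating the imaginary part from the two component equations leaves a quadratic
  equation for the square of the real part.\<close>

lemma sroot_quartic:
  "(Re (sroot nu X k \<xi>))\<^sup>2 * ((Re (sroot nu X k \<xi>))\<^sup>2 - (X + 4 * nu\<^sup>2 * k\<^sup>2)) = 4 * nu\<^sup>2 * \<xi>\<^sup>2"
proof -
  have "(Re (sroot nu X k \<xi>))\<^sup>2 - (X + 4 * nu\<^sup>2 * k\<^sup>2) = (Im (sroot nu X k \<xi>))\<^sup>2"
    using sroot_Re_Im(1)[of nu X k \<xi>] by simp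
  hence "(Re (sroot nu X k \<xi>))\<^sup>2 * ((Re (sroot nu X k \<xi>))\<^sup>2 - (X + 4 * nu\<^sup>2 * k\<^sup>2))
      = (Re (sroot nu X k \<xi>) * Im (sroot nu X k \<xi>))\<^sup>2" by (simp add: power_mult_distrib)
  thus ?thesis unfolding sroot_Re_Im(2) by (simp add: power_mult_distrib)
qed

lemma Re_sroot_ge: "X + 4 * nu\<^sup>2 * k\<^sup>2 \<le> (Re (sroot nu X k \<xi>))\<^sup>2"
  using sroot_Re_Im(1)[of nu X k \<xi>] by (smt (verit) zero_le_power2)

text \<open>The real part of the principal root of \<open>z\<close> is
  \<open>sqrt ((cmod z + Re z) / 2)\<close>.\<close>

lemma phi_eq_Re_sroot: "phi nu a b k \<xi> = 4 * Re (sroot nu (x0sq nu a b) k \<xi>)"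
proof -
  define N where "N = sqrt ((x0sq nu a b + 4 * nu\<^sup>2 * k\<^sup>2)\<^sup>2 + 16 * nu\<^sup>2 * \<xi>\<^sup>2) + x0sq nu a b + 4 * nu\<^sup>2 * k\<^sup>2"
  have "Re (sroot nu (x0sq nu a b) k \<xi>) = sqrt (N / 2)"
    by (simp add: sroot_def N_def cmod_def power_mult_distrib add.assoc)
  also have "4 * sqrt (N / 2) = 2 * sqrt 2 * sqrt N"
  proof -
    have "4 = 2 * (sqrt 2 * sqrt 2)" by simp
    hence "4 * sqrt (N / 2) = 2 * sqrt 2 * (sqrt 2 * sqrt (N / 2))" by (simp only: mult.assoc)
    also have "sqrt 2 * sqrt (N / 2) = sqrt N" by (simp flip: real_sqrt_mult)
    finally show ?thesis .
  qed
  finally show ?thesis by (simp add: phi_def N_def)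
qed

section \<open>The least real part over the admissible frequencies\<close>

lemma phi_uminus: "phi nu a b k (-\<xi>) = phi nu a b k \<xi>"
  by (simp add: phi_def)

text \<open>With \<open>x\<close> fixed, \<open>Re (sroot \<dots>) \<ge> x\<close> amounts to a lower bound on the quadratic form \<open>x\<^sup>2 k\<^sup>2 + \<xi>\<^sup>2\<close>.\<close>

lemma Re_sroot_mono:
  assumes "(Re (sroot nu X k1 \<xi>1))\<^sup>2 * k1\<^sup>2 + \<xi>1\<^sup>2 \<le> (Re (sroot nu X k1 \<xi>1))\<^sup>2 * k\<^sup>2 + \<xi>\<^sup>2"
  shows "Re (sroot nu X k1 \<xi>1) \<le> Re (sroot nu X k \<xi>)"
proof (rule ccontr)
  define x1 x Z where "x1 = Re (sroot nu X k1 \<xi>1)" and "x = Re (sroot nu X k \<xi>)"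
    and "Z = X + 4 * nu\<^sup>2 * k\<^sup>2"
  assume "\<not> ?thesis"
  hence lt: "x < x1" by (simp add: x_def x1_def)
  have x0: "x \<ge> 0" unfolding x_def by (rule Re_sroot_nonneg)
  have sq: "x\<^sup>2 < x1\<^sup>2" using lt x0 by (intro power_strict_mono) auto
  have Z: "Z \<le> x\<^sup>2" unfolding x_def Z_def by (rule Re_sroot_ge)
  \<comment> \<open>If \<open>x < x1\<close>, the quartic relations at both points and the
    hypothesis give \<open>x1\<^sup>2 * (x1\<^sup>2 - Z) \<le> x\<^sup>2 * (x\<^sup>2 - Z)\<close>,
    whereas the product increases strictly with its first argument.\<close>
  have "x1\<^sup>2 * (x1\<^sup>2 - Z) = x1\<^sup>2 * (x1\<^sup>2 - (X + 4 * nu\<^sup>2 * k1\<^sup>2)) + 4 * nu\<^sup>2 * (x1\<^sup>2 * k1\<^sup>2) - 4 * nu\<^sup>2 * (x1\<^sup>2 * k\<^sup>2)"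
    by (simp add: Z_def algebra_simps)
  also have "\<dots> = 4 * nu\<^sup>2 * (x1\<^sup>2 * k1\<^sup>2 + \<xi>1\<^sup>2) - 4 * nu\<^sup>2 * (x1\<^sup>2 * k\<^sup>2)"
    unfolding x1_def sroot_quartic by (simp add: algebra_simps)
  also have "\<dots> \<le> 4 * nu\<^sup>2 * (x1\<^sup>2 * k\<^sup>2 + \<xi>\<^sup>2) - 4 * nu\<^sup>2 * (x1\<^sup>2 * k\<^sup>2)"
    using assms unfolding x1_def by (intro diff_right_mono mult_left_mono) auto
  also have "\<dots> = x\<^sup>2 * (x\<^sup>2 - Z)" unfolding x_def Z_def sroot_quartic by (simp add: algebra_simps)
  also have "\<dots> \<le> x1\<^sup>2 * (x\<^sup>2 - Z)" using sq Z by (intro mult_right_mono) auto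
  also have "\<dots> < x1\<^sup>2 * (x1\<^sup>2 - Z)"
  proof (rule mult_strict_left_mono)
    show "0 < x1\<^sup>2" using sq by (smt (verit) zero_le_power2)
  qed (use sq in simp)
  finally show False by simp
qed

text \<open>With the real part frozen at its value at \<open>(k1, \<xi>1)\<close>, the form of the
  previous lemma is convex. Nonnegativity of its first-order variation along the line
  \<open>\<xi> = \<xi>1 - C * (\<bar>k\<bar> - k1)\<close>, which is the hypothesis
  \<open>stat\<close>, therefore suffices for a minimum.\<close>

lemma Re_sroot_minimal:
  assumes xi1: "0 \<le> \<xi>1" "\<xi>1 - C * (\<bar>k\<bar> - k1) \<le> \<bar>\<xi>\<bar>"
    and stat: "0 \<le> ((Re (sroot nu X k1 \<xi>1))\<^sup>2 * k1 - \<xi>1 * C) * (\<bar>k\<bar> - k1)"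
  shows "Re (sroot nu X k1 \<xi>1) \<le> Re (sroot nu X k \<xi>)"
proof (rule Re_sroot_mono)
  define x1 d where "x1 = Re (sroot nu X k1 \<xi>1)" and "d = \<bar>k\<bar> - k1"
  have "0 \<le> (\<xi>1 - \<bar>\<xi>\<bar>)\<^sup>2" by simp
  hence "\<xi>1\<^sup>2 - \<bar>\<xi>\<bar>\<^sup>2 \<le> 2 * \<xi>1 * (\<xi>1 - \<bar>\<xi>\<bar>)" by (simp add: power2_eq_square algebra_simps)
  also have "\<dots> \<le> 2 * \<xi>1 * (C * d)" using xi1 by (intro mult_left_mono) (auto simp: d_def)
  finally have 1: "\<xi>1\<^sup>2 - \<xi>\<^sup>2 \<le> 2 * \<xi>1 * (C * d)" by simp
  have "k\<^sup>2 = (k1 + d)\<^sup>2" by (simp add: d_def)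
  hence "2 * k1 * d \<le> k\<^sup>2 - k1\<^sup>2" by (simp add: power2_eq_square algebra_simps)
  hence "x1\<^sup>2 * (2 * k1 * d) \<le> x1\<^sup>2 * (k\<^sup>2 - k1\<^sup>2)" by (intro mult_left_mono) auto
  moreover have "0 \<le> x1\<^sup>2 * (2 * k1 * d) - 2 * \<xi>1 * (C * d)"
    using stat unfolding x1_def[symmetric] d_def[symmetric] by (simp add: algebra_simps)
  ultimately show "(Re (sroot nu X k1 \<xi>1))\<^sup>2 * k1\<^sup>2 + \<xi>1\<^sup>2 \<le> (Re (sroot nu X k1 \<xi>1))\<^sup>2 * k\<^sup>2 + \<xi>\<^sup>2"
    using 1 unfolding x1_def[symmetric] right_diff_distrib by linarith
qed

text \<open>The last equation says that the first-order variation along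
  \<open>\<xi> = om - \<bar>c\<bar> * k\<close> vanishes at \<open>kbar\<close>, which explains its
  closed form.\<close>

lemma kbar_stationary:
  fixes nu a b c om :: real
  assumes "nu > 0" "b \<ge> 0" "om > 0"
  defines "kb \<equiv> kbar nu a b c om"
  defines "x \<equiv> Re (sroot nu (x0sq nu a b) kb (om - \<bar>c\<bar> * kb))"
  shows "0 \<le> kb" "0 \<le> om - \<bar>c\<bar> * kb" "0 < x" "kb * (x\<^sup>2 + c\<^sup>2) = om * \<bar>c\<bar>"
proof -
  define X where "X = x0sq nu a b"
  define D where "D = c\<^sup>2 + X"
  define sq where "sq = sqrt (D\<^sup>2 + 16 * nu\<^sup>2 * om\<^sup>2)"
  \<comment> \<open>\<open>u\<close> is the positive root of
    \<open>u * (u - D) = 4 * nu\<^sup>2 * om\<^sup>2\<close>; it turns out to be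
    \<open>x\<^sup>2 + c\<^sup>2\<close>, and \<open>w\<close> to be
    \<open>x\<^sup>2\<close>.\<close>
  define u w \<xi>1 where "u = (D + sq) / 2" and "w = u - c\<^sup>2" and "\<xi>1 = om - \<bar>c\<bar> * kb"
  have X: "X \<ge> 0" using assms by (simp add: X_def x0sq_def)
  have D: "D \<ge> 0" using X by (simp add: D_def)
  have no: "nu\<^sup>2 * om\<^sup>2 > 0" using assms by simp
  have "sqrt (D\<^sup>2) < sq" unfolding sq_def using no by (intro real_sqrt_less_mono) simp
  hence sqD: "D < sq" using D by simp
  have u: "u > D" "u > 0" "sq - D = 2 * (u - D)" using sqD D by (auto simp: u_def)
  have "sq\<^sup>2 = D\<^sup>2 + 16 * nu\<^sup>2 * om\<^sup>2" unfolding sq_def by (intro real_sqrt_pow2) simp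
  hence uD: "u * (u - D) = 4 * nu\<^sup>2 * om\<^sup>2" by (simp add: u_def power2_eq_square algebra_simps)
  have w: "w > 0" "u * (w - X) = 4 * nu\<^sup>2 * om\<^sup>2"
    using u X uD by (auto simp: w_def D_def algebra_simps)
  have kb: "kb = \<bar>c\<bar> * (sq - D) / (8 * nu\<^sup>2 * om)"
    by (simp add: kb_def kbar_def sq_def D_def X_def)
  have kbu: "kb * u = \<bar>c\<bar> * om"
  proof -
    have "kb * u = \<bar>c\<bar> * (2 * (u * (u - D))) / (8 * nu\<^sup>2 * om)"
      unfolding kb u(3) by (simp only: times_divide_eq_left times_divide_eq_right mult_ac)
    also have "\<dots> = \<bar>c\<bar> * om" unfolding uD using assms by (simp add: power2_eq_square)
    finally show ?thesis .
  qed
  show kb0: "0 \<le> kb" unfolding kb using sqD assms by simp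
  have "u * \<xi>1 = om * u - \<bar>c\<bar> * (kb * u)" by (simp add: \<xi>1_def algebra_simps)
  also have "\<dots> = om * w" unfolding kbu by (simp add: w_def power2_eq_square algebra_simps flip: abs_mult)
  finally have \<xi>u: "u * \<xi>1 = om * w" .
  have "0 < u * \<xi>1" unfolding \<xi>u using w assms by simp
  thus "0 \<le> om - \<bar>c\<bar> * kb" using u by (simp add: \<xi>1_def zero_less_mult_iff)
  define Z where "Z = X + 4 * nu\<^sup>2 * kb\<^sup>2"
  have wZ: "w * (w - Z) = 4 * nu\<^sup>2 * \<xi>1\<^sup>2"
  proof -
    have "u\<^sup>2 * (w * (w - Z)) = w * (u * (u * (w - X)) - 4 * nu\<^sup>2 * (kb * u)\<^sup>2)"
      by (simp add: Z_def power2_eq_square algebra_simps)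
    also have "\<dots> = w * (4 * nu\<^sup>2 * om\<^sup>2 * (u - c\<^sup>2))"
      unfolding w(2) kbu by (simp add: power_mult_distrib algebra_simps)
    also have "\<dots> = 4 * nu\<^sup>2 * (om * w)\<^sup>2" by (simp add: w_def power2_eq_square)
    also have "\<dots> = u\<^sup>2 * (4 * nu\<^sup>2 * \<xi>1\<^sup>2)" unfolding \<xi>u[symmetric] by (simp add: power_mult_distrib)
    finally show ?thesis using u by simp
  qed
  have xZ: "x\<^sup>2 * (x\<^sup>2 - Z) = 4 * nu\<^sup>2 * \<xi>1\<^sup>2" "Z \<le> x\<^sup>2"
    unfolding x_def Z_def X_def \<xi>1_def by (rule sroot_quartic, rule Re_sroot_ge)
  \<comment> \<open>\<open>w\<close> and \<open>x\<^sup>2\<close> solve the same quadratic equation,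
    and the second factor is positive because \<open>Z \<le> x\<^sup>2\<close> and
    \<open>w > 0\<close>.\<close>
  have "(x\<^sup>2 - w) * (x\<^sup>2 + w - Z) = x\<^sup>2 * (x\<^sup>2 - Z) - w * (w - Z)" by (simp add: algebra_simps)
  also have "\<dots> = 0" using xZ wZ by simp
  finally have xw: "x\<^sup>2 = w" using xZ w by auto
  show "0 < x" using xw w Re_sroot_nonneg[of nu "x0sq nu a b" kb "om - \<bar>c\<bar> * kb"] unfolding x_def
    by (cases "Re (sroot nu (x0sq nu a b) kb (om - \<bar>c\<bar> * kb)) = 0") auto
  show "kb * (x\<^sup>2 + c\<^sup>2) = om * \<bar>c\<bar>" using kbu by (simp add: xw w_def)
qed

text \<open>A frequency with \<open>\<bar>\<omega>\<bar> \<ge> om\<close> gives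
  \<open>\<bar>\<xi>\<bar> \<ge> om - \<bar>c\<bar> * \<bar>k\<bar>\<close>. Over this region the
  minimum sits at the stationary point, or at \<open>km\<close> on the boundary line, or, past the
  point where that line meets zero, at \<open>km\<close> with \<open>\<xi> = 0\<close>. The
  disjunction for \<open>\<xi>1\<close> ensures that an actual frequency realizes it.\<close>

lemma Aconst_minimal:
  fixes nu a b c km om :: real
  assumes "nu > 0" "b \<ge> 0" "km \<ge> 0" "om > 0"
  obtains k1 \<xi>1 where "km \<le> k1" "\<xi>1 = om - \<bar>c\<bar> * k1 \<or> \<xi>1 = 0 \<and> om \<le> \<bar>c\<bar> * k1"
    "Aconst nu a b c km om = 4 * Re (sroot nu (x0sq nu a b) k1 \<xi>1)"
    "0 < Re (sroot nu (x0sq nu a b) k1 \<xi>1)"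
    "\<And>k \<xi>. km \<le> \<bar>k\<bar> \<Longrightarrow> om - \<bar>c\<bar> * \<bar>k\<bar> \<le> \<bar>\<xi>\<bar> \<Longrightarrow>
       Re (sroot nu (x0sq nu a b) k1 \<xi>1) \<le> Re (sroot nu (x0sq nu a b) k \<xi>)"
proof -
  define X where "X = x0sq nu a b"
  define kb where "kb = kbar nu a b c om"
  define xb where "xb = Re (sroot nu X kb (om - \<bar>c\<bar> * kb))"
  note kbs = kbar_stationary[OF assms(1,2,4), where a = a and c = c, folded kb_def X_def, folded xb_def]
  have X: "X \<ge> 0" using assms by (simp add: X_def x0sq_def)
  \<comment> \<open>The first-order variation is zero at \<open>kb\<close>, so the comparison holds
    on both sides of it.\<close>
  have glob: "xb \<le> Re (sroot nu X k \<xi>)" if "om - \<bar>c\<bar> * \<bar>k\<bar> \<le> \<bar>\<xi>\<bar>" for k \<xi>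
    unfolding xb_def
  proof (rule Re_sroot_minimal[where C = "\<bar>c\<bar>"])
    show "om - \<bar>c\<bar> * kb - \<bar>c\<bar> * (\<bar>k\<bar> - kb) \<le> \<bar>\<xi>\<bar>" using that by (simp add: algebra_simps)
    have "xb\<^sup>2 * kb - (om - \<bar>c\<bar> * kb) * \<bar>c\<bar> = 0"
      using kbs(4) by (simp add: algebra_simps power2_eq_square)
    thus "0 \<le> ((Re (sroot nu X kb (om - \<bar>c\<bar> * kb)))\<^sup>2 * kb - (om - \<bar>c\<bar> * kb) * \<bar>c\<bar>) * (\<bar>k\<bar> - kb)"
      by (simp add: xb_def)
  qed (fact kbs(2))
  have phi': "phi nu a b k (- om + \<bar>c\<bar> * k) = 4 * Re (sroot nu X k (om - \<bar>c\<bar> * k))" for k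
    using phi_uminus[of nu a b k "om - \<bar>c\<bar> * k"] by (simp add: phi_eq_Re_sroot X_def)
  consider (1) "km \<le> kb" | (2) "kb < km" "c = 0 \<or> km \<le> om / \<bar>c\<bar>" | (3) "kb < km" "c \<noteq> 0" "om / \<bar>c\<bar> < km"
    by linarith
  thus thesis
  proof cases
    case 1
    show thesis
    proof (rule that[folded X_def])
      show "Aconst nu a b c km om = 4 * Re (sroot nu X kb (om - \<bar>c\<bar> * kb))"
        unfolding Aconst_def Let_def kb_def[symmetric] phi' using 1 by simp
    qed (use 1 glob kbs in \<open>auto simp: xb_def\<close>)
  next
    case 2
    define x1 where "x1 = Re (sroot nu X km (om - \<bar>c\<bar> * km))"
    have \<xi>1: "om - \<bar>c\<bar> * km \<ge> 0"
      using 2 assms by (cases "c = 0") (auto simp: field_simps)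
    have x1: "xb \<le> x1" unfolding x1_def using assms by (intro glob) auto
    \<comment> \<open>Compared with the stationary equation at \<open>kb\<close>, both factors have
      grown; so the variation at \<open>km\<close> is nonnegative towards larger wave
      numbers.\<close>
    have "om * \<bar>c\<bar> \<le> km * (x1\<^sup>2 + c\<^sup>2)"
      unfolding kbs(4)[symmetric] using 2 x1 kbs(1,3) by (intro mult_mono add_right_mono power_mono) auto
    hence stat: "0 \<le> x1\<^sup>2 * km - (om - \<bar>c\<bar> * km) * \<bar>c\<bar>"
      by (simp add: algebra_simps power2_eq_square)
    show thesis
    proof (rule that[folded X_def])
      show "Aconst nu a b c km om = 4 * Re (sroot nu X km (om - \<bar>c\<bar> * km))"
        unfolding Aconst_def Let_def kb_def[symmetric] phi' using 2 by simp
      show "0 < Re (sroot nu X km (om - \<bar>c\<bar> * km))" using x1 kbs(3) by (simp add: x1_def)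
      fix k \<xi> assume k: "km \<le> \<bar>k\<bar>" "om - \<bar>c\<bar> * \<bar>k\<bar> \<le> \<bar>\<xi>\<bar>"
      show "Re (sroot nu X km (om - \<bar>c\<bar> * km)) \<le> Re (sroot nu X k \<xi>)"
      proof (rule Re_sroot_minimal[where C = "\<bar>c\<bar>"])
        show "om - \<bar>c\<bar> * km - \<bar>c\<bar> * (\<bar>k\<bar> - km) \<le> \<bar>\<xi>\<bar>" using k by (simp add: algebra_simps)
        show "0 \<le> ((Re (sroot nu X km (om - \<bar>c\<bar> * km)))\<^sup>2 * km - (om - \<bar>c\<bar> * km) * \<bar>c\<bar>) * (\<bar>k\<bar> - km)"
          using stat k by (intro mult_nonneg_nonneg) (auto simp: x1_def)
      qed (fact \<xi>1)
    qed auto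
  next
    case 3
    have ck: "om < \<bar>c\<bar> * km" using 3 by (simp add: field_simps)
    hence km: "km > 0" using assms by (cases "km = 0") auto
    show thesis
    proof (rule that[folded X_def])
      show "Aconst nu a b c km om = 4 * Re (sroot nu X km 0)"
        using 3 by (simp add: Aconst_def phi_eq_Re_sroot X_def flip: kb_def)
      have "0 < 4 * nu\<^sup>2 * km\<^sup>2" using km assms by simp
      hence "0 < (Re (sroot nu X km 0))\<^sup>2" using Re_sroot_ge[of X nu km 0] X by linarith
      thus "0 < Re (sroot nu X km 0)" using Re_sroot_nonneg[of nu X km 0]
        by (cases "Re (sroot nu X km 0) = 0") auto
      fix k \<xi> assume k: "km \<le> \<bar>k\<bar>"
      show "Re (sroot nu X km 0) \<le> Re (sroot nu X k \<xi>)"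
        by (rule Re_sroot_minimal[where C = 0]) (use k assms in \<open>auto intro!: mult_nonneg_nonneg\<close>)
    qed (use ck in auto)
  qed
qed

section \<open>The square roots over the frequency domain\<close>

definition spectrum :: "real \<Rightarrow> real \<Rightarrow> real \<Rightarrow> real \<Rightarrow> real \<Rightarrow> real \<Rightarrow> complex set" where
  "spectrum nu a b c km om = (\<lambda>(\<omega>, k). sroot nu (x0sq nu a b) k (\<omega> + c * k)) ` Dinf km om"

lemma spectrumI:
  "om \<le> \<bar>\<omega>\<bar> \<Longrightarrow> km \<le> \<bar>k\<bar> \<Longrightarrow> \<xi> = \<omega> + c * k \<Longrightarrow> sroot nu (x0sq nu a b) k \<xi> \<in> spectrum nu a b c km om"
  unfolding spectrum_def Dinf_def by (rule image_eqI[of _ _ "(\<omega>, k)"]) auto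

text \<open>On the branch cut the principal root is purely imaginary. Positivity of the real part
  thus gives continuity and compatibility with conjugation.\<close>

lemma Re_csqrt_pos_imp:
  assumes "0 < Re (csqrt z)"
  shows "z \<notin> \<real>\<^sub>\<le>\<^sub>0"
proof
  assume "z \<in> \<real>\<^sub>\<le>\<^sub>0"
  hence "Im z = 0" "Re z \<le> 0" by (auto simp: complex_nonpos_Reals_iff)
  thus False using assms by (simp del: csqrt.simps)
qed

lemma cnj_sroot:
  assumes "0 < Re (sroot nu X k \<xi>)"
  shows "cnj (sroot nu X k \<xi>) = sroot nu X k (-\<xi>)"
  using cnj_csqrt[OF Re_csqrt_pos_imp[OF assms[unfolded sroot_def]]]
  by (simp add: sroot_def complex_cnj)

lemma Dinf_Re_sroot_pos:
  assumes "nu > 0" "b \<ge> 0" "km \<ge> 0" "om > 0" "(\<omega>, k) \<in> Dinf km om"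
  shows "Aconst nu a b c km om / 4 \<le> Re (sroot nu (x0sq nu a b) k (\<omega> + c * k))"
    and "0 < Aconst nu a b c km om / 4"
proof -
  obtain k1 \<xi>1 where *: "Aconst nu a b c km om = 4 * Re (sroot nu (x0sq nu a b) k1 \<xi>1)"
    "0 < Re (sroot nu (x0sq nu a b) k1 \<xi>1)"
    "\<And>k \<xi>. km \<le> \<bar>k\<bar> \<Longrightarrow> om - \<bar>c\<bar> * \<bar>k\<bar> \<le> \<bar>\<xi>\<bar> \<Longrightarrow>
       Re (sroot nu (x0sq nu a b) k1 \<xi>1) \<le> Re (sroot nu (x0sq nu a b) k \<xi>)"
    using Aconst_minimal[OF assms(1-4)] by metis
  have "\<bar>\<omega>\<bar> \<le> \<bar>\<omega> + c * k\<bar> + \<bar>c * k\<bar>" by linarith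
  hence "om - \<bar>c\<bar> * \<bar>k\<bar> \<le> \<bar>\<omega> + c * k\<bar>" using assms(5) by (auto simp: Dinf_def abs_mult)
  with *(3) assms(5) show "Aconst nu a b c km om / 4 \<le> Re (sroot nu (x0sq nu a b) k (\<omega> + c * k))"
    by (simp add: Dinf_def *(1))
  show "0 < Aconst nu a b c km om / 4" using *(1,2) by simp
qed

lemma continuous_on_sroot:
  assumes "nu > 0" "b \<ge> 0" "km \<ge> 0" "om > 0"
  shows "continuous_on (Dinf km om) (\<lambda>(\<omega>, k). sroot nu (x0sq nu a b) k (\<omega> + c * k))"
proof -
  have "continuous_on (Dinf km om) (\<lambda>w. csqrt (Complex (x0sq nu a b + 4 * nu\<^sup>2 * (snd w)\<^sup>2) (4 * nu * (fst w + c * snd w))))"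
  proof (rule continuous_on_compose2[of "- \<real>\<^sub>\<le>\<^sub>0" csqrt])
    show "continuous_on (- \<real>\<^sub>\<le>\<^sub>0) csqrt" by (rule continuous_on_csqrt)
    show "continuous_on (Dinf km om) (\<lambda>w. Complex (x0sq nu a b + 4 * nu\<^sup>2 * (snd w)\<^sup>2) (4 * nu * (fst w + c * snd w)))"
      unfolding Complex_eq by (intro continuous_intros)
    show "(\<lambda>w. Complex (x0sq nu a b + 4 * nu\<^sup>2 * (snd w)\<^sup>2) (4 * nu * (fst w + c * snd w))) ` Dinf km om \<subseteq> - \<real>\<^sub>\<le>\<^sub>0"
    proof (rule image_subsetI)
      fix w assume "w \<in> Dinf km om"
      hence "(fst w, snd w) \<in> Dinf km om" by simp
      from Dinf_Re_sroot_pos[OF assms this, where a = a and c = c]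
      have "0 < Re (sroot nu (x0sq nu a b) (snd w) (fst w + c * snd w))" by linarith
      thus "Complex (x0sq nu a b + 4 * nu\<^sup>2 * (snd w)\<^sup>2) (4 * nu * (fst w + c * snd w)) \<in> - \<real>\<^sub>\<le>\<^sub>0"
        unfolding sroot_def using Re_csqrt_pos_imp by blast
    qed
  qed
  thus ?thesis by (simp add: sroot_def case_prod_beta)
qed

text \<open>The square of the root has real part at least \<open>4 * nu\<^sup>2 * k\<^sup>2\<close>
  and imaginary part \<open>4 * nu * (\<omega> + c * k)\<close>, so bounded roots come from a closed
  bounded set of frequencies.\<close>

lemma compact_spectrum:
  assumes "nu > 0" "b \<ge> 0" "km \<ge> 0" "om > 0"
  shows "compact (spectrum nu a b c km om \<inter> cball 0 R)"
proof -
  define f where "f = (\<lambda>(\<omega>, k). sroot nu (x0sq nu a b) k (\<omega> + c * k))"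
  define E where "E = Dinf km om \<inter> f -` cball 0 R"
  note cont = continuous_on_sroot[OF assms, where a = a and c = c, folded f_def]
  have X: "x0sq nu a b \<ge> 0" using assms by (simp add: x0sq_def)
  have "Dinf km om = {w. om \<le> \<bar>fst w\<bar>} \<inter> {w. km \<le> \<bar>snd w\<bar>}" by (auto simp: Dinf_def)
  moreover have "closed \<dots>"
    by (intro closed_Int closed_Collect_le continuous_intros)
  ultimately have "closed (Dinf km om)" by simp
  hence "closed E" unfolding E_def using cont by (intro continuous_closed_preimage) auto
  moreover have "bounded E"
  proof -
    define B where "B = \<bar>R\<bar> / (2 * nu)"
    define B' where "B' = R\<^sup>2 / (4 * nu) + \<bar>c\<bar> * B"
    have "E \<subseteq> cball 0 B' \<times> cball 0 B"
    proof
      fix w assume w: "w \<in> E"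
      obtain \<omega> k where wk: "w = (\<omega>, k)" by (cases w)
      define z where "z = Complex (x0sq nu a b + 4 * nu\<^sup>2 * k\<^sup>2) (4 * nu * (\<omega> + c * k))"
      have "cmod (f w) \<le> \<bar>R\<bar>" using w by (auto simp: E_def)
      hence "(cmod (f w))\<^sup>2 \<le> \<bar>R\<bar>\<^sup>2" by (intro power_mono) auto
      moreover have "(f w)\<^sup>2 = z" by (simp add: f_def wk z_def sroot_square)
      ultimately have z: "cmod z \<le> R\<^sup>2" by (simp add: norm_power[symmetric])
      have "4 * nu\<^sup>2 * k\<^sup>2 \<le> R\<^sup>2" using complex_Re_le_cmod[of z] z X by (simp add: z_def)
      hence "(2 * nu * \<bar>k\<bar>)\<^sup>2 \<le> \<bar>R\<bar>\<^sup>2" by (simp add: power_mult_distrib)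
      hence "2 * nu * \<bar>k\<bar> \<le> \<bar>R\<bar>" by (rule power2_le_imp_le) simp
      hence k: "\<bar>k\<bar> \<le> B" using assms by (simp add: B_def field_simps)
      have "\<bar>4 * nu * (\<omega> + c * k)\<bar> \<le> R\<^sup>2" using abs_Im_le_cmod[of z] z by (simp add: z_def)
      moreover have "\<bar>4 * nu * (\<omega> + c * k)\<bar> = \<bar>\<omega> + c * k\<bar> * (4 * nu)" using assms by (simp add: abs_mult)
      ultimately have "\<bar>\<omega> + c * k\<bar> \<le> R\<^sup>2 / (4 * nu)" using assms by (simp add: pos_le_divide_eq)
      moreover have "\<bar>c * k\<bar> \<le> \<bar>c\<bar> * B" using k by (simp add: abs_mult mult_left_mono)
      ultimately have "\<bar>\<omega>\<bar> \<le> B'" unfolding B'_def by linarith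
      with k show "w \<in> cball 0 B' \<times> cball 0 B" by (simp add: wk)
    qed
    thus ?thesis by (rule bounded_subset[OF bounded_Times[OF bounded_cball bounded_cball]])
  qed
  ultimately have "compact E" by (simp add: compact_eq_bounded_closed)
  moreover have "continuous_on E f" using cont by (rule continuous_on_subset) (auto simp: E_def)
  ultimately have "compact (f ` E)" by (intro compact_continuous_image)
  moreover have "f ` E = spectrum nu a b c km om \<inter> cball 0 R"
    by (auto simp: E_def spectrum_def f_def)
  ultimately show ?thesis by simp
qed

text \<open>The hyperbola is the curve \<open>k = km\<close>, along which the real part of the
  square is constant. The lower bound on its height makes \<xi> large enough for
  \<open>\<omega> = \<xi> - c * km\<close> to be admissible.\<close>

lemma sector_set_spectrum:
  fixes nu a b c km om :: real
  assumes pos: "nu > 0" "b \<ge> 0" "km \<ge> 0" "om > 0"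
  shows "\<exists>S0. sector_set (spectrum nu a b c km om) nu (Aconst nu a b c km om / 4)
     (x0sq nu a b + 4 * nu\<^sup>2 * km\<^sup>2) (max 1 (2 * nu * (om + \<bar>c\<bar> * km))) S0"
proof -
  define X where "X = x0sq nu a b"
  have X: "X \<ge> 0" using pos by (simp add: X_def x0sq_def)
  obtain k1 \<xi>1 where k1: "km \<le> k1" "\<xi>1 = om - \<bar>c\<bar> * k1 \<or> \<xi>1 = 0 \<and> om \<le> \<bar>c\<bar> * k1"
    and A: "Aconst nu a b c km om = 4 * Re (sroot nu X k1 \<xi>1)"
    and Apos: "0 < Re (sroot nu X k1 \<xi>1)"
    using Aconst_minimal[OF pos, of c a] unfolding X_def by metis
  have mem: "Aconst nu a b c km om / 4 \<le> Re S \<and> \<bar>Im S\<bar> \<le> Re S \<and> cnj S \<in> spectrum nu a b c km om"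
    if S: "S \<in> spectrum nu a b c km om" for S
  proof -
    obtain \<omega> k where wk: "(\<omega>, k) \<in> Dinf km om" "S = sroot nu X k (\<omega> + c * k)"
      using S by (auto simp: spectrum_def X_def)
    note bd = Dinf_Re_sroot_pos[OF pos wk(1), where a = a and c = c, folded X_def]
    have "0 < Re (sroot nu X k (\<omega> + c * k))" using bd by linarith
    hence "cnj S = sroot nu X k (-(\<omega> + c * k))" unfolding wk(2) by (rule cnj_sroot)
    also have "\<dots> = sroot nu X (-k) (-\<omega> + c * (-k))" by (simp add: sroot_def)
    finally have "cnj S = sroot nu X (-k) (-\<omega> + c * (-k))" .
    moreover have "sroot nu X (-k) (-\<omega> + c * (-k)) \<in> spectrum nu a b c km om"
      unfolding X_def using wk(1) by (intro spectrumI[of _ "-\<omega>"]) (auto simp: Dinf_def)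
    ultimately show ?thesis using bd sroot_sector[OF X] by (auto simp: wk(2))
  qed
  have S0: "sroot nu X k1 \<xi>1 \<in> spectrum nu a b c km om"
  proof (cases "\<xi>1 = om - \<bar>c\<bar> * k1")
    case True
    show ?thesis
    \<comment> \<open>The sign of the wave number is chosen opposite to that of \<open>c\<close>, so
      that the frequency \<open>om\<close> yields \<open>om - \<bar>c\<bar> * k1\<close>; the root
      depends on \<open>k\<close> only through its square.\<close>
    proof (cases "c \<ge> 0")
      case True
      have "sroot nu X (-k1) \<xi>1 \<in> spectrum nu a b c km om"
        unfolding X_def using k1 pos True \<open>\<xi>1 = om - \<bar>c\<bar> * k1\<close> by (intro spectrumI[of _ om]) auto
      thus ?thesis by (simp add: sroot_def)
    next
      case False
      thus ?thesis
        unfolding X_def using k1 pos \<open>\<xi>1 = om - \<bar>c\<bar> * k1\<close> by (intro spectrumI[of _ om]) auto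
    qed
  next
    case False
    thus ?thesis
      unfolding X_def using k1 pos by (intro spectrumI[of _ "- (c * k1)"]) (auto simp: abs_mult)
  qed
  have hyp: "Complex (sqrt (X + 4 * nu\<^sup>2 * km\<^sup>2 + y\<^sup>2)) y \<in> spectrum nu a b c km om"
    if y: "max 1 (2 * nu * (om + \<bar>c\<bar> * km)) \<le> y" for y
  proof -
    define Z where "Z = X + 4 * nu\<^sup>2 * km\<^sup>2"
    have Z: "Z \<ge> 0" using X by (simp add: Z_def)
    \<comment> \<open>The value for which the imaginary part of the squared point is
      \<open>4 * nu * \<xi>\<close>.\<close>
    define \<xi> where "\<xi> = y * sqrt (Z + y\<^sup>2) / (2 * nu)"
    have y1: "y \<ge> 1" "2 * nu * (om + \<bar>c\<bar> * km) \<le> y" using y by auto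
    have Zy: "Z + y\<^sup>2 > 0" using Z y1 by (intro add_nonneg_pos) auto
    have "csqrt (Complex Z (4 * nu * \<xi>)) = Complex (sqrt (Z + y\<^sup>2)) y"
    proof (rule csqrt_unique)
      have "(Complex (sqrt (Z + y\<^sup>2)) y)\<^sup>2 = Complex ((sqrt (Z + y\<^sup>2))\<^sup>2 - y\<^sup>2) (2 * (y * sqrt (Z + y\<^sup>2)))"
        by (simp add: complex_eq_iff power2_eq_square)
      thus "(Complex (sqrt (Z + y\<^sup>2)) y)\<^sup>2 = Complex Z (4 * nu * \<xi>)"
        using Zy pos by (simp add: \<xi>_def)
    qed (use Zy in simp)
    hence "sroot nu X km \<xi> = Complex (sqrt (Z + y\<^sup>2)) y" by (simp add: sroot_def Z_def)
    moreover have "sroot nu X km \<xi> \<in> spectrum nu a b c km om"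
      unfolding X_def
    proof (rule spectrumI)
      have "1 \<le> sqrt (Z + y\<^sup>2)" using Z y1 by (simp add: power2_eq_square) (smt (verit) mult_le_cancel_left1)
      hence "y * 1 \<le> y * sqrt (Z + y\<^sup>2)" using y1 by (intro mult_left_mono) auto
      hence "2 * nu * (om + \<bar>c\<bar> * km) \<le> y * sqrt (Z + y\<^sup>2)" using y1 by linarith
      hence "om + \<bar>c\<bar> * km \<le> \<xi>" using pos by (simp add: \<xi>_def field_simps)
      moreover have "\<bar>c * km\<bar> = \<bar>c\<bar> * km" using pos by (simp add: abs_mult)
      ultimately show "om \<le> \<bar>\<xi> - c * km\<bar>" by linarith
    qed (use pos in auto)
    ultimately show ?thesis by (simp add: Z_def)
  qed
  have "sector_set (spectrum nu a b c km om) nu (Aconst nu a b c km om / 4)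
     (X + 4 * nu\<^sup>2 * km\<^sup>2) (max 1 (2 * nu * (om + \<bar>c\<bar> * km))) (sroot nu X k1 \<xi>1)"
    by unfold_locales
       (use pos X A Apos mem S0 hyp compact_spectrum[OF pos, where a = a and c = c] in auto)
  thus ?thesis unfolding X_def by blast
qed

section \<open>The best approximation problem\<close>

text \<open>Since \<open>z = (S\<^sup>2 - x0sq nu a b) / (4 * nu)\<close>, the Ventcel symbol
  \<open>p + q * z\<close> is affine in \<open>S\<^sup>2\<close>.\<close>

lemma cmod_rho:
  fixes nu a b c \<omega> k L :: real and p q :: complex
  assumes "nu > 0"
  defines "S \<equiv> sroot nu (x0sq nu a b) k (\<omega> + c * k)"
  defines "s \<equiv> p - q * of_real (x0sq nu a b / (4 * nu)) + q / of_real (4 * nu) * S\<^sup>2"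
  shows "cmod (rho nu a b c \<omega> k p q L) = cmod (s - S) / cmod (s + S) * exp (- (L / (2*nu) * Re S))"
proof -
  define z where "z = complex_of_real (nu * k\<^sup>2) + \<i> * complex_of_real (\<omega> + c * k)"
  have eq: "complex_of_real (x0sq nu a b) + 4 * complex_of_real nu * z
     = Complex (x0sq nu a b + 4 * nu\<^sup>2 * k\<^sup>2) (4 * nu * (\<omega> + c * k))"
    by (simp add: z_def complex_eq_iff power2_eq_square)
  hence S: "csqrt (complex_of_real (x0sq nu a b) + 4 * complex_of_real nu * z) = S"
    by (simp add: S_def sroot_def)
  have S2: "S\<^sup>2 = complex_of_real (x0sq nu a b) + 4 * complex_of_real nu * z"
    by (simp add: S_def sroot_square eq)
  have s: "p + q * z = s" unfolding s_def S2 using assms(1) by (simp add: field_simps)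
  have "rho nu a b c \<omega> k p q L = ((s - S) / (s + S)) * exp (- complex_of_real (L / (2 * nu)) * S)"
    unfolding rho_def Let_def z_def[symmetric] S s by simp
  thus ?thesis by (simp add: norm_mult norm_divide)
qed

text \<open>At a pole, \<open>rho\<close> takes the junk value \<open>0\<close>. Poles are isolated and the frequency domain has no isolated points,
  so a bound on \<open>|rho|\<close> still excludes them.\<close>

lemma supRho_le_iff:
  fixes nu a b c km om L \<delta> :: real and p q :: complex
  assumes pos: "nu > 0" "b \<ge> 0" "km \<ge> 0" "om > 0" and \<delta>: "\<delta> \<ge> 0"
  defines "P \<equiv> p - q * of_real (x0sq nu a b / (4 * nu))" and "Q \<equiv> q / of_real (4 * nu)"
  shows "supRho nu a b c km om p q L \<le> ereal \<delta> \<longleftrightarrow>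
    (\<forall>S\<in>spectrum nu a b c km om.
       cmod (P + Q * S\<^sup>2 - S) \<le> \<delta> * exp (L / (2*nu) * Re S) * cmod (P + Q * S\<^sup>2 + S))"
    (is "_ \<longleftrightarrow> (\<forall>S\<in>_. ?B S)")
proof -
  define f where "f = (\<lambda>(\<omega>, k). sroot nu (x0sq nu a b) k (\<omega> + c * k))"
  have rho: "cmod (rho nu a b c (fst w) (snd w) p q L) =
      cmod (P + Q * (f w)\<^sup>2 - f w) / cmod (P + Q * (f w)\<^sup>2 + f w) * exp (- (L / (2*nu) * Re (f w)))" for w
    using cmod_rho[OF pos(1), of a b c "fst w" "snd w" p q L]
    by (simp add: f_def P_def Q_def case_prod_beta)
  have iff: "cmod (rho nu a b c (fst w) (snd w) p q L) \<le> \<delta> \<longleftrightarrow> ?B (f w)"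
    if "P + Q * (f w)\<^sup>2 + f w \<noteq> 0" for w
    unfolding rho using that by (simp add: exp_minus field_simps)
  have "supRho nu a b c km om p q L \<le> ereal \<delta> \<longleftrightarrow>
      (\<forall>w\<in>Dinf km om. cmod (rho nu a b c (fst w) (snd w) p q L) \<le> \<delta>)"
    by (simp add: supRho_def SUP_le_iff)
  also have "\<dots> \<longleftrightarrow> (\<forall>w\<in>Dinf km om. ?B (f w))"
  proof (intro iffI ballI)
    fix w assume "\<forall>w\<in>Dinf km om. ?B (f w)" and w: "w \<in> Dinf km om"
    hence "?B (f w)" by blast
    thus "cmod (rho nu a b c (fst w) (snd w) p q L) \<le> \<delta>"
      using iff[of w] \<delta> by (cases "P + Q * (f w)\<^sup>2 + f w = 0") (auto simp: rho)
  next
    fix w assume all: "\<forall>w\<in>Dinf km om. cmod (rho nu a b c (fst w) (snd w) p q L) \<le> \<delta>"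
      and w: "w \<in> Dinf km om"
    obtain \<omega> k where wk: "w = (\<omega>, k)" by (cases w)
    \<comment> \<open>Points approaching \<open>w\<close> with \<omega> pushed away from zero, so
      that they remain in the frequency domain.\<close>
    define v where "v n = (\<omega> + sgn \<omega> * inverse (real (Suc n)), k)" for n
    have \<omega>: "\<omega> \<noteq> 0" "om \<le> \<bar>\<omega>\<bar>" "km \<le> \<bar>k\<bar>" using w pos by (auto simp: wk Dinf_def)
    have vD: "v n \<in> Dinf km om" for n
    proof -
      have "\<bar>\<omega>\<bar> \<le> \<bar>\<omega> + sgn \<omega> * inverse (real (Suc n))\<bar>"
      proof -
        define e where "e = inverse (real (Suc n))"
        have "e > 0" by (simp add: e_def)
        hence "\<bar>\<omega>\<bar> \<le> \<bar>\<omega> + sgn \<omega> * e\<bar>" using \<omega>(1) by (cases "\<omega> > 0") auto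
        thus ?thesis by (simp only: e_def)
      qed
      thus ?thesis using \<omega> by (auto simp: v_def Dinf_def)
    qed
    have "(\<lambda>n. (\<omega> + sgn \<omega> * inverse (real (Suc n)), k)) \<longlonglongrightarrow> (\<omega> + sgn \<omega> * 0, k)"
      by (intro tendsto_intros LIMSEQ_inverse_real_of_nat)
    hence vlim: "v \<longlonglongrightarrow> w" by (simp add: v_def[abs_def] wk)
    have flim: "(\<lambda>n. f (v n)) \<longlonglongrightarrow> f w"
      by (rule continuous_on_tendsto_compose[OF continuous_on_sroot[OF pos, where a = a and c = c, folded f_def] vlim w])
         (use vD in auto)
    \<comment> \<open>This is the polynomial (p + q z)^2 - (\<open>x0sq\<close> + 4 nu z), which
      vanishes at every pole. It is not the zero polynomial: for \<open>q = 0\<close> its linear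
      coefficient is \<open>- 4 * nu\<close>.\<close>
    define R where "R = [: p\<^sup>2 - of_real (x0sq nu a b), 2 * p * q - 4 * of_real nu, q\<^sup>2 :]"
    define z where "z n = complex_of_real (nu * k\<^sup>2) + \<i> * complex_of_real (fst (v n) + c * k)" for n
    have "R \<noteq> 0" using pos by (cases "q = 0") (auto simp: R_def)
    hence fin: "finite {z. poly R z = 0}" by (rule poly_roots_finite)
    have "inj z"
    proof (rule injI)
      fix i j assume "z i = z j"
      hence "sgn \<omega> * inverse (real (Suc i)) = sgn \<omega> * inverse (real (Suc j))"
        using arg_cong[of "z i" "z j" Im] by (simp add: z_def v_def del: of_nat_Suc)
      thus "i = j" using \<omega>(1) by (simp add: sgn_eq_0_iff)
    qed
    hence "finite (z -` {z. poly R z = 0})" by (intro finite_vimageI fin)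
    moreover have "{n. P + Q * (f (v n))\<^sup>2 + f (v n) = 0} \<subseteq> z -` {z. poly R z = 0}"
    proof
      fix n assume "n \<in> {n. P + Q * (f (v n))\<^sup>2 + f (v n) = 0}"
      hence 0: "P + Q * (f (v n))\<^sup>2 + f (v n) = 0" by simp
      have fv2: "(f (v n))\<^sup>2 = of_real (x0sq nu a b) + 4 * of_real nu * z n"
      proof -
        have "f (v n) = sroot nu (x0sq nu a b) k (fst (v n) + c * k)" by (simp add: f_def v_def)
        thus ?thesis by (simp only: sroot_square) (simp add: z_def complex_eq_iff power2_eq_square)
      qed
      have "P + Q * (f (v n))\<^sup>2 = p + q * z n"
        unfolding fv2 P_def Q_def using pos by (simp add: field_simps)
      with 0 have "p + q * z n = - f (v n)" by (simp add: eq_neg_iff_add_eq_0)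
      hence "(p + q * z n)\<^sup>2 = (f (v n))\<^sup>2" by simp
      hence "poly R (z n) = 0" unfolding fv2 R_def by (simp add: power2_eq_square algebra_simps)
      thus "n \<in> z -` {z. poly R z = 0}" by simp
    qed
    ultimately have "finite {n. P + Q * (f (v n))\<^sup>2 + f (v n) = 0}" by (rule finite_subset[rotated])
    hence "\<forall>\<^sub>F n in sequentially. P + Q * (f (v n))\<^sup>2 + f (v n) \<noteq> 0"
      by (simp add: eventually_cofinite flip: cofinite_eq_sequentially)
    hence "\<forall>\<^sub>F n in sequentially. ?B (f (v n))"
      by eventually_elim (use all vD iff in blast)
    moreover have "(\<lambda>n. cmod (P + Q * (f (v n))\<^sup>2 - f (v n))) \<longlonglongrightarrow> cmod (P + Q * (f w)\<^sup>2 - f w)"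
      by (intro tendsto_intros flim)
    moreover have "(\<lambda>n. \<delta> * exp (L / (2*nu) * Re (f (v n))) * cmod (P + Q * (f (v n))\<^sup>2 + f (v n)))
        \<longlonglongrightarrow> \<delta> * exp (L / (2*nu) * Re (f w)) * cmod (P + Q * (f w)\<^sup>2 + f w)"
      by (intro tendsto_intros flim)
    \<comment> \<open>The bound holds at all but finitely many of the approximating points and is
      closed under limits, so it also holds at a pole.\<close>
    ultimately show "?B (f w)" by (intro tendsto_le[OF sequentially_bot])
  qed
  also have "\<dots> \<longleftrightarrow> (\<forall>S\<in>spectrum nu a b c km om. ?B S)" by (simp add: spectrum_def f_def)
  finally show ?thesis .
qed

lemma supRho_nonneg:
  assumes "km \<ge> 0" "om > 0"
  shows "0 \<le> supRho nu a b c km om p q L"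
proof -
  have "(om, km) \<in> Dinf km om" using assms by (simp add: Dinf_def)
  hence "ereal (cmod (rho nu a b c om km p q L)) \<le> supRho nu a b c km om p q L"
    unfolding supRho_def by (rule SUP_upper2) simp
  moreover have "0 \<le> ereal (cmod (rho nu a b c om km p q L))" by simp
  ultimately show ?thesis by (rule order.trans[rotated])
qed

theorem theorem5:
  fixes nu a b c km om :: real
  assumes "nu > 0" and "b \<ge> 0" and "km \<ge> 0" and "om > 0"
  defines "A \<equiv> Aconst nu a b c km om"
  shows "\<exists>P Q :: real \<Rightarrow> complex. \<exists>\<Delta> :: real \<Rightarrow> real.
     (\<forall>\<^sub>F L in at_right 0.
        (\<forall>p q. supRho nu a b c km om p q L = (INF pq. supRho nu a b c km om (fst pq) (snd pq) L)
               \<longleftrightarrow> (p = P L \<and> q = Q L))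
      \<and> ereal (\<Delta> L) = (INF pq. supRho nu a b c km om (fst pq) (snd pq) L))
   \<and> (P \<sim>[at_right 0] (\<lambda>L. complex_of_real (1/2 * root 5 (nu * A^4 / (8 * L)))))
   \<and> (Q \<sim>[at_right 0] (\<lambda>L. complex_of_real (4 * root 5 (nu^2 * L^3 / (2 * A^2)))))
   \<and> ((\<lambda>L. complex_of_real (1 - \<Delta> L)) \<sim>[at_right 0] (\<lambda>L. complex_of_real A / (2 * P L)))"
proof -
  define X where "X = x0sq nu a b"
  define K where "K = spectrum nu a b c km om"
  note pos = assms(1-4)
  obtain S0 where "sector_set K nu (A / 4) (X + 4 * nu\<^sup>2 * km\<^sup>2) (max 1 (2 * nu * (om + \<bar>c\<bar> * km))) S0"
    using sector_set_spectrum[OF pos] unfolding A_def X_def K_def by blast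
  then interpret sector_set K nu "A / 4" "X + 4 * nu\<^sup>2 * km\<^sup>2" "max 1 (2 * nu * (om + \<bar>c\<bar> * km))" S0 .
  have Apos: "A > 0" using m_pos by simp
  have kap5: "kappa_opt ^ 5 = 8 * A / nu" using kappa_opt_power5 nu_pos by (simp add: field_simps)
  have alpha_opt: "alpha_opt = A / (2 * kappa_opt)" by (simp add: alpha_opt_def)
  \<comment> \<open>This fifth power and the next one convert the limiting constants into the stated
    fifth roots.\<close>
  have al5: "(2 * alpha_opt) ^ 5 = nu * A ^ 4 / 8"
  proof -
    have "(2 * alpha_opt) ^ 5 = A ^ 5 / kappa_opt ^ 5" by (simp add: alpha_opt power_divide)
    also have "\<dots> = nu * A ^ 4 / 8" unfolding kap5 using Apos nu_pos by (simp add: power_numeral_reduce)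
    finally show ?thesis .
  qed
  have be5: "(nu * beta_opt) ^ 5 = nu\<^sup>2 / (2 * A\<^sup>2)"
  proof -
    have "(nu * beta_opt) ^ 5 = 32 / (kappa_opt ^ 5)\<^sup>2"
      using nu_pos by (simp add: beta_opt_def power_divide flip: power_mult)
    also have "\<dots> = nu\<^sup>2 / (2 * A\<^sup>2)"
      unfolding kap5 using Apos nu_pos by (simp add: power_divide power_mult_distrib)
    finally show ?thesis .
  qed
  obtain \<alpha> \<beta> D where lim: "(\<alpha> \<longlongrightarrow> of_real alpha_opt) (at_right 0)" "(\<beta> \<longlongrightarrow> of_real beta_opt) (at_right 0)"
    "((\<lambda>h. (1 - D h) / h) \<longlongrightarrow> kappa_opt) (at_right 0)"
    and opt: "\<forall>\<^sub>F h in at_right 0. optimum (h ^ 5) (D h) (\<alpha> h / of_real h) (\<beta> h * of_real h ^ 3)"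
    using optimum_asymptotics by blast
  define h where "h L = root 5 L" for L :: real
  \<comment> \<open>Inverts the change of parameters. The correction to the first parameter is of
    order \<open>h ^ 3\<close>, against a leading term of order \<open>1 / h\<close>, and does not
    affect the asymptotics.\<close>
  define P where "P L = \<alpha> (h L) / of_real (h L) + \<beta> (h L) * of_real (h L) ^ 3 * of_real X" for L
  define Q where "Q L = of_real (4 * nu) * (\<beta> (h L) * of_real (h L) ^ 3)" for L
  define \<Delta> where "\<Delta> L = D (h L)" for L
  have h_pos: "h L > 0" and h5: "h L ^ 5 = L" if "L > 0" for L
    using that by (simp_all add: h_def)
  have Lpos: "\<forall>\<^sub>F L::real in at_right 0. L > 0" by (rule eventually_at_right_less)
  have hlim: "filterlim h (at_right 0) (at_right 0)"
  proof -
    have "(h \<longlongrightarrow> root 5 0) (at_right 0)" unfolding h_def[abs_def] by (intro tendsto_intros)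
    moreover have "\<forall>\<^sub>F L in at_right 0. h L \<in> {0<..}" using Lpos by eventually_elim (simp add: h_pos)
    ultimately show ?thesis by (auto simp: filterlim_at elim: eventually_mono)
  qed
  have lim': "((\<lambda>L. \<alpha> (h L)) \<longlongrightarrow> of_real alpha_opt) (at_right 0)" "((\<lambda>L. \<beta> (h L)) \<longlongrightarrow> of_real beta_opt) (at_right 0)"
    "((\<lambda>L. (1 - \<Delta> L) / h L) \<longlongrightarrow> kappa_opt) (at_right 0)"
    unfolding \<Delta>_def by (rule filterlim_compose[OF lim(1) hlim], rule filterlim_compose[OF lim(2) hlim],
      rule filterlim_compose[OF lim(3) hlim])
  have h0: "((\<lambda>L. complex_of_real (h L)) \<longlongrightarrow> 0) (at_right 0)"
    using hlim by (auto simp: filterlim_at intro: tendsto_eq_intros)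
  have hP: "((\<lambda>L. of_real (h L) * P L) \<longlongrightarrow> of_real alpha_opt) (at_right 0)"
  proof -
    have "((\<lambda>L. \<alpha> (h L) + \<beta> (h L) * of_real (h L) ^ 4 * of_real X) \<longlongrightarrow> of_real alpha_opt + of_real beta_opt * 0 ^ 4 * of_real X) (at_right 0)"
      by (intro tendsto_intros lim' h0)
    moreover have "\<forall>\<^sub>F L in at_right 0. \<alpha> (h L) + \<beta> (h L) * of_real (h L) ^ 4 * of_real X = of_real (h L) * P L"
      using Lpos
    proof eventually_elim
      case (elim L)
      with h_pos[OF elim] show ?case by (simp add: P_def field_simps power_numeral_reduce)
    qed
    ultimately show ?thesis using Lim_transform_eventually by fastforce
  qed
  have "\<forall>\<^sub>F L in at_right 0. optimum (h L ^ 5) (\<Delta> L) (\<alpha> (h L) / of_real (h L)) (\<beta> (h L) * of_real (h L) ^ 3)"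
    unfolding \<Delta>_def by (rule eventually_compose_filterlim[OF opt hlim])
  with Lpos have best_approx: "\<forall>\<^sub>F L in at_right 0.
        (\<forall>p q. supRho nu a b c km om p q L = (INF pq. supRho nu a b c km om (fst pq) (snd pq) L)
               \<longleftrightarrow> (p = P L \<and> q = Q L))
      \<and> ereal (\<Delta> L) = (INF pq. supRho nu a b c km om (fst pq) (snd pq) L)"
  proof eventually_elim
    case (elim L)
    define P' Q' where "P' p q = p - q * of_real (X / (4 * nu))" and "Q' q = q / of_real (4 * nu)" for p q :: complex
    have opt: "optimum L (\<Delta> L) (\<alpha> (h L) / of_real (h L)) (\<beta> (h L) * of_real (h L) ^ 3)"
      using elim h5 by simp
    hence \<Delta>0: "\<Delta> L \<ge> 0" by (simp add: optimum_def)
    have le_iff: "supRho nu a b c km om p q L \<le> ereal \<delta> \<longleftrightarrow> feas L \<delta> (P' p q) (Q' q)" if "\<delta> \<ge> 0" for p q \<delta>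
      unfolding feas_def unfolding K_def P'_def Q'_def X_def by (rule supRho_le_iff[OF pos that])
    have ge: "ereal (\<Delta> L) \<le> supRho nu a b c km om p q L" for p q
    proof (rule ccontr)
      assume less: "\<not> ?thesis"
      have nn: "0 \<le> supRho nu a b c km om p q L" using pos by (intro supRho_nonneg)
      \<comment> \<open>A nonnegative extended real below a finite bound is finite, so the
        equivalence with feasibility applies at its real value.\<close>
      obtain \<delta> where \<delta>: "supRho nu a b c km om p q L = ereal \<delta>"
        using less nn by (cases "supRho nu a b c km om p q L") auto
      have \<delta>0: "\<delta> \<ge> 0" using nn \<delta> by simp
      have "feas L \<delta> (P' p q) (Q' q)" by (rule le_iff[OF \<delta>0, THEN iffD1]) (simp add: \<delta>)
      with \<delta>0 have "\<Delta> L \<le> \<delta>" using opt by (auto simp: optimum_def)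
      with less \<delta> show False by simp
    qed
    have sol: "supRho nu a b c km om p q L \<le> ereal (\<Delta> L) \<longleftrightarrow> p = P L \<and> q = Q L" for p q
    proof -
      have "supRho nu a b c km om p q L \<le> ereal (\<Delta> L) \<longleftrightarrow>
          P' p q = \<alpha> (h L) / of_real (h L) \<and> Q' q = \<beta> (h L) * of_real (h L) ^ 3"
        using le_iff[OF \<Delta>0] opt by (simp add: optimum_def)
      also have "\<dots> \<longleftrightarrow> p = P L \<and> q = Q L"
      proof -
        have "Q' q = \<beta> (h L) * of_real (h L) ^ 3 \<longleftrightarrow> q = Q L"
          using pos by (auto simp: Q'_def Q_def divide_eq_eq mult_ac)
        moreover have "P' p (Q L) = \<alpha> (h L) / of_real (h L) \<longleftrightarrow> p = P L"
          using pos by (auto simp: P'_def P_def Q_def diff_eq_eq mult.assoc)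
        ultimately show ?thesis by blast
      qed
      finally show ?thesis .
    qed
    have INF: "(INF pq. supRho nu a b c km om (fst pq) (snd pq) L) = ereal (\<Delta> L)"
    proof (rule antisym)
      have "(INF pq. supRho nu a b c km om (fst pq) (snd pq) L) \<le> supRho nu a b c km om (P L) (Q L) L"
        by (rule INF_lower2[of "(P L, Q L)"]) auto
      also have "\<dots> \<le> ereal (\<Delta> L)" using sol by blast
      finally show "(INF pq. supRho nu a b c km om (fst pq) (snd pq) L) \<le> ereal (\<Delta> L)" .
    qed (rule INF_greatest, rule ge)
    have "supRho nu a b c km om p q L = ereal (\<Delta> L) \<longleftrightarrow> p = P L \<and> q = Q L" for p q
      using sol[of p q] ge[of p q] by (auto intro: antisym)
    thus ?case unfolding INF by simp
  qed
  have P_asymp: "P \<sim>[at_right 0] (\<lambda>L. complex_of_real (1/2 * root 5 (nu * A^4 / (8 * L))))"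
  proof (rule asymp_equivI')
    have "((\<lambda>L. of_real (h L) * P L / of_real alpha_opt) \<longlongrightarrow> of_real alpha_opt / of_real alpha_opt) (at_right 0)"
      using alpha_opt_pos by (intro tendsto_intros hP) auto
    hence "((\<lambda>L. of_real (h L) * P L / of_real alpha_opt) \<longlongrightarrow> 1) (at_right 0)" using alpha_opt_pos by simp
    moreover have "\<forall>\<^sub>F L in at_right 0. of_real (h L) * P L / of_real alpha_opt
        = P L / complex_of_real (1/2 * root 5 (nu * A^4 / (8 * L)))" using Lpos
    proof eventually_elim
      case (elim L)
      have "(2 * alpha_opt / h L) ^ 5 = nu * A^4 / (8 * L)"
        by (simp only: power_divide al5 h5[OF elim] divide_divide_eq_left)
      hence "root 5 (nu * A^4 / (8 * L)) = 2 * alpha_opt / h L"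
        by (intro real_root_pos_unique) (use alpha_opt_pos h_pos[OF elim] in auto)
      thus ?case using h_pos[OF elim] by simp
    qed
    ultimately show "((\<lambda>L. P L / complex_of_real (1/2 * root 5 (nu * A^4 / (8 * L)))) \<longlongrightarrow> 1) (at_right 0)"
      by (rule Lim_transform_eventually)
  qed
  have Q_asymp: "Q \<sim>[at_right 0] (\<lambda>L. complex_of_real (4 * root 5 (nu^2 * L^3 / (2 * A^2))))"
  proof (rule asymp_equivI')
    have "((\<lambda>L. \<beta> (h L) / of_real beta_opt) \<longlongrightarrow> of_real beta_opt / of_real beta_opt) (at_right 0)"
      using beta_opt_pos by (intro tendsto_intros lim') auto
    hence "((\<lambda>L. \<beta> (h L) / of_real beta_opt) \<longlongrightarrow> 1) (at_right 0)" using beta_opt_pos by simp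
    moreover have "\<forall>\<^sub>F L in at_right 0. \<beta> (h L) / of_real beta_opt
        = Q L / complex_of_real (4 * root 5 (nu^2 * L^3 / (2 * A^2)))" using Lpos
    proof eventually_elim
      case (elim L)
      have "(nu * beta_opt * h L ^ 3) ^ 5 = (nu * beta_opt) ^ 5 * (h L ^ 5) ^ 3"
        by (simp only: power_mult_distrib mult.commute flip: power_mult)
      also have "\<dots> = nu\<^sup>2 * L ^ 3 / (2 * A\<^sup>2)" by (simp only: be5 h5[OF elim] times_divide_eq_left)
      finally have "(nu * beta_opt * h L ^ 3) ^ 5 = nu\<^sup>2 * L ^ 3 / (2 * A\<^sup>2)" .
      hence "root 5 (nu^2 * L^3 / (2 * A^2)) = nu * beta_opt * h L ^ 3"
        by (intro real_root_pos_unique) (use beta_opt_pos nu_pos h_pos[OF elim] in auto)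
      thus ?case using h_pos[OF elim] nu_pos by (simp add: Q_def)
    qed
    ultimately show "((\<lambda>L. Q L / complex_of_real (4 * root 5 (nu^2 * L^3 / (2 * A^2)))) \<longlongrightarrow> 1) (at_right 0)"
      by (rule Lim_transform_eventually)
  qed
  have \<Delta>_asymp: "(\<lambda>L. complex_of_real (1 - \<Delta> L)) \<sim>[at_right 0] (\<lambda>L. complex_of_real A / (2 * P L))"
  proof (rule asymp_equivI')
    have "((\<lambda>L. of_real ((1 - \<Delta> L) / h L) * (2 * (of_real (h L) * P L)) / of_real A)
        \<longlongrightarrow> of_real kappa_opt * (2 * of_real alpha_opt) / of_real A) (at_right 0)"
      using Apos by (intro tendsto_intros hP lim') auto
    \<comment> \<open>The relation \<kappa> = A / (2 \<alpha>) links the rate of the optimal level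
      to the leading term of the first parameter.\<close>
    moreover have "complex_of_real kappa_opt * (2 * of_real alpha_opt) / of_real A = 1"
      using kappa_opt_pos Apos by (simp add: alpha_opt)
    ultimately have "((\<lambda>L. of_real ((1 - \<Delta> L) / h L) * (2 * (of_real (h L) * P L)) / of_real A) \<longlongrightarrow> 1) (at_right 0)"
      by simp
    moreover have "\<forall>\<^sub>F L in at_right 0. of_real ((1 - \<Delta> L) / h L) * (2 * (of_real (h L) * P L)) / of_real A
        = complex_of_real (1 - \<Delta> L) / (complex_of_real A / (2 * P L))" using Lpos
    proof eventually_elim
      case (elim L)
      thus ?case using h_pos[OF elim] by simp
    qed
    ultimately show "((\<lambda>L. complex_of_real (1 - \<Delta> L) / (complex_of_real A / (2 * P L))) \<longlongrightarrow> 1) (at_right 0)"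
      by (rule Lim_transform_eventually)
  qed
  from best_approx P_asymp Q_asymp \<Delta>_asymp show ?thesis by blast
qed

end
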